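(* Let $n\ge 2$, let $M$ be an $(n-1)$-space group, and let $\Delta$ be an infinite cyclic $1$-space group. The set $\mathrm{Iso}(\Delta,M)$ is in one-to-one correspondence with the set of conjugacy classes of pairs of inverse elements of $\mathrm{Out}(M)$ of finite order. If $[\Gamma,N]\in\mathrm{Iso}(\Delta,M)$, $\alpha:N\to M$ is an isomorphism, and $\gamma$ is an element of $\Gamma$ such that $N\gamma$ generates $\Gamma/N$, then $[\Gamma,N]$ corresponds to the conjugacy class of the pair of inverse elements $\{\alpha\gamma_\ast\alpha^{-1}\mathrm{Inn}(M),\ \alpha\gamma_\ast^{-1}\alpha^{-1}\mathrm{Inn}(M)\}$ of $\mathrm{Out}(M)$.
   Context: A $k$-space group is a discrete group $\Gamma$ of isometries of Euclidean $k$-space $E^k$ such that the orbit space $E^k/\Gamma$ is compact. For a $1$-space group $\Delta$ and an $(n-1)$-space group $M$, $\mathrm{Iso}(\Delta,M)$ is the set of isomorphism classes $[\Gamma,N]$ of pairs $(\Gamma,N)$, where $\Gamma$ is an $n$-space group and $N$ is a normal subgroup of $\Gamma$ with $N$ isomorphic to $M$ and $\Gamma/N$ isomorphic to $\Delta$; two pairs $(\Gamma_1,N_1)$, $(\Gamma_2,N_2)$ are isomorphic if there is a group isomorphism $\phi:\Gamma_1\to\Gamma_2$ with $\phi(N_1)=N_2$. For $\gamma\in\Gamma$, $\gamma_\ast$ denotes the automorphism $\nu\mapsto\gamma\nu\gamma^{-1}$ of $N$. $\mathrm{Out}(M)=\mathrm{Aut}(M)/\mathrm{Inn}(M)$. A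 pair $\{x,y\}$ is an unordered pair (possibly $x=y$); a pair of inverse elements is $\{x,x^{-1}\}$. The conjugacy class of $\{x,y\}$ consists of all $\{gxg^{-1},gyg^{-1}\}$ with $g\in\mathrm{Out}(M)$. *)

theory Defs
  imports
    "HOL-Analysis.Analysis"
    "HOL-Algebra.Bij"
    "HOL-Algebra.Elementary_Groups"
    "HOL-Algebra.Group_Action"
begin

type_synonym 'n selfmap = "(real, 'n) vec \<Rightarrow> (real, 'n) vec"

definition isom_group :: "('n::finite) selfmap monoid" where
  "isom_group =
     \<lparr>carrier = {f. surj f \<and> (\<forall>x y. dist (f x) (f y) = dist x y)}, mult = (\<circ>), one = id\<rparr>"

lemma group_isom_group: "group (isom_group :: ('n::finite) selfmap monoid)"
proof (rule groupI)
  fix f :: "'n selfmap"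
  assume "f \<in> carrier isom_group"
  then have f: "surj f" "\<And>x y. dist (f x) (f y) = dist x y"
    by (auto simp: isom_group_def)
  let ?g = "inv_into UNIV f"
  have "inj f"
    by (metis f(2) dist_eq_0_iff injI)
  then have "surj ?g" "?g \<circ> f = id"
    by (simp_all add: inj_imp_surj_inv)
  moreover have "dist (?g x) (?g y) = dist x y" for x y
    by (metis f surj_f_inv_f)
  ultimately show "\<exists>g\<in>carrier isom_group. g \<otimes>\<^bsub>isom_group\<^esub> f = \<one>\<^bsub>isom_group\<^esub>"
    by (auto simp: isom_group_def)
qed (auto simp: isom_group_def comp_assoc comp_surj simp del: comp_apply, simp_all add: comp_apply)

abbreviation grp :: "('n::finite) selfmap set \<Rightarrow> 'n selfmap monoid" where
  "grp \<Gamma> \<equiv> isom_group \<lparr>carrier := \<Gamma>\<rparr>"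

definition compact_open_topology :: "('n::finite) selfmap topology" where
  "compact_open_topology =
     topology_generated_by {{f. f ` K \<subseteq> U} | K U. compact K \<and> open U}"

definition discrete_isometries :: "('n::finite) selfmap set \<Rightarrow> bool" where
  "discrete_isometries \<Gamma> \<longleftrightarrow> subtopology compact_open_topology \<Gamma> = discrete_topology \<Gamma>"

abbreviation orb :: "('n::finite) selfmap set \<Rightarrow> real^'n \<Rightarrow> (real^'n) set" where
  "orb \<Gamma> \<equiv> orbit (grp \<Gamma>) (\<lambda>g. g)"

text \<open>The quotient topology of \<open>orb \<Gamma>\<close>.\<close>

definition orbit_space :: "('n::finite) selfmap set \<Rightarrow> (real^'n) set topology" where
  "orbit_space \<Gamma> =
     topology (\<lambda>U. U \<subseteq> orbits (grp \<Gamma>) UNIV (\<lambda>g. g) \<and> open {x. orb \<Gamma> x \<in> U})"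

lemma openin_orbit_space:
  "openin (orbit_space \<Gamma>) U \<longleftrightarrow>
     U \<subseteq> orbits (grp \<Gamma>) UNIV (\<lambda>g. g) \<and> open {x. orb \<Gamma> x \<in> U}"
proof -
  have "{x. orb \<Gamma> x \<in> \<Union> K} = (\<Union>U\<in>K. {x. orb \<Gamma> x \<in> U})" for K
    by auto
  then have "istopology (\<lambda>U. U \<subseteq> orbits (grp \<Gamma>) UNIV (\<lambda>g. g) \<and> open {x. orb \<Gamma> x \<in> U})"
    unfolding istopology_def
    by (auto simp: Collect_conj_eq intro!: open_Int open_UN)
  then show ?thesis
    by (simp add: orbit_space_def topology_inverse')
qed

text \<open>\<open>k\<close>-space groups, where \<open>k = CARD('n)\<close>.\<close>

definition space_group :: "('n::finite) selfmap set \<Rightarrow> bool" where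
  "space_group \<Gamma> \<longleftrightarrow>
     subgroup \<Gamma> isom_group \<and> discrete_isometries \<Gamma> \<and> compact_space (orbit_space \<Gamma>)"

definition iso_pairs ::
    "1 selfmap set \<Rightarrow> ('m::finite) selfmap set \<Rightarrow> (('n::finite) selfmap set \<times> 'n selfmap set) set"
  where
  "iso_pairs \<Delta> M =
     {(\<Gamma>, N). space_group \<Gamma> \<and> N \<lhd> grp \<Gamma> \<and> grp N \<cong> grp M \<and> grp \<Gamma> Mod N \<cong> grp \<Delta>}"

definition pair_rel ::
    "1 selfmap set \<Rightarrow> ('m::finite) selfmap set \<Rightarrow>
       ((('n::finite) selfmap set \<times> 'n selfmap set) \<times> ('n selfmap set \<times> 'n selfmap set)) set"
  where
  "pair_rel \<Delta> M =
     {((\<Gamma>\<^sub>1, N\<^sub>1), (\<Gamma>\<^sub>2, N\<^sub>2)). (\<Gamma>\<^sub>1, N\<^sub>1) \<in> iso_pairs \<Delta> M \<and> (\<Gamma>\<^sub>2, N\<^sub>2) \<in> iso_pairs \<Delta> M \<and>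
        (\<exists>\<phi> \<in> iso (grp \<Gamma>\<^sub>1) (grp \<Gamma>\<^sub>2). \<phi> ` N\<^sub>1 = N\<^sub>2)}"

definition Iso ::
    "1 selfmap set \<Rightarrow> ('m::finite) selfmap set \<Rightarrow> (('n::finite) selfmap set \<times> 'n selfmap set) set set"
  where "Iso \<Delta> M = iso_pairs \<Delta> M // pair_rel \<Delta> M"

definition iso_class ::
    "1 selfmap set \<Rightarrow> ('m::finite) selfmap set \<Rightarrow> ('n::finite) selfmap set \<Rightarrow> 'n selfmap set \<Rightarrow>
       ('n selfmap set \<times> 'n selfmap set) set"
  where "iso_class \<Delta> M \<Gamma> N = pair_rel \<Delta> M `` {(\<Gamma>, N)}"

text \<open>Automorphisms are restricted to the carrier, as in \<^const>\<open>AutoGroup\<close>.\<close>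

definition conj_aut :: "('a, 'b) monoid_scheme \<Rightarrow> 'a set \<Rightarrow> 'a \<Rightarrow> 'a \<Rightarrow> 'a" where
  "conj_aut G N g = (\<lambda>x\<in>N. g \<otimes>\<^bsub>G\<^esub> x \<otimes>\<^bsub>G\<^esub> inv\<^bsub>G\<^esub> g)"

definition Inn :: "('a, 'b) monoid_scheme \<Rightarrow> ('a \<Rightarrow> 'a) set" where
  "Inn G = conj_aut G (carrier G) ` carrier G"

definition Out :: "('a, 'b) monoid_scheme \<Rightarrow> ('a \<Rightarrow> 'a) set monoid" where
  "Out G = AutoGroup G Mod Inn G"

definition finite_order :: "('a, 'b) monoid_scheme \<Rightarrow> 'a \<Rightarrow> bool" where
  "finite_order G x \<longleftrightarrow> (\<exists>k::nat. k > 0 \<and> x [^]\<^bsub>G\<^esub> k = \<one>\<^bsub>G\<^esub>)"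

definition conj_class :: "('a, 'b) monoid_scheme \<Rightarrow> 'a set \<Rightarrow> 'a set set" where
  "conj_class G P = {(\<lambda>x. g \<otimes>\<^bsub>G\<^esub> x \<otimes>\<^bsub>G\<^esub> inv\<^bsub>G\<^esub> g) ` P | g. g \<in> carrier G}"

definition inverse_pair_classes :: "('a, 'b) monoid_scheme \<Rightarrow> 'a set set set" where
  "inverse_pair_classes G =
     {conj_class G {x, inv\<^bsub>G\<^esub> x} | x. x \<in> carrier G \<and> finite_order G x}"

text \<open>The automorphism \<open>\<alpha> \<phi> \<alpha>\<inverse>\<close> of \<open>M\<close>, for \<open>\<alpha> : N \<rightarrow> M\<close> and \<open>\<phi> : N \<rightarrow> N\<close>.\<close>

definition transport :: "'a set \<Rightarrow> 'b set \<Rightarrow> ('a \<Rightarrow> 'b) \<Rightarrow> ('a \<Rightarrow> 'a) \<Rightarrow> 'b \<Rightarrow> 'b" where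
  "transport N M \<alpha> \<phi> = compose M \<alpha> (compose M \<phi> (inv_into N \<alpha>))"

end

theory Submission
  imports Defs
begin

text \<open>Since \<open>\<Gamma>/N\<close> is infinite cyclic, \<open>\<Gamma>\<close> is a semidirect product of \<open>N\<close> with the integers, so \<open>(\<Gamma>, N)\<close> is
  determined up to isomorphism by the class of \<open>\<gamma>\<^sub>*\<close> in \<open>Out N\<close> up to inversion and conjugation.
  The geometry decides which classes occur. By Bieberbach's first theorem (proved following
  Buser) a space group has a finite point group. Hence a power of \<open>\<gamma>\<close> is a translation, and a
  further power acts on \<open>N\<close> as an inner automorphism. Conversely, an automorphism \<open>\<theta>\<close> of \<open>M\<close> is
  induced by an affine map; if \<open>\<theta>\<close> has finite order in \<open>Out M\<close>, averaging yields an inner product in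
  which this map and \<open>M\<close> act by isometries. Adding a unit translation in a new direction to the
  map, and letting \<open>M\<close> act trivially there, generates the desired \<open>\<Gamma>\<close>.\<close>


section \<open>Isometries of Euclidean space\<close>

text \<open>The two halves meet different obstacles. Necessity: \<open>N\<close> is only an abstract
  copy of \<open>M\<close> and is not given as a group acting on a space of dimension n - 1, so
  finite order is extracted from the geometry of \<Gamma> alone. Sufficiency: the affine map
  inducing \<theta> need not be an isometry, and for \<theta> of infinite order in Out M its linear
  part can be hyperbolic, with no invariant inner product. Finite order makes a power of the linear
  part orthogonal, so that a finite sum of pulled back inner products is invariant. Moreover
  \<theta> is not known in advance to preserve translations; its linear part is therefore read off
  on a sublattice that is stable by construction. Inverse pairs enter because an infinite cyclic
  group has exactly two generators, conjugacy because the identification of \<open>N\<close> with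
  \<open>M\<close> is arbitrary, and Out instead of Aut because the lift of a generator is
  determined only up to \<open>N\<close>. The bound 1/2 on rotations in Bieberbach's theorem is
  chosen so that a commutator with such an element rotates no more than the other factor
  does.\<close>

definition lin :: "('a::real_vector \<Rightarrow> 'a) \<Rightarrow> 'a \<Rightarrow> 'a" where
  "lin f = (\<lambda>x. f x - f 0)"

lemma isom_groupD:
  assumes "f \<in> carrier isom_group"
  shows "surj f" "dist (f x) (f y) = dist x y"
  using assms by (auto simp: isom_group_def)

lemma isom_group_simps [simp]:
  "f \<otimes>\<^bsub>isom_group\<^esub> g = f \<circ> g" "\<one>\<^bsub>isom_group\<^esub> = id"
  by (simp_all add: isom_group_def)

abbreviation inv_isom :: "('n::finite) selfmap \<Rightarrow> 'n selfmap" where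
  "inv_isom f \<equiv> inv\<^bsub>isom_group\<^esub> f"

lemma inv_isom_group:
  fixes f :: "('n::finite) selfmap"
  assumes "f \<in> carrier isom_group"
  shows "inv_isom f \<circ> f = id" "f \<circ> inv_isom f = id"
    "(inv_isom f) (f x) = x" "f ((inv_isom f) x) = x"
    "inv_isom f \<in> carrier isom_group"
proof -
  interpret group "isom_group :: 'n selfmap monoid" by (rule group_isom_group)
  show 1: "inv_isom f \<circ> f = id" "f \<circ> inv_isom f = id"
    using l_inv[OF assms] r_inv[OF assms] by simp_all
  show "(inv_isom f) (f x) = x" "f ((inv_isom f) x) = x"
    using 1 by (metis comp_apply id_apply)+
  show "inv_isom f \<in> carrier isom_group"
    using assms by simp
qed

text \<open>Subtracting \<open>f 0\<close> leaves an isometry fixing the origin, and such a map is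
  orthogonal.\<close>

lemma lin_isom:
  fixes f :: "('n::finite) selfmap"
  assumes "f \<in> carrier isom_group"
  shows "linear (lin f)" "norm (lin f x) = norm x" "lin f x \<bullet> lin f y = x \<bullet> y"
    "inj (lin f)" "surj (lin f)"
proof -
  have "orthogonal_transformation (lin f)"
    unfolding orthogonal_transformation_isometry
    using isom_groupD(2)[OF assms] by (simp add: lin_def dist_norm)
  then show "linear (lin f)" "norm (lin f x) = norm x" "lin f x \<bullet> lin f y = x \<bullet> y"
    "inj (lin f)" "surj (lin f)"
    using orthogonal_transformation_inj[of "lin f"] orthogonal_transformation_surj[of "lin f"]
      orthogonal_transformation_norm[of "lin f"]
    by (simp_all add: orthogonal_transformation_def)
qed

lemma isom_eq_lin: "f x = lin f x + f 0"
  by (simp add: lin_def)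

lemma lin_0 [simp]: "lin f 0 = 0"
  by (simp add: lin_def)

lemma lin_id [simp]: "lin id = id"
  by (auto simp: lin_def)

lemma lin_comp:
  fixes f g :: "('n::finite) selfmap"
  assumes "f \<in> carrier isom_group"
  shows "lin (f \<circ> g) = lin f \<circ> lin g"
proof
  fix x
  interpret linear "lin f" using assms by (rule lin_isom)
  have "lin (f \<circ> g) x = f (g x) - f (g 0)" by (simp add: lin_def)
  also have "\<dots> = lin f (g x) - lin f (g 0)" by (simp add: lin_def)
  also have "\<dots> = lin f (lin g x)" unfolding diff[symmetric] by (simp add: lin_def)
  finally show "lin (f \<circ> g) x = (lin f \<circ> lin g) x" by simp
qed

lemma lin_inv:
  fixes f :: "('n::finite) selfmap"
  assumes "f \<in> carrier isom_group"
  shows "lin (inv_isom f) \<circ> lin f = id" "lin f \<circ> lin (inv_isom f) = id"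
    "lin (inv_isom f) (lin f x) = x" "lin f (lin (inv_isom f) x) = x"
proof -
  show 1: "lin (inv_isom f) \<circ> lin f = id" "lin f \<circ> lin (inv_isom f) = id"
    using assms by (simp_all add: lin_comp[symmetric] inv_isom_group)
  show "lin (inv_isom f) (lin f x) = x" "lin f (lin (inv_isom f) x) = x"
    using 1 by (metis comp_apply id_apply)+
qed

lemma isom_norm_inv_0:
  fixes f :: "('n::finite) selfmap"
  assumes "f \<in> carrier isom_group"
  shows "norm ((inv_isom f) 0) = norm (f 0)"
  using isom_groupD(2)[OF assms, of "(inv_isom f) 0" 0] inv_isom_group[OF assms]
  by (simp add: dist_norm)

section \<open>Space groups as uniformly discrete, relatively dense groups\<close>

text \<open>On a group of isometries, discreteness in the compact-open topology means that only finitely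
  many elements move the origin by a bounded amount, and compactness of the orbit space means that
  the orbit of the origin is relatively dense.\<close>

locale isometry_group =
  fixes G :: "('n::finite) selfmap set"
  assumes subgp: "subgroup G isom_group"
begin

sublocale isom: group "isom_group :: 'n selfmap monoid"
  by (rule group_isom_group)

lemma carr: "g \<in> G \<Longrightarrow> g \<in> carrier isom_group"
  using subgp by (rule subgroup.mem_carrier)

lemma comp_mem: "f \<in> G \<Longrightarrow> g \<in> G \<Longrightarrow> f \<circ> g \<in> G"
  using subgroup.m_closed[OF subgp] by simp

lemma id_mem: "id \<in> G"
  using subgroup.one_closed[OF subgp] by simp

lemma inv_mem: "f \<in> G \<Longrightarrow> inv_isom f \<in> G"
  using subgroup.m_inv_closed[OF subgp] by simp

lemma grp: "group (grp G)"
  using subgroup.subgroup_is_group[OF subgp group_isom_group] .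

lemma orb_eq: "orb G x = {g x | g. g \<in> G}"
  by (simp add: orbit_def)

lemma orb_eq_iff: "orb G x = orb G y \<longleftrightarrow> (\<exists>g\<in>G. y = g x)"
proof
  assume "orb G x = orb G y"
  moreover have "y \<in> orb G y" using id_mem by (auto simp: orb_eq) (metis id_apply)
  ultimately show "\<exists>g\<in>G. y = g x" by (auto simp: orb_eq)
next
  assume "\<exists>g\<in>G. y = g x"
  then obtain g where g: "g \<in> G" "y = g x" by blast
  have "f x \<in> orb G y" if "f \<in> G" for f
  proof -
    have "f x = (f \<circ> inv_isom g) y" using g by (simp add: inv_isom_group carr)
    then show ?thesis unfolding orb_eq using comp_mem[OF that inv_mem[OF g(1)]] by blast
  qed
  moreover have "f y \<in> orb G x" if "f \<in> G" for f
  proof -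
    have "f y = (f \<circ> g) x" using g by simp
    then show ?thesis unfolding orb_eq using comp_mem[OF that g(1)] by blast
  qed
  ultimately show "orb G x = orb G y" unfolding orb_eq by blast
qed

text \<open>Images of the open balls about 0 form an open cover of the orbit space, so a finite
  subcover bounds the distance from any point to the orbit of 0. Conversely the bound makes a
  compact ball meet every orbit, and covers of the orbit space pull back to that ball.\<close>

lemma compact_orbit_space_iff:
  "compact_space (orbit_space G) \<longleftrightarrow> (\<exists>d. \<forall>x. \<exists>g\<in>G. dist (g 0) x \<le> d)"
proof -
  let ?X = "orbit_space G"
  have mem: "orb G x \<in> orbits (grp G) UNIV (\<lambda>g. g)" for x by (auto simp: orbits_def)
  have top: "topspace ?X = orbits (grp G) UNIV (\<lambda>g. g)"
  proof
    show "topspace ?X \<subseteq> orbits (grp G) UNIV (\<lambda>g. g)"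
      using openin_topspace[of ?X] unfolding openin_orbit_space by blast
    have "openin ?X (orbits (grp G) UNIV (\<lambda>g. g))"
      unfolding openin_orbit_space by (auto simp: mem)
    then show "orbits (grp G) UNIV (\<lambda>g. g) \<subseteq> topspace ?X" by (rule openin_subset)
  qed
  show ?thesis
  proof
    assume c: "compact_space ?X"
    define U where "U r = orb G ` ball 0 r" for r :: real
    have U_iff: "orb G x \<in> U r \<longleftrightarrow> (\<exists>g\<in>G. norm (g x) < r)" for x r
      unfolding U_def by (auto simp: orb_eq_iff image_iff)
    have opn: "openin ?X (U r)" for r
    proof -
      have "{x. orb G x \<in> U r} = (\<Union>g\<in>G. {x. norm (g x) < r})" by (auto simp: U_iff)
      moreover have "open {x. norm (g x) < r}" if "g \<in> G" for g
      proof -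
        have "continuous_on UNIV g"
          unfolding continuous_on_iff using isom_groupD(2)[OF carr[OF that]] by auto
        then show ?thesis by (intro open_Collect_less continuous_intros)
      qed
      ultimately show ?thesis unfolding openin_orbit_space by (auto simp: U_def mem)
    qed
    have "topspace ?X \<subseteq> \<Union> (U ` UNIV)"
    proof
      fix c assume "c \<in> topspace ?X"
      then obtain x where "c = orb G x" unfolding top orbits_def by blast
      then have "c \<in> U (norm x + 1)" unfolding U_def by auto
      then show "c \<in> \<Union> (U ` UNIV)" by blast
    qed
    then obtain F where F: "finite F" "F \<subseteq> U ` UNIV" "topspace ?X \<subseteq> \<Union> F"
      using c opn unfolding compact_space_alt by (metis (no_types, lifting) imageE)
    then obtain R where R: "finite R" "F = U ` R" by (meson finite_subset_image)
    define d where "d = Max (insert 0 R)"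
    have "\<exists>g\<in>G. dist (g 0) x \<le> d" for x
    proof -
      have "orb G x \<in> \<Union> F" using F(3) mem top by blast
      then obtain r g where r: "r \<in> R" "g \<in> G" "norm (g x) < r" using R U_iff by auto
      have "dist ((inv_isom g) 0) x = norm (g x)"
        using isom_groupD(2)[OF carr[OF r(2)], of "(inv_isom g) 0" x]
          inv_isom_group[OF carr[OF r(2)]] by (simp add: dist_norm)
      moreover have "r \<le> d" using R r by (simp add: d_def)
      ultimately show ?thesis using r inv_mem[OF r(2)] by (metis less_eq_real_def order_trans)
    qed
    then show "\<exists>d. \<forall>x. \<exists>g\<in>G. dist (g 0) x \<le> d" by blast
  next
    assume "\<exists>d. \<forall>x. \<exists>g\<in>G. dist (g 0) x \<le> d"
    then obtain d where d: "\<And>x. \<exists>g\<in>G. dist (g 0) x \<le> d" by blast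
    have cover: "\<exists>y\<in>cball 0 d. orb G x = orb G y" for x
    proof -
      obtain g where g: "g \<in> G" "dist (g 0) x \<le> d" using d by blast
      let ?y = "(inv_isom g) x"
      have "norm ?y = dist (g 0) x"
        using isom_groupD(2)[OF carr[OF g(1)], of 0 ?y] inv_isom_group[OF carr[OF g(1)]]
        by (simp add: dist_norm norm_minus_commute)
      then show ?thesis using g inv_mem[OF g(1)] by (intro bexI[of _ ?y]) (auto simp: orb_eq_iff)
    qed
    show "compact_space ?X"
      unfolding compact_space_alt
    proof (intro allI impI)
      fix \<U> assume "(\<forall>U\<in>\<U>. openin ?X U) \<and> topspace ?X \<subseteq> \<Union> \<U>"
      then have U: "\<forall>U\<in>\<U>. openin ?X U" "topspace ?X \<subseteq> \<Union> \<U>" by blast+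
      let ?P = "\<lambda>U. {x. orb G x \<in> U}"
      have "compact (cball (0::real^'n) d)" by simp
      moreover have "\<And>B. B \<in> ?P ` \<U> \<Longrightarrow> open B" using U by (auto simp: openin_orbit_space)
      moreover have "cball 0 d \<subseteq> \<Union> (?P ` \<U>)" using U mem unfolding top by blast
      ultimately obtain \<C> where C: "\<C> \<subseteq> ?P ` \<U>" "finite \<C>" "cball 0 d \<subseteq> \<Union>\<C>"
        using compactE[of "cball 0 d" "?P ` \<U>"] by (metis (no_types, lifting))
      then obtain F where F: "finite F" "F \<subseteq> \<U>" "\<C> = ?P ` F" by (meson finite_subset_image)
      have "topspace ?X \<subseteq> \<Union> F"
      proof
        fix c assume "c \<in> topspace ?X"
        then obtain x where x: "c = orb G x" unfolding top orbits_def by blast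
        obtain y where "y \<in> cball 0 d" "orb G x = orb G y" using cover by blast
        then show "c \<in> \<Union> F" using C(3) F(3) x by auto
      qed
      then show "\<exists>\<F>. finite \<F> \<and> \<F> \<subseteq> \<U> \<and> topspace ?X \<subseteq> \<Union> \<F>"
        using F by blast
    qed
  qed
qed

end

text \<open>Induction over the generation of the topology. For a subbasic set, a compact
  \<open>K\<close> inside an open \<open>U\<close> keeps a positive distance from the complement, so
  maps uniformly close to \<open>id\<close> on a ball containing \<open>K\<close> still send
  \<open>K\<close> into \<open>U\<close>.\<close>

lemma openin_compact_open_id:
  fixes W :: "('n::finite) selfmap set"
  assumes "openin compact_open_topology W" "id \<in> W"
  shows "\<exists>R e. e > 0 \<and> (\<forall>f. (\<forall>x. norm x \<le> R \<longrightarrow> dist (f x) x < e) \<longrightarrow> f \<in> W)"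
proof -
  have "generate_topology_on {{f :: 'n selfmap. f ` K \<subseteq> U} | K U. compact K \<and> open U} W"
    using assms(1) by (simp add: compact_open_topology_def openin_topology_generated_by_iff)
  then show ?thesis
    using assms(2)
  proof (induction)
    case Empty
    then show ?case by simp
  next
    case (Int a b)
    then obtain R e R' e' where
      "e > 0" "\<forall>f. (\<forall>x. norm x \<le> R \<longrightarrow> dist (f x) x < e) \<longrightarrow> f \<in> a"
      "e' > 0" "\<forall>f. (\<forall>x. norm x \<le> R' \<longrightarrow> dist (f x) x < e') \<longrightarrow> f \<in> b"
      by blast
    then show ?case
      by (intro exI[of _ "max R R'"] exI[of _ "min e e'"]) auto
  next
    case (UN K)
    then obtain k where k: "k \<in> K" "id \<in> k" by blast
    then obtain R e where "e > 0" "\<forall>f. (\<forall>x. norm x \<le> R \<longrightarrow> dist (f x) x < e) \<longrightarrow> f \<in> k"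
      using UN.IH by blast
    then show ?case using k(1) by (intro exI[of _ R] exI[of _ e]) auto
  next
    case (Basis s)
    then obtain K U where KU: "s = {f. f ` K \<subseteq> U}" "compact K" "open U" "K \<subseteq> U" by auto
    obtain R where R: "\<And>x. x \<in> K \<Longrightarrow> norm x \<le> R"
      using compact_imp_bounded[OF KU(2)] by (auto simp: bounded_iff)
    obtain e where e: "e > 0" "(\<Union>x\<in>K. ball x e) \<subseteq> U"
      using compact_subset_open_imp_ball_epsilon_subset[OF KU(2,3,4)] by blast
    show ?case
    proof (rule exI[of _ R], rule exI[of _ e], intro conjI allI impI)
      show "e > 0" by fact
    next
      fix f :: "'n selfmap" assume f: "\<forall>x. norm x \<le> R \<longrightarrow> dist (f x) x < e"
      have "f x \<in> U" if "x \<in> K" for x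
      proof -
        have "f x \<in> ball x e" using f R[OF that] by (simp add: dist_commute)
        then show ?thesis using e(2) that by blast
      qed
      then show "f \<in> s" using KU by auto
    qed
  qed
qed

lemma openin_compact_open_basis:
  "compact K \<Longrightarrow> open U \<Longrightarrow> openin compact_open_topology {f :: ('n::finite) selfmap. f ` K \<subseteq> U}"
  unfolding compact_open_topology_def by (rule topology_generated_by_Basis) blast

lemma topspace_compact_open [simp]: "topspace compact_open_topology = (UNIV :: ('n::finite) selfmap set)"
proof -
  have "openin compact_open_topology {f :: 'n selfmap. f ` {} \<subseteq> {}}"
    by (rule openin_compact_open_basis) auto
  from openin_subset[OF this] show ?thesis by auto
qed

text \<open>The linear parts lie in the unit ball of a finite-dimensional space of operators, so
  some subsequence converges. Only its Cauchy property is exported: the later arguments divide two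
  members with almost equal linear parts.\<close>

lemma bounded_isometries_cluster:
  fixes f :: "nat \<Rightarrow> ('n::finite) selfmap"
  assumes "\<And>k. f k \<in> carrier isom_group"
  shows "\<exists>r :: nat \<Rightarrow> nat. strict_mono r \<and> (\<forall>e>0. \<exists>K. \<forall>i\<ge>K. \<forall>j\<ge>K. \<forall>x.
    norm (lin (f (r i)) x - lin (f (r j)) x) \<le> e * norm x)"
proof -
  define B where "B k = Blinfun (lin (f k))" for k
  have lin_B: "blinfun_apply (B k) = lin (f k)" for k
    unfolding B_def using lin_isom(1)[OF assms]
    by (intro bounded_linear_Blinfun_apply) (simp add: linear_conv_bounded_linear)
  have "norm (B k) \<le> 1" for k
    by (rule norm_blinfun_bound) (simp_all add: lin_B lin_isom(2)[OF assms])
  then have "bounded (range B)" by (auto simp: bounded_iff)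
  then obtain l r where r: "strict_mono r" "(B \<circ> r) \<longlonglongrightarrow> l"
    using bounded_imp_convergent_subsequence by blast
  have "Cauchy (B \<circ> r)" using r(2) by (rule LIMSEQ_imp_Cauchy)
  have "\<exists>K. \<forall>i\<ge>K. \<forall>j\<ge>K. \<forall>x. norm (lin (f (r i)) x - lin (f (r j)) x) \<le> e * norm x" if "e > 0" for e
  proof -
    obtain K where K: "\<And>i j. i \<ge> K \<Longrightarrow> j \<ge> K \<Longrightarrow> norm (B (r i) - B (r j)) < e"
      using CauchyD[OF \<open>Cauchy (B \<circ> r)\<close> \<open>e > 0\<close>] by (auto simp: comp_def)
    have "norm (lin (f (r i)) x - lin (f (r j)) x) \<le> e * norm x" if "i \<ge> K" "j \<ge> K" for i j x
    proof -
      have "norm (blinfun_apply (B (r i) - B (r j)) x) \<le> norm (B (r i) - B (r j)) * norm x"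
        by (rule norm_blinfun)
      also have "\<dots> \<le> e * norm x" using K[OF that] by (intro mult_right_mono) auto
      finally show ?thesis by (simp add: blinfun.diff_left lin_B)
    qed
    then show ?thesis by blast
  qed
  then show ?thesis using r(1) by blast
qed

context isometry_group
begin

text \<open>Infinitely many elements of bounded displacement would include two that are uniformly
  close on a large ball, and their quotient would be a nontrivial element in a given neighbourhood
  of \<open>id\<close>. Conversely only finitely many elements of \<open>G\<close> send 0 near
  \<open>g 0\<close>, and one test point for each separates it from \<open>g\<close>.\<close>

lemma discrete_isometries_iff:
  "discrete_isometries G \<longleftrightarrow> (\<forall>R. finite {g \<in> G. norm (g 0) \<le> R})"
proof
  assume disc: "discrete_isometries G"
  then have "openin (subtopology compact_open_topology G) {id}"
    using id_mem by (simp add: discrete_isometries_def)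
  then obtain W where W: "openin compact_open_topology W" "{id} = W \<inter> G"
    unfolding openin_subtopology by blast
  then obtain R0 e where e: "e > 0"
    and We: "\<And>f. (\<And>x. norm x \<le> R0 \<Longrightarrow> dist (f x) x < e) \<Longrightarrow> f \<in> W"
    using openin_compact_open_id[of W] by blast
  \<comment> \<open>On the ball of radius \<open>R0\<close> the two isometries will differ by at
    most \<open>e' * norm x + e'\<close>; adding 2 instead of 1 makes the final bound
    strict.\<close>
  define e' where "e' = e / (\<bar>R0\<bar> + 2)"
  have e': "e' > 0" using e by (simp add: e'_def add_nonneg_pos)
  show "\<forall>R. finite {g \<in> G. norm (g 0) \<le> R}"
  proof (rule allI, rule ccontr)
    fix R assume inf: "infinite {g \<in> G. norm (g 0) \<le> R}"
    then obtain f :: "nat \<Rightarrow> 'n selfmap" where f: "inj f" "\<And>k. f k \<in> G" "\<And>k. norm (f k 0) \<le> R"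
      using infinite_countable_subset[OF inf] by blast
    obtain r :: "nat \<Rightarrow> nat" where r: "strict_mono r" and cau: "\<And>e. e > 0 \<Longrightarrow> \<exists>K. \<forall>i\<ge>K. \<forall>j\<ge>K. \<forall>x.
        norm (lin (f (r i)) x - lin (f (r j)) x) \<le> e * norm x"
      using bounded_isometries_cluster[of f] f(2) carr by blast
    have "bounded (range (\<lambda>k. f (r k) 0))" using f(3) by (auto simp: bounded_iff)
    then obtain l s where s: "strict_mono s" "((\<lambda>k. f (r k) 0) \<circ> s) \<longlonglongrightarrow> l"
      using bounded_imp_convergent_subsequence[of "\<lambda>k. f (r k) 0"] by blast
    then have cau0: "Cauchy ((\<lambda>k. f (r k) 0) \<circ> s)" by (blast intro: LIMSEQ_imp_Cauchy)
    then obtain K' where K': "\<And>i j. i \<ge> K' \<Longrightarrow> j \<ge> K' \<Longrightarrow> norm (f (r (s i)) 0 - f (r (s j)) 0) < e'"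
      using CauchyD[OF cau0 e'] by (auto simp: comp_def)
    obtain K where K: "\<And>i j x. i \<ge> K \<Longrightarrow> j \<ge> K \<Longrightarrow>
        norm (lin (f (r i)) x - lin (f (r j)) x) \<le> e' * norm x" using cau[OF e'] by blast
    \<comment> \<open>\<open>K'\<close> counts along the finer subsequence \<open>s\<close>, while
      \<open>K\<close> counts along \<open>r\<close>; since \<open>s i \<ge> i\<close>, one index
      passes both thresholds.\<close>
    define i where "i = max K K'"
    have i: "s i \<ge> K" "s (Suc i) \<ge> K" "i \<ge> K'" "Suc i \<ge> K'"
      using seq_suble[OF s(1), of i] seq_suble[OF s(1), of "Suc i"] by (auto simp: i_def)
    let ?a = "f (r (s i))" and ?b = "f (r (s (Suc i)))"
    have ab: "?a \<in> G" "?b \<in> G" using f by auto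
    have "dist ((inv_isom ?a \<circ> ?b) x) x < e" if "norm x \<le> R0" for x
    proof -
      have "dist ((inv_isom ?a \<circ> ?b) x) x = dist (?b x) (?a x)"
        using isom_groupD(2)[OF carr[OF ab(1)], of "(inv_isom ?a \<circ> ?b) x" x]
          inv_isom_group[OF carr[OF ab(1)]] by simp
      also have "\<dots> = norm ((lin ?b x - lin ?a x) + (?b 0 - ?a 0))"
        by (simp add: dist_norm lin_def)
      also have "\<dots> \<le> norm (lin ?b x - lin ?a x) + norm (?b 0 - ?a 0)" by (rule norm_triangle_ineq)
      also have "\<dots> \<le> e' * norm x + e'"
        using K[OF i(2,1), of x] K'[OF i(4,3)] by simp
      also have "\<dots> = e' * (norm x + 1)" by (simp add: algebra_simps)
      also have "\<dots> < e' * (\<bar>R0\<bar> + 2)" using that e' by (intro mult_strict_left_mono) auto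
      also have "\<dots> = e" by (simp add: e'_def)
      finally show ?thesis .
    qed
    then have "inv_isom ?a \<circ> ?b \<in> W" by (rule We)
    moreover have "inv_isom ?a \<circ> ?b \<in> G" using ab comp_mem inv_mem by blast
    ultimately have "inv_isom ?a \<circ> ?b = id" using W(2) by blast
    then have "?a = ?b"
      using inv_isom_group[OF carr[OF ab(1)]] by (metis comp_assoc comp_id id_comp)
    moreover have "r (s i) \<noteq> r (s (Suc i))"
      using r s(1) by (simp add: strict_mono_eq)
    ultimately show False using f(1) by (simp add: inj_eq)
  qed
next
  assume fin: "\<forall>R. finite {g \<in> G. norm (g 0) \<le> R}"
  have "openin (subtopology compact_open_topology G) {g}" if g: "g \<in> G" for g
  proof -
    \<comment> \<open>The finitely many rivals of \<open>g\<close> that the neighbourhood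
      \<open>V\<close> below may fail to exclude.\<close>
    define F where "F = {h \<in> G. norm (h 0) \<le> norm (g 0) + 1} - {g}"
    have "finite F" using fin by (simp add: F_def)
    define p where "p h = (SOME x. h x \<noteq> g x)" for h :: "'n selfmap"
    have p: "h (p h) \<noteq> g (p h)" if "h \<noteq> g" for h
      unfolding p_def by (rule someI_ex) (use that in auto)
    define V where "V = {f :: 'n selfmap. f ` {0} \<subseteq> ball (g 0) 1}"
    define W where "W h = {f :: 'n selfmap. f ` {p h} \<subseteq> - {h (p h)}}" for h
    have "openin compact_open_topology V" "openin compact_open_topology (W h)" for h
      unfolding V_def W_def by (rule openin_compact_open_basis, simp, simp add: open_Compl)+
    then have "openin compact_open_topology (\<Inter>(insert V (W ` F)))"
      using \<open>finite F\<close> by (intro openin_Inter) auto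
    moreover have "{g} = \<Inter>(insert V (W ` F)) \<inter> G"
    proof (intro equalityI subsetI)
      fix h assume "h \<in> {g}"
      moreover have "g \<in> W k" if "k \<in> F" for k
        using that p[of k] by (auto simp: W_def F_def)
      ultimately show "h \<in> \<Inter>(insert V (W ` F)) \<inter> G"
        using g by (auto simp: V_def)
    next
      fix h assume h: "h \<in> \<Inter>(insert V (W ` F)) \<inter> G"
      then have "dist (g 0) (h 0) < 1" by (simp add: V_def)
      then have "norm (h 0) \<le> norm (g 0) + 1"
        using norm_triangle_sub[of "h 0" "g 0"] by (simp add: dist_norm norm_minus_commute)
      moreover have "h \<notin> F" using h by (auto simp: W_def)
      ultimately show "h \<in> {g}" using h by (auto simp: F_def)
    qed
    ultimately show ?thesis unfolding openin_subtopology by blast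
  qed
  then have "discrete_topology G = subtopology compact_open_topology G"
    by (subst discrete_topology_unique) (auto simp: topspace_subtopology)
  then show "discrete_isometries G" unfolding discrete_isometries_def by simp
qed

end

locale crystal_group = isometry_group G for G :: "('n::finite) selfmap set" +
  assumes finite_bounded: "finite {g \<in> G. norm (g 0) \<le> R}"
    and dense_orbit: "\<exists>d. \<forall>x. \<exists>g\<in>G. dist (g 0) x \<le> d"

lemma space_group_iff: "space_group G \<longleftrightarrow> crystal_group G"
proof (cases "subgroup G isom_group")
  case True
  then interpret isometry_group G by (rule isometry_group.intro)
  show ?thesis
    by (simp add: space_group_def crystal_group_def crystal_group_axioms_def
        discrete_isometries_iff compact_orbit_space_iff isometry_group_axioms True)
next
  case False
  then show ?thesis
    by (simp add: space_group_def crystal_group_def isometry_group_def)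
qed



section \<open>Bieberbach's first theorem\<close>

text \<open>The size of the rotational part. As an operator norm it makes products of
  \<open>lin f - id\<close> and \<open>lin g - id\<close> easy to bound; translations are the
  isometries of size 0.\<close>

definition dev :: "('a::real_normed_vector \<Rightarrow> 'a) \<Rightarrow> real" where
  "dev f = onorm (\<lambda>x. lin f x - x)"

lemma bounded_linear_lin_diff:
  fixes f :: "('n::finite) selfmap"
  assumes "f \<in> carrier isom_group"
  shows "bounded_linear (\<lambda>x. lin f x - x)"
  using lin_isom(1)[OF assms] by (intro bounded_linear_sub bounded_linear_ident)
    (simp add: linear_conv_bounded_linear)

lemma dev_le:
  fixes f :: "('n::finite) selfmap"
  assumes "f \<in> carrier isom_group"
  shows "norm (lin f x - x) \<le> dev f * norm x"
  unfolding dev_def by (rule onorm[OF bounded_linear_lin_diff[OF assms]])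

lemma dev_nonneg:
  fixes f :: "('n::finite) selfmap"
  assumes "f \<in> carrier isom_group"
  shows "0 \<le> dev f"
  unfolding dev_def by (rule onorm_pos_le[OF bounded_linear_lin_diff[OF assms]])

lemma dev_leI:
  fixes f :: "('n::finite) selfmap"
  assumes "\<And>x. norm (lin f x - x) \<le> e * norm x"
  shows "dev f \<le> e"
  unfolding dev_def by (rule onorm_le) (rule assms)

lemma dev_eq_0:
  fixes f :: "('n::finite) selfmap"
  assumes "f \<in> carrier isom_group"
  shows "dev f = 0 \<longleftrightarrow> lin f = id"
  unfolding dev_def onorm_eq_0[OF bounded_linear_lin_diff[OF assms]] by (auto simp: fun_eq_iff)

lemma dev_attained:
  fixes f :: "('n::finite) selfmap"
  assumes "f \<in> carrier isom_group"
  shows "\<exists>u. norm u = 1 \<and> norm (lin f u - u) = dev f"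
proof -
  have "continuous_on (sphere 0 1) (\<lambda>x. norm (lin f x - x))"
    by (intro continuous_intros linear_continuous_on bounded_linear_lin_diff assms)
  moreover have "compact (sphere (0::real^'n) 1)" "sphere (0::real^'n) 1 \<noteq> {}" by simp_all
  ultimately obtain u where u: "norm u = 1"
    and max: "\<And>x. norm x = 1 \<Longrightarrow> norm (lin f x - x) \<le> norm (lin f u - u)"
    using continuous_attains_sup[of "sphere 0 1" "\<lambda>x. norm (lin f x - x)"] by auto
  have "norm (lin f x - x) \<le> norm (lin f u - u) * norm x" for x
  proof (cases "x = 0")
    case False
    interpret linear "lin f" using assms by (rule lin_isom)
    have "norm (lin f x - x) = norm x * norm (lin f (x /\<^sub>R norm x) - x /\<^sub>R norm x)"
      using False by (simp add: scale scaleR_diff_right[symmetric])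
    also have "\<dots> \<le> norm x * norm (lin f u - u)"
      using False by (intro mult_left_mono max) auto
    finally show ?thesis by (simp add: mult.commute)
  qed simp
  then have "dev f \<le> norm (lin f u - u)" by (rule dev_leI)
  moreover have "norm (lin f u - u) \<le> dev f" using dev_le[OF assms, of u] u by simp
  ultimately show ?thesis using u by auto
qed

text \<open>The vectors on which \<open>lin f - id\<close> attains its norm form an invariant subspace,
  namely the kernel of a positive semidefinite form; on its complement the norm drops.\<close>

definition max_dev_space :: "('n::finite) selfmap \<Rightarrow> (real^'n) set" where
  "max_dev_space f = {x. norm (lin f x - x) = dev f * norm x}"

text \<open>As \<open>q x x = 0\<close>, the value of the form at \<open>t *\<^sub>R x + y\<close>
  is affine in \<open>t\<close>, hence unbounded below unless the slope \<open>2 * q x y\<close>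
  vanishes.\<close>

lemma psd_kernel:
  fixes q :: "'a::real_vector \<Rightarrow> 'a \<Rightarrow> real"
  assumes sym: "\<And>x y. q x y = q y x"
    and add: "\<And>x y z. q (x + y) z = q x z + q y z"
    and scale: "\<And>c x y. q (c *\<^sub>R x) y = c * q x y"
    and psd: "\<And>x. 0 \<le> q x x" and x: "q x x = 0"
  shows "q x y = 0"
proof (rule ccontr)
  assume ne: "q x y \<noteq> 0"
  define t where "t = - (q y y + 1) / (2 * q x y)"
  have add': "q z (x + y) = q z x + q z y" for x y z using add sym by metis
  have scale': "q y (c *\<^sub>R x) = c * q y x" for c x y using scale sym by metis
  have "q (t *\<^sub>R x + y) (t *\<^sub>R x + y) = 2 * t * q x y + q y y"
    by (simp add: add add' scale scale' x sym[of y x])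
  also have "\<dots> = - 1" using ne by (simp add: t_def field_simps)
  finally show False using psd[of "t *\<^sub>R x + y"] by simp
qed

lemma subspace_max_dev_space:
  fixes f :: "('n::finite) selfmap"
  assumes "f \<in> carrier isom_group"
  shows "subspace (max_dev_space f)"
proof -
  interpret linear "lin f" using assms by (rule lin_isom)
  let ?D = "\<lambda>x. lin f x - x"
  define q where "q x y = (dev f)\<^sup>2 * (x \<bullet> y) - ?D x \<bullet> ?D y" for x y
  have sym: "q x y = q y x" for x y by (simp add: q_def inner_commute)
  have addq: "q (x + y) z = q x z + q y z" for x y z
    by (simp add: q_def add algebra_simps inner_simps)
  have scaleq: "q (c *\<^sub>R x) y = c * q x y" for c x y
    by (simp add: q_def scale inner_simps algebra_simps)
  have q_eq: "q x x = (dev f * norm x)\<^sup>2 - (norm (?D x))\<^sup>2" for x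
    by (simp add: q_def power2_norm_eq_inner power_mult_distrib)
  have psd: "0 \<le> q x x" for x
    using dev_le[OF assms, of x] by (simp add: q_eq power_mono)
  have iff: "x \<in> max_dev_space f \<longleftrightarrow> q x x = 0" for x
    unfolding max_dev_space_def q_eq using dev_nonneg[OF assms]
    by (auto simp: power2_eq_iff_nonneg)
  have ker: "q x x = 0 \<Longrightarrow> q x y = 0" for x y
    by (rule psd_kernel[of q, OF sym addq scaleq psd])
  show ?thesis
    unfolding subspace_def iff
  proof (intro conjI ballI allI impI)
    show "q 0 0 = 0" by (simp add: q_def)
    fix x assume x: "x \<in> max_dev_space f"
    then show "q (c *\<^sub>R x) (c *\<^sub>R x) = 0" for c
      unfolding iff using ker scaleq by simp
    fix y assume "y \<in> max_dev_space f"
    then show "q (x + y) (x + y) = 0" using x unfolding iff by (simp add: addq ker)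
  qed
qed

lemma max_dev_space_invariant:
  fixes f :: "('n::finite) selfmap"
  assumes f: "f \<in> carrier isom_group"
  shows "x \<in> max_dev_space f \<Longrightarrow> lin f x \<in> max_dev_space f"
    "x \<in> max_dev_space f \<Longrightarrow> lin (inv_isom f) x \<in> max_dev_space f"
proof -
  interpret linear "lin f" using f by (rule lin_isom)
  show "lin f x \<in> max_dev_space f" if "x \<in> max_dev_space f"
    using that lin_isom(2)[OF f] unfolding max_dev_space_def
    by (simp add: diff[symmetric])
  show "lin (inv_isom f) x \<in> max_dev_space f" if "x \<in> max_dev_space f"
  proof -
    let ?y = "lin (inv_isom f) x"
    have "norm (lin f ?y - ?y) = norm (lin f (lin f ?y - ?y))" using lin_isom(2)[OF f] by simp
    also have "\<dots> = norm (lin f x - x)" by (simp add: diff lin_inv[OF f])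
    also have "\<dots> = dev f * norm ?y"
      using that lin_isom(2)[OF inv_isom_group(5)[OF f]] by (simp add: max_dev_space_def)
    finally show ?thesis by (simp add: max_dev_space_def)
  qed
qed

text \<open>On the unit sphere of the orthogonal complement the maximum is attained; were it
  \<open>dev f\<close>, the maximiser would lie in the maximal space and be orthogonal to
  itself.\<close>

lemma max_dev_space_complement:
  fixes f :: "('n::finite) selfmap"
  assumes f: "f \<in> carrier isom_group" and pos: "dev f > 0"
  shows "\<exists>m. 0 \<le> m \<and> m < dev f \<and>
    (\<forall>w. (\<forall>e\<in>max_dev_space f. w \<bullet> e = 0) \<longrightarrow> norm (lin f w - w) \<le> m * norm w)"
proof -
  let ?E = "max_dev_space f" and ?D = "\<lambda>x. lin f x - x"
  define S where "S = sphere 0 1 \<inter> (\<Inter>e\<in>?E. {w. w \<bullet> e = 0})"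
  have "closed (\<Inter>e\<in>?E. {w. w \<bullet> e = 0})"
    by (intro closed_INT ballI closed_Collect_eq continuous_intros)
  then have "compact S" unfolding S_def by (intro compact_Int_closed) simp_all
  interpret linear "lin f" using f by (rule lin_isom)
  have scale1: "norm (?D w) = norm w * norm (?D (w /\<^sub>R norm w))" if "w \<noteq> 0" for w
    using that by (simp add: scale scaleR_diff_right[symmetric])
  show ?thesis
  proof (cases "S = {}")
    \<comment> \<open>The complement is zero, and \<open>m = 0\<close> lies below
      \<open>dev f\<close> because \<open>f\<close> does rotate.\<close>
    case True
    have "w = 0" if w: "\<forall>e\<in>?E. w \<bullet> e = 0" for w
    proof (rule ccontr)
      assume "w \<noteq> 0"
      then have "w /\<^sub>R norm w \<in> S" using w by (simp add: S_def)
      then show False using True by simp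
    qed
    moreover have "lin f 0 = 0" by simp
    ultimately show ?thesis using pos by (intro exI[of _ 0]) (metis diff_self mult_zero_left norm_zero order_refl)
  next
    case False
    have "continuous_on S (\<lambda>x. norm (?D x))"
      by (intro continuous_intros linear_continuous_on bounded_linear_lin_diff f)
    then obtain u where u: "u \<in> S" and max: "\<And>x. x \<in> S \<Longrightarrow> norm (?D x) \<le> norm (?D u)"
      using continuous_attains_sup[OF \<open>compact S\<close> False, of "\<lambda>x. norm (?D x)"] by blast
    have "u \<notin> ?E"
    proof
      assume "u \<in> ?E"
      then have "u \<bullet> u = 0" using u unfolding S_def by blast
      then show False using u by (simp add: S_def)
    qed
    then have "norm (?D u) \<noteq> dev f" using u by (simp add: max_dev_space_def S_def)
    moreover have "norm (?D u) \<le> dev f" using dev_le[OF f, of u] u by (simp add: S_def)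
    moreover have "norm (?D w) \<le> norm (?D u) * norm w" if w: "\<forall>e\<in>?E. w \<bullet> e = 0" for w
    proof (cases "w = 0")
      case w0: False
      have "w /\<^sub>R norm w \<in> S" using w w0 by (simp add: S_def)
      from max[OF this] show ?thesis
        unfolding scale1[OF w0] by (simp add: mult.commute mult_left_mono)
    qed simp
    ultimately show ?thesis by (intro exI[of _ "norm (?D u)"]) auto
  qed
qed

text \<open>With A and B the linear parts of \<open>f\<close> and \<open>g\<close>, AB - BA = (A -
  1)(B - 1) - (B - 1)(A - 1), so a commutator rotates by a product of two small quantities. The last
  formula is \<open>h \<circ> (g \<circ> f) = f \<circ> g\<close> at the origin, grouped so that
  only \<open>lin f (g 0) - g 0\<close> survives when \<open>g\<close> is a translation.\<close>

lemma commutator_identities: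
  fixes f g :: "('n::finite) selfmap"
  assumes f: "f \<in> carrier isom_group" and g: "g \<in> carrier isom_group"
  defines "h \<equiv> (f \<circ> g) \<circ> inv_isom (g \<circ> f)"
  shows "h \<in> carrier isom_group" "dev h \<le> 2 * dev f * dev g"
    "h 0 = (lin f (g 0) - g 0) - (lin g (f 0) - f 0) - (lin h (lin g (f 0) + g 0) - (lin g (f 0) + g 0))"
proof -
  interpret isom: group "isom_group :: 'n selfmap monoid" by (rule group_isom_group)
  have fg: "f \<circ> g \<in> carrier isom_group" and gf: "g \<circ> f \<in> carrier isom_group"
    using isom.m_closed[OF f g] isom.m_closed[OF g f] by simp_all
  then show h: "h \<in> carrier isom_group"
    unfolding h_def using isom.m_closed[OF fg inv_isom_group(5)[OF gf]] by simp
  have hgf: "h \<circ> (g \<circ> f) = f \<circ> g"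
    unfolding h_def using inv_isom_group(1)[OF gf] by (simp add: comp_assoc)
  interpret F: linear "lin f" using f by (rule lin_isom)
  interpret G: linear "lin g" using g by (rule lin_isom)
  interpret H: linear "lin h" using h by (rule lin_isom)
  have lin_h: "lin h (lin g (lin f z)) = lin f (lin g z)" for z
    using arg_cong[OF hgf, of lin] lin_comp[OF h] lin_comp[OF g] lin_comp[OF f]
    by (metis comp_apply)
  show "dev h \<le> 2 * dev f * dev g"
  proof (rule dev_leI)
    fix x
    obtain y where y: "x = lin g y" using lin_isom(5)[OF g] by (metis surjD)
    obtain z where z: "y = lin f z" using lin_isom(5)[OF f] by (metis surjD)
    have nz: "norm z = norm x" using y z lin_isom(2)[OF f] lin_isom(2)[OF g] by simp
    have "lin h x - x = (lin f (lin g z - z) - (lin g z - z)) - (lin g (lin f z - z) - (lin f z - z))"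
      by (simp add: y z lin_h F.diff G.diff)
    also have "norm \<dots> \<le> norm (lin f (lin g z - z) - (lin g z - z)) + norm (lin g (lin f z - z) - (lin f z - z))"
      by (rule norm_triangle_ineq4)
    also have "\<dots> \<le> dev f * norm (lin g z - z) + dev g * norm (lin f z - z)"
      by (intro add_mono dev_le f g)
    also have "\<dots> \<le> dev f * (dev g * norm z) + dev g * (dev f * norm z)"
      by (intro add_mono mult_left_mono dev_le f g dev_nonneg)
    finally show "norm (lin h x - x) \<le> 2 * dev f * dev g * norm x"
      by (simp add: nz mult_ac)
  qed
  have "h (g (f 0)) = f (g 0)" using hgf by (metis comp_apply)
  then have "lin h (lin g (f 0) + g 0) + h 0 = lin f (g 0) + f 0"
    using isom_eq_lin[of h "g (f 0)"] isom_eq_lin[of f "g 0"] isom_eq_lin[of g "f 0"] by simp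
  then show "h 0 = (lin f (g 0) - g 0) - (lin g (f 0) - f 0) - (lin h (lin g (f 0) + g 0) - (lin g (f 0) + g 0))"
    by (simp add: algebra_simps)
qed

context crystal_group
begin

text \<open>Choose elements carrying 0 near the points \<open>real k *\<^sub>R u\<close>. Two of
  them with almost equal linear parts have a quotient that hardly rotates and still moves 0 roughly
  along \<open>u\<close>.\<close>

lemma almost_translation_in_direction:
  assumes u: "norm u = 1" and "\<delta> > 0" "\<epsilon> > 0"
  shows "\<exists>g\<in>G. \<exists>s>0. norm (g 0 - s *\<^sub>R u) \<le> \<delta> * s \<and> dev g \<le> \<epsilon>"
proof -
  obtain d where d: "\<And>x. \<exists>g\<in>G. dist (g 0) x \<le> d" using dense_orbit by blast
  then have "\<exists>f. \<forall>k. f k \<in> G \<and> dist (f k 0) (real k *\<^sub>R u) \<le> d"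
    by (intro choice allI) (metis)
  then obtain f where f: "\<And>k. f k \<in> G" "\<And>k. dist (f k 0) (real k *\<^sub>R u) \<le> d" by blast
  obtain r :: "nat \<Rightarrow> nat" where r: "strict_mono r" and cau: "\<And>e. e > 0 \<Longrightarrow> \<exists>K. \<forall>i\<ge>K. \<forall>j\<ge>K. \<forall>x.
      norm (lin (f (r i)) x - lin (f (r j)) x) \<le> e * norm x"
    using bounded_isometries_cluster[of f] f(1) carr by blast
  obtain K where K: "\<And>i j x. i \<ge> K \<Longrightarrow> j \<ge> K \<Longrightarrow>
      norm (lin (f (r i)) x - lin (f (r j)) x) \<le> \<epsilon> * norm x" using cau[OF \<open>\<epsilon> > 0\<close>] by blast
  let ?a = "f (r K)"
  \<comment> \<open>\<open>?a\<close> is fixed before \<open>?b\<close> is chosen, so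
    \<open>d + norm (?a 0)\<close> is a constant that becomes relatively smaller than
    \<open>\<delta>\<close> once the target point is far enough out.\<close>
  obtain j0 :: nat where j0: "real j0 \<ge> (d + norm (?a 0)) / \<delta>" using real_arch_simple by blast
  define j where "j = max (Suc K) (max j0 1)"
  let ?b = "f (r j)"
  have rj: "r j \<ge> j" using r by (rule seq_suble)
  have ab: "?a \<in> G" "?b \<in> G" using f by auto
  define g where "g = ?b \<circ> inv_isom ?a"
  have g: "g \<in> G" unfolding g_def using ab by (intro comp_mem inv_mem)
  have "dev g \<le> \<epsilon>"
  proof (rule dev_leI)
    fix x
    obtain y where y: "x = lin ?a y" using lin_isom(5)[OF carr[OF ab(1)]] by (metis surjD)
    have "lin g x = lin ?b y"
      unfolding g_def lin_comp[OF carr[OF ab(2)]] y by (simp add: lin_inv[OF carr[OF ab(1)]])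
    then have "norm (lin g x - x) = norm (lin ?b y - lin ?a y)" using y by simp
    also have "\<dots> \<le> \<epsilon> * norm y" by (rule K) (auto simp: j_def)
    finally show "norm (lin g x - x) \<le> \<epsilon> * norm x" using y lin_isom(2)[OF carr[OF ab(1)]] by simp
  qed
  moreover have "norm (g 0 - real (r j) *\<^sub>R u) \<le> \<delta> * real (r j)"
  proof -
    have "dist (g 0) (?b 0) = norm (?a 0)"
      unfolding g_def comp_apply isom_groupD(2)[OF carr[OF ab(2)]]
      using isom_norm_inv_0[OF carr[OF ab(1)]] by simp
    moreover have "dist (?b 0) (real (r j) *\<^sub>R u) \<le> d" by (rule f)
    ultimately have "dist (g 0) (real (r j) *\<^sub>R u) \<le> d + norm (?a 0)"
      using dist_triangle[of "g 0" "real (r j) *\<^sub>R u" "?b 0"] by linarith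
    also have "\<dots> \<le> \<delta> * real j0" using j0 \<open>\<delta> > 0\<close> by (simp add: field_simps)
    also have "\<dots> \<le> \<delta> * real (r j)"
      using rj \<open>\<delta> > 0\<close> by (intro mult_left_mono) (auto simp: j_def)
    finally show ?thesis by (simp add: dist_norm)
  qed
  moreover have "real (r j) > 0" using rj by (auto simp: j_def)
  ultimately show ?thesis using g by blast
qed

text \<open>Only finitely many elements displace the origin no further than \<open>f\<close> does,
  so the minimum is attained.\<close>

lemma minimal_displacement:
  assumes "f \<in> G" "P f"
  shows "\<exists>g\<in>G. P g \<and> (\<forall>h\<in>G. P h \<longrightarrow> norm (g 0) \<le> norm (h 0))"
proof -
  let ?S = "{g \<in> G. norm (g 0) \<le> norm (f 0)} \<inter> {g. P g}"
  have "finite ?S" "f \<in> ?S" using finite_bounded assms by auto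
  then obtain g where "g \<in> ?S" "\<And>h. h \<in> ?S \<Longrightarrow> norm (g 0) \<le> norm (h 0)"
    using arg_min_if_finite(1)[of ?S "\<lambda>g. norm (g 0)"] arg_min_least[of ?S _ "\<lambda>g. norm (g 0)"]
    by (metis (no_types, lifting) empty_iff)
  then show ?thesis
    by (intro bexI[of _ g]) (auto, meson linear order_trans)
qed

text \<open>Buser's geometric proof: an element \<open>f\<close> with small nonzero rotation part and minimal
  translation part, commutated with an almost translation \<open>g\<close> in a direction that \<open>f\<close>
  rotates maximally, yields a shorter almost translation of the same kind.\<close>

lemma small_rotation_is_translation:
  assumes "f0 \<in> G" "dev f0 \<le> 1/2"
  shows "lin f0 = id"
proof (rule ccontr)
  assume "lin f0 \<noteq> id"
  then have "dev f0 > 0" using dev_eq_0 dev_nonneg carr[OF assms(1)] by (metis less_eq_real_def)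
  then obtain f where f: "f \<in> G" "0 < dev f" "dev f \<le> 1/2"
    and f_min: "\<And>h. h \<in> G \<Longrightarrow> 0 < dev h \<Longrightarrow> dev h \<le> 1/2 \<Longrightarrow> norm (f 0) \<le> norm (h 0)"
    using minimal_displacement[of f0 "\<lambda>f. 0 < dev f \<and> dev f \<le> 1/2"] assms by blast
  define E where "E = max_dev_space f"
  define C where "C = {w. \<forall>e\<in>E. w \<bullet> e = 0}"
  have subE: "subspace E" unfolding E_def by (intro subspace_max_dev_space carr f)
  have subC: "subspace C" unfolding C_def subspace_def by (auto simp: inner_simps)
  obtain m where m: "0 \<le> m" "m < dev f" "\<And>w. w \<in> C \<Longrightarrow> norm (lin f w - w) \<le> m * norm w"
    using max_dev_space_complement[OF carr[OF f(1)] f(2)] unfolding C_def E_def by blast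
  \<comment> \<open>With this constant the error \<open>r\<close> below satisfies
    \<open>norm r \<le> 6 * \<epsilon> * norm e\<close>, which is 3/8 of the gap
    \<open>(dev f - m) * norm e\<close>; twice the error stays below the gap. As
    \<open>dev f \<le> 1/2\<close>, also \<open>\<epsilon> \<le> 1/32\<close>.\<close>
  define \<epsilon> where "\<epsilon> = (dev f - m) / 16"
  have eps: "\<epsilon> > 0" "\<epsilon> \<le> 1/32" "\<epsilon> \<le> 1/2" using m f by (simp_all add: \<epsilon>_def)
  have fE: "lin f x - x \<in> E" if "x \<in> E" for x
    using that max_dev_space_invariant(1)[OF carr[OF f(1)]] subE unfolding E_def
    by (simp add: subspace_diff)
  have fC: "lin f x - x \<in> C" if "x \<in> C" for x
  proof -
    have "lin f x \<bullet> e = 0" if "e \<in> E" for e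
    proof -
      have "lin f x \<bullet> e = lin f x \<bullet> lin f (lin (inv_isom f) e)"
        by (simp add: lin_inv[OF carr[OF f(1)]])
      also have "\<dots> = x \<bullet> lin (inv_isom f) e" by (rule lin_isom(3)[OF carr[OF f(1)]])
      also have "\<dots> = 0"
        using \<open>x \<in> C\<close> max_dev_space_invariant(2)[OF carr[OF f(1)]] that unfolding C_def E_def by blast
      finally show ?thesis .
    qed
    then show ?thesis using that by (simp add: C_def inner_simps)
  qed
  have decomp: "\<exists>e\<in>E. \<exists>w\<in>C. x = e + w \<and> norm e \<le> norm x \<and> norm w \<le> norm x" for x
  proof -
    obtain e w where ew: "e \<in> span E" "\<And>y. y \<in> span E \<Longrightarrow> orthogonal w y" "x = e + w"
      using orthogonal_subspace_decomp_exists[of E x] by blast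
    have "e \<in> E" "w \<in> C" using ew by (simp_all add: C_def orthogonal_def span_base span_eq_iff[THEN iffD2, OF subE])
    moreover have "(norm x)\<^sup>2 = (norm e)\<^sup>2 + (norm w)\<^sup>2"
      using norm_add_Pythagorean[of e w] ew by (simp add: orthogonal_commute)
    then have "norm e \<le> norm x" "norm w \<le> norm x"
      by (auto intro: power2_le_imp_le)
    ultimately show ?thesis using ew(3) by blast
  qed
  \<comment> \<open>The candidates for \<open>g\<close>: almost translations that move the origin
    mainly along \<open>E\<close>, where \<open>f\<close> rotates most.\<close>
  define P where "P g \<longleftrightarrow> dev g \<le> \<epsilon> \<and> (\<exists>e\<in>E. \<exists>w\<in>C. g 0 = e + w \<and> norm w < norm e)" for g :: "'n selfmap"
  obtain u where u: "norm u = 1" "u \<in> E"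
    using dev_attained[OF carr[OF f(1)]] by (auto simp: E_def max_dev_space_def)
  obtain g0 s where g0: "g0 \<in> G" "s > 0" "norm (g0 0 - s *\<^sub>R u) \<le> 1/4 * s" "dev g0 \<le> \<epsilon>"
    using almost_translation_in_direction[OF u(1), of "1/4" \<epsilon>] eps by auto
  \<comment> \<open>An error of at most \<open>s / 4\<close> leaves a component of at least
    \<open>3 * s / 4\<close> in \<open>E\<close> and of at most \<open>s / 4\<close> in its
    complement.\<close>
  have "P g0"
  proof -
    obtain e w where ew: "e \<in> E" "w \<in> C" "g0 0 - s *\<^sub>R u = e + w"
      "norm e \<le> 1/4 * s" "norm w \<le> 1/4 * s"
      using decomp[of "g0 0 - s *\<^sub>R u"] g0(3) by (meson order_trans)
    have "norm (s *\<^sub>R u) - norm e \<le> norm (s *\<^sub>R u + e)" by (rule norm_diff_ineq)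
    then have "norm w < norm (s *\<^sub>R u + e)" using ew u g0(2) by simp
    moreover have "s *\<^sub>R u + e \<in> E" using u ew subE by (simp add: subspace_add subspace_mul)
    moreover have "g0 0 = (s *\<^sub>R u + e) + w" using ew(3) by (simp add: algebra_simps)
    ultimately show ?thesis unfolding P_def using g0(4) ew(2) by blast
  qed
  then obtain g where g: "g \<in> G" "P g" and g_min: "\<And>h. h \<in> G \<Longrightarrow> P h \<Longrightarrow> norm (g 0) \<le> norm (h 0)"
    using minimal_displacement[of g0 P] g0(1) by blast
  obtain e w where ew: "e \<in> E" "w \<in> C" "g 0 = e + w" "norm w < norm e" and dev_g: "dev g \<le> \<epsilon>"
    using g(2) unfolding P_def by blast
  define h where "h = (f \<circ> g) \<circ> inv_isom (g \<circ> f)"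
  have h: "h \<in> G" unfolding h_def using f g by (intro comp_mem inv_mem)
  note ch = commutator_identities[OF carr[OF f(1)] carr[OF g(1)], folded h_def]
  \<comment> \<open>The part of \<open>h 0\<close> that is due to the rotations of \<open>g\<close>
    and \<open>h\<close>.\<close>
  define r where "r = - (lin g (f 0) - f 0) - (lin h (lin g (f 0) + g 0) - (lin g (f 0) + g 0))"
  have h0: "h 0 = (lin f (g 0) - g 0) + r" unfolding ch(3) r_def by simp
  have dev_h: "dev h \<le> dev g"
  proof -
    have "2 * dev f * dev g \<le> 1 * dev g"
      using f(3) dev_nonneg[OF carr[OF g(1)]] by (intro mult_right_mono) auto
    then show ?thesis using ch(2) by linarith
  qed
  have r: "norm r \<le> 3 * \<epsilon> * norm (g 0)"
  \<comment> \<open>If \<open>g\<close> is a translation the error vanishes. Otherwise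
    \<open>g\<close> competes with \<open>f\<close> in the minimal choice of \<open>f\<close>, which
    gives \<open>norm (f 0) \<le> norm (g 0)\<close>.\<close>
  proof (cases "dev g = 0")
    case True
    then have "dev h = 0" using dev_h dev_nonneg[OF carr[OF h]] by simp
    then have "lin h = id" "lin g = id" using True dev_eq_0 carr g(1) h by blast+
    then have "r = 0" by (simp add: r_def)
    then show ?thesis using eps by simp
  next
    case False
    then have pos: "dev g > 0" using dev_nonneg[OF carr[OF g(1)]] by simp
    then have fg: "norm (f 0) \<le> norm (g 0)" using f_min[OF g(1)] dev_g eps by simp
    have "norm r \<le> norm (lin g (f 0) - f 0) + norm (lin h (lin g (f 0) + g 0) - (lin g (f 0) + g 0))"
      unfolding r_def using norm_triangle_ineq4[of "- (lin g (f 0) - f 0)"] by (simp only: norm_minus_cancel)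
    also have "\<dots> \<le> dev g * norm (f 0) + dev h * norm (lin g (f 0) + g 0)"
      by (intro add_mono dev_le carr g h)
    also have "\<dots> \<le> \<epsilon> * norm (g 0) + \<epsilon> * (norm (g 0) + norm (g 0))"
    proof (intro add_mono mult_mono)
      show "norm (lin g (f 0) + g 0) \<le> norm (g 0) + norm (g 0)"
        using norm_triangle_ineq[of "lin g (f 0)" "g 0"] lin_isom(2)[OF carr[OF g(1)]] fg by simp
    qed (use dev_g dev_h fg eps dev_nonneg[OF carr[OF h]] in auto)
    finally show ?thesis by (simp add: algebra_simps)
  qed
  have gb: "norm (g 0) < 2 * norm e" using norm_triangle_ineq[of e w] ew by simp
  obtain re rw where rr: "re \<in> E" "rw \<in> C" "r = re + rw" "norm re \<le> norm r" "norm rw \<le> norm r"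
    using decomp[of r] by blast
  let ?e = "(lin f e - e) + re" and ?w = "(lin f w - w) + rw"
  interpret F: linear "lin f" using lin_isom(1)[OF carr[OF f(1)]] .
  have "3 * \<epsilon> * norm (g 0) \<le> 3 * \<epsilon> * (2 * norm e)"
    using gb eps by (intro mult_left_mono) auto
  then have "norm r \<le> 6 * \<epsilon> * norm e" using r by simp
  then have r8: "8 * norm r \<le> 3 * ((dev f - m) * norm e)"
    unfolding \<epsilon>_def by (simp add: algebra_simps)
  have pos: "(dev f - m) * norm e > 0" using m ew by (intro mult_pos_pos) auto
  have e_norm: "norm (lin f e - e) = dev f * norm e" using ew by (simp add: E_def max_dev_space_def)
  \<comment> \<open>\<open>lin f - id\<close> scales the component in \<open>E\<close> by exactly
    \<open>dev f\<close> and the other one by at most \<open>m\<close>; the gap outweighs the error,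
    so \<open>h\<close> is again a candidate.\<close>
  have "norm (lin f w - w) \<le> m * norm e"
    using m(3)[OF ew(2)] m(1) ew(4) by (meson less_eq_real_def mult_left_mono order_trans)
  then have w_bd: "norm ?w \<le> m * norm e + norm r"
    using norm_triangle_ineq[of "lin f w - w" rw] rr by linarith
  have e_bd: "norm ?e \<ge> dev f * norm e - norm r"
    using norm_diff_ineq[of "lin f e - e" re] rr e_norm by linarith
  have "norm ?w < norm ?e"
    using w_bd e_bd r8 pos by (simp add: algebra_simps)
  moreover have "?e \<in> E" "?w \<in> C"
    using fE fC ew rr subE subC by (simp_all add: subspace_add)
  moreover have "h 0 = ?e + ?w" using h0 ew(3) rr(3) by (simp add: F.add)
  moreover have "dev h \<le> \<epsilon>" using dev_h dev_g by simp
  ultimately have "P h" unfolding P_def by blast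
  \<comment> \<open>Contradiction with the minimality of \<open>g\<close>: \<open>norm (h 0)\<close>
    is at most 1/2 + 3/32 times \<open>norm (g 0)\<close>.\<close>
  then have "norm (g 0) \<le> norm (h 0)" using g_min h by blast
  moreover have "norm (h 0) \<le> dev f * norm (g 0) + norm r"
    unfolding h0 using dev_le[OF carr[OF f(1)], of "g 0"] norm_triangle_ineq[of "lin f (g 0) - g 0" r] by linarith
  moreover have "dev f * norm (g 0) \<le> 1/2 * norm (g 0)" using f by (intro mult_right_mono) auto
  moreover have "3 * \<epsilon> * norm (g 0) \<le> 3/32 * norm (g 0)"
    using eps by (intro mult_right_mono) auto
  moreover have "norm (g 0) > 0"
  proof -
    have "norm e - norm w \<le> norm (e + w)" by (rule norm_diff_ineq)
    then show ?thesis unfolding ew(3) using ew(4) by linarith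
  qed
  ultimately show False using r by linarith
qed

text \<open>Among infinitely many linear parts two distinct ones differ by at most 1/2 in operator
  norm. The quotient of the corresponding elements is then a translation, so the two linear parts
  agree after all.\<close>

theorem finite_point_group: "finite (lin ` G)"
proof (rule ccontr)
  assume "infinite (lin ` G)"
  then obtain p :: "nat \<Rightarrow> real^'n \<Rightarrow> real^'n" where p: "inj p" "range p \<subseteq> lin ` G"
    using infinite_countable_subset by blast
  then have "\<exists>f. \<forall>k. f k \<in> G \<and> lin (f k) = p k" by (intro choice allI) (metis imageE rangeI subsetD)
  then obtain f where f: "\<And>k. f k \<in> G" "\<And>k. lin (f k) = p k" by blast
  obtain r :: "nat \<Rightarrow> nat" where r: "strict_mono r" and cau: "\<And>e. e > 0 \<Longrightarrow> \<exists>K. \<forall>i\<ge>K. \<forall>j\<ge>K. \<forall>x.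
      norm (lin (f (r i)) x - lin (f (r j)) x) \<le> e * norm x"
    using bounded_isometries_cluster[of f] f(1) carr by blast
  obtain K where K: "\<And>i j x. i \<ge> K \<Longrightarrow> j \<ge> K \<Longrightarrow>
      norm (lin (f (r i)) x - lin (f (r j)) x) \<le> 1/2 * norm x" using cau[of "1/2"] by auto
  let ?a = "f (r K)" and ?b = "f (r (Suc K))"
  let ?g = "inv_isom ?a \<circ> ?b"
  have ab: "?a \<in> G" "?b \<in> G" using f by auto
  have lin_g: "lin ?a (lin ?g x) = lin ?b x" for x
    by (simp add: lin_comp[OF carr[OF inv_mem[OF ab(1)]]] lin_inv[OF carr[OF ab(1)]])
  have "dev ?g \<le> 1/2"
  proof (rule dev_leI)
    fix x
    interpret linear "lin ?a" using lin_isom(1)[OF carr[OF ab(1)]] .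
    have "norm (lin ?g x - x) = norm (lin ?a (lin ?g x - x))" using lin_isom(2)[OF carr[OF ab(1)]] by simp
    also have "\<dots> = norm (lin ?b x - lin ?a x)" by (simp add: diff lin_g)
    also have "\<dots> \<le> 1/2 * norm x" by (rule K) auto
    finally show "norm (lin ?g x - x) \<le> 1/2 * norm x" .
  qed
  then have "lin ?g = id" using small_rotation_is_translation ab comp_mem inv_mem by blast
  then have "lin ?a = lin ?b" using lin_g by auto
  then have "r K = r (Suc K)" using f(2) p(1) by (simp add: inj_eq)
  then show False using r by (simp add: strict_mono_eq)
qed

end



section \<open>Translations\<close>

lemma translation_isom: "(+) (v :: real^'n::finite) \<in> carrier isom_group"
  by (simp add: isom_group_def dist_norm surj_plus)

lemma lin_translation [simp]: "lin ((+) v) = id"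
  by (auto simp: lin_def)

lemma lin_eq_id_iff: "lin f = id \<longleftrightarrow> f = (+) (f 0)"
proof
  assume "lin f = id"
  then have "f x = f 0 + x" for x using isom_eq_lin[of f x] by (simp add: add.commute)
  then show "f = (+) (f 0)" by (rule ext)
next
  assume "f = (+) (f 0)"
  from arg_cong[OF this, of lin] show "lin f = id" by simp
qed

lemma conj_translation:
  fixes f :: "('n::finite) selfmap"
  assumes "f \<in> carrier isom_group"
  shows "f \<circ> (+) v = (+) (lin f v) \<circ> f"
proof
  fix x
  interpret linear "lin f" using assms by (rule lin_isom)
  show "(f \<circ> (+) v) x = ((+) (lin f v) \<circ> f) x"
    using isom_eq_lin[of f "v + x"] isom_eq_lin[of f x] by (simp add: add)
qed

lemma inv_translation: "inv_isom ((+) v) = (+) (- v :: real^'n::finite)"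
proof -
  interpret group "isom_group :: 'n selfmap monoid" by (rule group_isom_group)
  show ?thesis by (rule inv_equality) (auto simp: translation_isom)
qed

context isometry_group
begin

lemma funpow_mem: "g \<in> G \<Longrightarrow> g ^^ k \<in> G"
  by (induction k) (simp_all only: funpow.simps id_mem comp_mem)

lemma lin_funpow: "g \<in> G \<Longrightarrow> lin (g ^^ k) = lin g ^^ k"
  by (induction k) (simp_all only: funpow.simps lin_id lin_comp carr)

lemma bij_betw_lin_comp:
  assumes "g \<in> G"
  shows "bij_betw (\<lambda>Q. lin g \<circ> Q) (lin ` G) (lin ` G)"
proof (rule bij_betw_byWitness[where f' = "\<lambda>Q. lin (inv_isom g) \<circ> Q"])
  show "\<forall>Q\<in>lin ` G. lin (inv_isom g) \<circ> (lin g \<circ> Q) = Q"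
    "\<forall>Q\<in>lin ` G. lin g \<circ> (lin (inv_isom g) \<circ> Q) = Q"
    using lin_inv[OF carr[OF assms]] by (simp_all add: comp_assoc[symmetric])
  have "lin g \<circ> lin f \<in> lin ` G" if "f \<in> G" "g \<in> G" for f g
    using lin_comp[OF carr[OF that(2)], of f] comp_mem[OF that(2,1)] by (metis imageI)
  then show "(\<lambda>Q. lin g \<circ> Q) ` lin ` G \<subseteq> lin ` G"
    "(\<lambda>Q. lin (inv_isom g) \<circ> Q) ` lin ` G \<subseteq> lin ` G"
    using assms inv_mem[OF assms] by blast+
qed

end

context crystal_group
begin

text \<open>Each linear part has finite order because its powers repeat, and the product of these
  orders serves all of them at once.\<close>

lemma point_group_exponent: "\<exists>p>0. \<forall>g\<in>G. lin (g ^^ p) = id"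
proof -
  have ex: "\<exists>q>0. P ^^ q = id" if P: "P \<in> lin ` G" for P
  proof -
    obtain g where g: "g \<in> G" "P = lin g" using P by blast
    have "P ^^ i \<in> lin ` G" for i using funpow_mem[OF g(1)] lin_funpow[OF g(1)] g(2) by (metis imageI)
    then have "range (\<lambda>i. P ^^ i) \<subseteq> lin ` G" by blast
    then have "\<not> inj (\<lambda>i. P ^^ i)"
      using finite_point_group finite_subset range_inj_infinite by blast
    then obtain i j where "P ^^ i = P ^^ j" "i < j"
      unfolding inj_def by (metis linorder_neqE_nat)
    moreover have "inj (P ^^ i)" using lin_isom(4)[OF carr[OF g(1)]] g(2) by (simp add: inj_fn)
    moreover have "P ^^ j = P ^^ i \<circ> P ^^ (j - i)" using \<open>i < j\<close> by (simp add: funpow_add[symmetric])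
    ultimately have "P ^^ (j - i) = id" by (auto simp: fun_eq_iff inj_eq)
    then show ?thesis using \<open>i < j\<close> by (intro exI[of _ "j - i"]) simp
  qed
  define q where "q P = (SOME k. k > 0 \<and> P ^^ k = id)" for P :: "real^'n \<Rightarrow> real^'n"
  have q: "q P > 0" "P ^^ q P = id" if "P \<in> lin ` G" for P
    using someI_ex[OF ex[OF that]] by (simp_all add: q_def)
  define p where "p = (\<Prod>P\<in>lin ` G. q P)"
  have "p > 0" using q(1) by (simp add: p_def prod_pos)
  moreover have "lin (g ^^ p) = id" if "g \<in> G" for g
  proof -
    have "q (lin g) dvd p"
      unfolding p_def using that finite_point_group by (intro dvd_prodI) auto
    then obtain r where "p = q (lin g) * r" by blast
    moreover have "lin g ^^ (q (lin g) * r) = id"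
      using q(2)[of "lin g"] that by (simp add: funpow_mult[symmetric])
    ultimately show ?thesis using that by (simp add: lin_funpow)
  qed
  ultimately show ?thesis by blast
qed

text \<open>Dividing an element by a fixed representative of its linear part leaves a translation,
  so finiteness of the point group makes the translation vectors relatively dense. A unit vector
  \<open>v\<close> orthogonal to all of them is impossible: far points on its line would be too
  distant from every translation vector.\<close>

lemma span_translations: "span {v. (+) v \<in> G} = UNIV"
proof (rule ccontr)
  let ?V = "{v. (+) v \<in> G}"
  assume ne: "span ?V \<noteq> UNIV"
  obtain d where d: "\<And>x. \<exists>g\<in>G. dist (g 0) x \<le> d" using dense_orbit by blast
  define rep where "rep Q = (SOME g. g \<in> G \<and> lin g = Q)" for Q
  have rep: "rep (lin g) \<in> G" "lin (rep (lin g)) = lin g" if "g \<in> G" for g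
    using someI[of "\<lambda>f. f \<in> G \<and> lin f = lin g" g] that by (simp_all add: rep_def)
  define K where "K = Max (insert 0 ((\<lambda>Q. norm (rep Q 0)) ` lin ` G))"
  have K: "norm (rep (lin g) 0) \<le> K" if "g \<in> G" for g
    unfolding K_def using finite_point_group that by (intro Max_ge) auto
  have near: "\<exists>v\<in>?V. norm (g 0 - v) \<le> K" if g: "g \<in> G" for g
  proof -
    let ?r = "rep (lin g)"
    let ?t = "g \<circ> inv_isom ?r"
    have t: "?t \<in> G" using g rep inv_mem comp_mem by blast
    have "lin ?t = id"
      using rep[OF g] lin_comp[OF carr[OF g]] lin_inv[OF carr[OF rep(1)[OF g]]] by simp
    then have tt: "?t = (+) (?t 0)" by (simp add: lin_eq_id_iff)
    then have "?t 0 \<in> ?V" using t by (metis mem_Collect_eq)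
    moreover have "g 0 = ?t 0 + ?r 0"
      using fun_cong[OF tt, of "?r 0"] inv_isom_group[OF carr[OF rep(1)[OF g]]] by simp
    then have "norm (g 0 - ?t 0) \<le> K" using K[OF g] by simp
    ultimately show ?thesis by blast
  qed
  obtain u where u: "u \<noteq> 0" "\<And>x. x \<in> span ?V \<Longrightarrow> orthogonal u x"
    using orthogonal_to_subspace_exists_gen[of ?V UNIV] ne by (auto simp: psubset_eq)
  define v where "v = u /\<^sub>R norm u"
  have v: "norm v = 1" "\<And>x. x \<in> ?V \<Longrightarrow> v \<bullet> x = 0"
    using u by (simp_all add: v_def orthogonal_def span_base)
  define s where "s = \<bar>d\<bar> + \<bar>K\<bar> + 1"
  obtain g where g: "g \<in> G" "dist (g 0) (s *\<^sub>R v) \<le> d" using d by blast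
  obtain t where t: "t \<in> ?V" "norm (g 0 - t) \<le> K" using near[OF g(1)] by blast
  have "s = v \<bullet> (s *\<^sub>R v - t)"
    using v t by (simp add: inner_simps power2_norm_eq_inner[symmetric])
  also have "\<dots> \<le> norm (s *\<^sub>R v - t)" using norm_cauchy_schwarz[of v "s *\<^sub>R v - t"] v by simp
  also have "\<dots> \<le> norm (s *\<^sub>R v - g 0) + norm (g 0 - t)"
    using norm_triangle_ineq[of "s *\<^sub>R v - g 0" "g 0 - t"] by simp
  also have "\<dots> \<le> d + K" using g t by (simp add: dist_norm norm_minus_commute)
  finally show False by (simp add: s_def)
qed

end

text \<open>A maximal independent \<open>B\<close> need not generate \<open>\<Lambda>\<close> over
  the integers, so agreement of \<open>L\<close> and \<open>h\<close> on \<open>B\<close> is not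
  enough by itself. The defect \<open>\<delta>\<close> vanishes on integer combinations of
  \<open>B\<close>. Subtracting such combinations from the multiples of \<open>x\<close> leaves
  lattice points of bounded norm; two of them coincide, so two different multiples of
  \<open>\<delta> x\<close> are equal.\<close>

lemma lattice_additive_extends_linear:
  fixes \<Lambda> :: "'a::euclidean_space set" and h :: "'a \<Rightarrow> 'b::real_vector"
  assumes zero: "0 \<in> \<Lambda>" and add: "\<And>x y. x \<in> \<Lambda> \<Longrightarrow> y \<in> \<Lambda> \<Longrightarrow> x + y \<in> \<Lambda>"
    and uminus: "\<And>x. x \<in> \<Lambda> \<Longrightarrow> - x \<in> \<Lambda>"
    and disc: "\<And>R. finite {x \<in> \<Lambda>. norm x \<le> R}" and span: "span \<Lambda> = UNIV"
    and hadd: "\<And>x y. x \<in> \<Lambda> \<Longrightarrow> y \<in> \<Lambda> \<Longrightarrow> h (x + y) = h x + h y"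
  shows "\<exists>L. linear L \<and> (\<forall>x\<in>\<Lambda>. h x = L x)"
proof -
  obtain B where B: "B \<subseteq> \<Lambda>" "independent B" "\<Lambda> \<subseteq> span B"
    using maximal_independent_subset[of \<Lambda>] by blast
  have spanB: "span B = UNIV"
    using B(3) span by (metis span_mono span_span top.extremum_uniqueI)
  have finB: "finite B" using B(2) by (rule independent_imp_finite)
  obtain L where L: "linear L" "\<And>b. b \<in> B \<Longrightarrow> L b = h b"
    using linear_independent_extend[OF B(2), of h] by blast
  interpret L: linear L by fact
  define \<delta> where "\<delta> x = h x - L x" for x
  have d_add: "\<delta> (x + y) = \<delta> x + \<delta> y" if "x \<in> \<Lambda>" "y \<in> \<Lambda>" for x y
    using that by (simp add: \<delta>_def hadd L.add)
  have d_0: "\<delta> 0 = 0" using d_add[OF zero zero] by simp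
  have d_uminus: "\<delta> (- x) = - \<delta> x" if "x \<in> \<Lambda>" for x
    using d_add[OF that uminus[OF that]] d_0 by (simp add: eq_neg_iff_add_eq_0 add.commute)
  have nat_mult: "of_nat n *\<^sub>R x \<in> \<Lambda> \<and> \<delta> (of_nat n *\<^sub>R x) = of_nat n *\<^sub>R \<delta> x" if "x \<in> \<Lambda>" for n x
    using that by (induction n) (auto simp: zero d_0 d_add add algebra_simps)
  have int_mult: "of_int n *\<^sub>R x \<in> \<Lambda> \<and> \<delta> (of_int n *\<^sub>R x) = of_int n *\<^sub>R \<delta> x" if "x \<in> \<Lambda>" for n x
  proof (cases n rule: int_cases2)
    case (nonneg m)
    then show ?thesis using nat_mult[OF that, of m] by simp
  next
    case (nonpos m)
    then show ?thesis using nat_mult[OF that, of m] d_uminus uminus by simp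
  qed
  have comb: "(\<Sum>b\<in>C. of_int (n b) *\<^sub>R b) \<in> \<Lambda> \<and> \<delta> (\<Sum>b\<in>C. of_int (n b) *\<^sub>R b) = 0"
    if "C \<subseteq> B" for C and n :: "'a \<Rightarrow> int"
    using finite_subset[OF that finB] that
  proof (induction C)
    case empty
    then show ?case by (simp add: zero d_0)
  next
    case (insert b C)
    then have b: "b \<in> \<Lambda>" "\<delta> b = 0" using B(1) L(2) by (auto simp: \<delta>_def)
    then show ?case using insert int_mult[OF b(1), of "n b"] by (simp add: add d_add)
  qed
  have "\<delta> x = 0" if x: "x \<in> \<Lambda>" for x
  proof -
    obtain c where c: "x = (\<Sum>b\<in>B. c b *\<^sub>R b)"
      using span_finite[OF finB] spanB by (metis (no_types, lifting) UNIV_I imageE)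
    \<comment> \<open>The multiple \<open>j\<close> of \<open>x\<close>, reduced to fractional
      coordinates with respect to \<open>B\<close>.\<close>
    define y where "y j = of_nat j *\<^sub>R x + - (\<Sum>b\<in>B. of_int \<lfloor>of_nat j * c b\<rfloor> *\<^sub>R b)" for j :: nat
    have ymem: "y j \<in> \<Lambda>" and dy: "\<delta> (y j) = of_nat j *\<^sub>R \<delta> x" for j
      using nat_mult[OF x, of j] comb[of B "\<lambda>b. \<lfloor>of_nat j * c b\<rfloor>"] uminus
      unfolding y_def by (simp_all add: add d_add d_uminus del: add_uminus_conv_diff)
    have "norm (y j) \<le> (\<Sum>b\<in>B. norm b)" for j
    proof -
      have "y j = (\<Sum>b\<in>B. frac (of_nat j * c b) *\<^sub>R b)"
        unfolding y_def by (simp add: c scaleR_sum_right frac_def scaleR_diff_left sum_subtractf)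
      also have "norm \<dots> \<le> (\<Sum>b\<in>B. norm b)"
      proof (rule sum_norm_le)
        fix b
        have "\<bar>frac (of_nat j * c b)\<bar> * norm b \<le> 1 * norm b"
          using frac_lt_1[of "of_nat j * c b"] frac_ge_0[of "of_nat j * c b"] by (intro mult_right_mono) auto
        then show "norm (frac (of_nat j * c b) *\<^sub>R b) \<le> norm b" by simp
      qed
      finally show ?thesis .
    qed
    then have "range y \<subseteq> {x \<in> \<Lambda>. norm x \<le> (\<Sum>b\<in>B. norm b)}" using ymem by blast
    then have "finite (range y)" using disc by (rule finite_subset)
    then have "\<not> inj y" using range_inj_infinite by blast
    then obtain i j where "i \<noteq> j" "y i = y j" unfolding inj_def by blast
    then have "of_nat i *\<^sub>R \<delta> x = of_nat j *\<^sub>R \<delta> x" using dy by metis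
    then show ?thesis using \<open>i \<noteq> j\<close> by simp
  qed
  then show ?thesis using L(1) by (intro exI[of _ L]) (auto simp: \<delta>_def)
qed

section \<open>Conjugation has finite order modulo inner automorphisms\<close>

text \<open>Some power of \<open>g\<close> is a translation by a vector \<open>t\<close>. With \<open>m\<close> the order of the point
  group of \<open>N\<close> and \<open>s\<close> the sum of the images of \<open>t\<close>
  under it, the translation by \<open>m t - s\<close> is a product of commutators, hence in \<open>N\<close>, and the
  translation by \<open>s\<close> centralises \<open>N\<close>.\<close>

lemma (in crystal_group) conjugation_power_inner:
  assumes N: "subgroup N isom_group" "N \<subseteq> G" and g: "g \<in> G"
    and norm: "\<And>f. f \<in> N \<Longrightarrow> g \<circ> f \<circ> inv_isom g \<in> N"
  shows "\<exists>k>0. \<exists>f0\<in>N. \<forall>f\<in>N. (g ^^ k) \<circ> f = f0 \<circ> f \<circ> inv_isom f0 \<circ> (g ^^ k)"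
proof -
  interpret N: isometry_group N using N(1) by (rule isometry_group.intro)
  obtain p where p: "p > 0" "lin (g ^^ p) = id" using point_group_exponent g by blast
  define t where "t = (g ^^ p) 0"
  have gp: "g ^^ p = (+) t" using p(2) by (simp add: t_def lin_eq_id_iff)
  have norm_pow: "(g ^^ i) \<circ> f \<circ> inv_isom (g ^^ i) \<in> N" if "f \<in> N" for f i
  proof (induction i)
    case 0
    have "inv_isom id = (id :: 'n selfmap)" using isom.inv_one by simp
    then show ?case using that by (simp only: funpow_0 funpow.simps id_comp comp_id)
  next
    case (Suc i)
    have gi: "g ^^ i \<in> carrier isom_group" using funpow_mem[OF g] carr by blast
    have "inv_isom (g ^^ Suc i) = inv_isom (g ^^ i) \<circ> inv_isom g"
      using isom.inv_mult_group[OF carr[OF g] gi] by simp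
    then show ?case using norm[OF Suc] by (simp only: funpow.simps comp_assoc)
  qed
  define Q where "Q = lin ` N"
  have finQ: "finite Q" unfolding Q_def using finite_point_group N(2) by (meson finite_subset image_mono)
  define s where "s = (\<Sum>P\<in>Q. P t)"
  have s_fix: "lin f s = s" if f: "f \<in> N" for f
  proof -
    interpret linear "lin f" using lin_isom(1)[OF N.carr[OF f]] .
    have "lin f s = (\<Sum>P\<in>Q. (lin f \<circ> P) t)" by (simp add: s_def sum)
    also have "\<dots> = s"
      unfolding s_def Q_def by (rule sum.reindex_bij_betw[OF N.bij_betw_lin_comp[OF f]])
    finally show ?thesis .
  qed
  \<comment> \<open>The commutator of the translation by \<open>t\<close> with \<open>f\<close> is
    the translation by \<open>t - P t\<close>; it lies in \<open>N\<close> because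
    \<open>g ^^ p\<close> normalises \<open>N\<close>.\<close>
  have comm: "(+) (t - P t) \<in> N" if "P \<in> Q" for P
  proof -
    obtain f where f: "f \<in> N" "P = lin f" using \<open>P \<in> Q\<close> by (auto simp: Q_def)
    have "(+) t \<circ> f \<circ> (+) (- t) \<circ> inv_isom f \<in> N"
      using norm_pow[OF f(1), of p] f(1) N.inv_mem N.comp_mem by (simp add: gp inv_translation)
    moreover have "(+) t \<circ> f \<circ> (+) (- t) \<circ> inv_isom f = (+) (t - P t)"
    proof -
      interpret linear "lin f" using lin_isom(1)[OF N.carr[OF f(1)]] .
      have "(+) t \<circ> (f \<circ> (+) (- t)) \<circ> inv_isom f
          = (+) t \<circ> (+) (lin f (- t)) \<circ> (f \<circ> inv_isom f)"
        unfolding conj_translation[OF N.carr[OF f(1)]] by (simp add: comp_assoc)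
      then show ?thesis using inv_isom_group(2)[OF N.carr[OF f(1)]]
        by (auto simp: comp_assoc f(2) neg fun_eq_iff)
    qed
    ultimately show ?thesis by simp
  qed
  have sum_mem: "(+) (\<Sum>P\<in>C. t - P t) \<in> N" if "C \<subseteq> Q" for C
    using finite_subset[OF that finQ] that
  proof (induction C)
    case empty
    have "(+) (0::real^'n) = id" by auto
    then show ?case using N.id_mem by (metis sum.empty)
  next
    case (insert P C)
    have "(+) ((t - P t) + (\<Sum>P\<in>C. t - P t)) = (+) (t - P t) \<circ> (+) (\<Sum>P\<in>C. t - P t)"
      by (auto simp: algebra_simps)
    moreover have "(+) (t - P t) \<in> N" using comm insert.prems by blast
    moreover have "(+) (\<Sum>P\<in>C. t - P t) \<in> N" using insert by blast
    ultimately have "(+) ((t - P t) + (\<Sum>P\<in>C. t - P t)) \<in> N" by (metis N.comp_mem)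
    then show ?case using insert.hyps by simp
  qed
  define m where "m = card Q"
  have "m > 0" unfolding m_def Q_def[symmetric] using finQ N.id_mem by (auto simp: card_gt_0_iff Q_def)
  define f0 where "f0 = (+) (of_nat m *\<^sub>R t - s)"
  have f0: "f0 \<in> N"
    using sum_mem[of Q] by (simp add: f0_def m_def s_def sum_subtractf scaleR_conv_of_real sum_constant_scaleR)
  have "((+) t) ^^ i = (+) (of_nat i *\<^sub>R t)" for i
    by (induction i) (auto simp: algebra_simps)
  \<comment> \<open>The power is the translation by \<open>m\<close> times \<open>t\<close>, split
    into \<open>f0\<close>, which lies in \<open>N\<close>, and the shift by \<open>s\<close>, which
    commutes with \<open>N\<close>.\<close>
  then have gk: "g ^^ (p * m) = f0 \<circ> (+) s"
    by (auto simp: funpow_mult[symmetric] gp f0_def)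
  have "(g ^^ (p * m)) \<circ> f = f0 \<circ> f \<circ> inv_isom f0 \<circ> (g ^^ (p * m))" if f: "f \<in> N" for f
  proof -
    have "f \<circ> (+) s = (+) s \<circ> f"
      using conj_translation[OF N.carr[OF f], of s] s_fix[OF f] by simp
    moreover have "inv_isom f0 \<circ> f0 = id" using inv_isom_group(1)[OF N.carr[OF f0]] .
    ultimately show ?thesis unfolding gk by (metis comp_assoc id_comp)
  qed
  moreover have "p * m > 0" using \<open>p > 0\<close> \<open>m > 0\<close> by simp
  ultimately show ?thesis using f0 by blast
qed



section \<open>Realising automorphisms of finite order by isometries\<close>

lemma isom_comp_left_cancel:
  fixes f :: "('n::finite) selfmap"
  assumes "f \<in> carrier isom_group" "f \<circ> g = f \<circ> h"
  shows "g = h"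
proof
  fix x
  have "dist (g x) (h x) = dist (f (g x)) (f (h x))" using isom_groupD(2)[OF assms(1)] by simp
  also have "f (g x) = f (h x)" using fun_cong[OF assms(2), of x] by simp
  finally show "g x = h x" by simp
qed

lemma isom_conj_eqI:
  fixes f :: "('n::finite) selfmap"
  assumes "f \<in> carrier isom_group" "f \<circ> g = h \<circ> f"
  shows "f \<circ> g \<circ> inv_isom f = h"
  unfolding assms(2) comp_assoc inv_isom_group(2)[OF assms(1)] by simp

text \<open>This replaces the square root of a positive semidefinite form. The map \<open>T\<close>
  into the product has a range of dimension at most that of \<open>'a\<close>, so the range can be
  carried isometrically back into \<open>'a\<close>.\<close>

lemma exists_linear_sum_of_squares:
  fixes L :: "nat \<Rightarrow> 'a::euclidean_space \<Rightarrow> 'a"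
  assumes "\<And>i. linear (L i)"
  shows "\<exists>S::'a \<Rightarrow> 'a. linear S \<and> (\<forall>x. (norm (S x))\<^sup>2 = (\<Sum>i<k. (norm (L i x))\<^sup>2))"
proof (induction k)
  case 0
  show ?case by (intro exI[of _ "\<lambda>x. 0"]) (auto simp: linear_iff)
next
  case (Suc k)
  then obtain S :: "'a \<Rightarrow> 'a" where S: "linear S" "\<And>x. (norm (S x))\<^sup>2 = (\<Sum>i<k. (norm (L i x))\<^sup>2)"
    by blast
  define T where "T x = (S x, L k x)" for x
  have T: "linear T"
    unfolding T_def using S(1) assms[of k] by (simp add: linear_iff)
  have "subspace (range T)" using T by (rule linear_subspace_image) simp
  moreover have "dim (range T) \<le> dim (UNIV :: 'a set)" using T by (rule dim_image_le)
  ultimately obtain f :: "'a \<times> 'a \<Rightarrow> 'a" where f: "linear f" "\<And>y. y \<in> range T \<Longrightarrow> norm (f y) = norm y"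
    using isometry_subset_subspace[of "range T" "UNIV :: 'a set"] by auto
  have "(norm ((f \<circ> T) x))\<^sup>2 = (\<Sum>i<Suc k. (norm (L i x))\<^sup>2)" for x
    by (simp add: f(2) T_def norm_Pair S(2) sum_nonneg)
  then show ?case using linear_compose[OF T f(1)] by blast
qed

text \<open>An automorphism \<open>\<theta>\<close> acts on the translations by a linear map \<open>L\<close>, which extends to an affine
  map \<open>x \<mapsto> L x + a\<close> inducing \<open>\<theta>\<close>: the obstruction is a cocycle on the point group, killed by
  averaging. As \<open>L\<^sup>k\<close> lies in the point group, \<open>\<Sum>i<k. |L\<^sup>i x|\<^sup>2\<close> is an inner product invariant
  under \<open>L\<close> and the point group; \<open>S\<close> carries it to the standard one.\<close>

lemma (in crystal_group) affine_realisation: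
  assumes \<theta>: "\<And>g. g \<in> G \<Longrightarrow> \<theta> g \<in> G" and \<theta>_comp: "\<And>f g. f \<in> G \<Longrightarrow> g \<in> G \<Longrightarrow> \<theta> (f \<circ> g) = \<theta> f \<circ> \<theta> g"
    and k: "k > 0" and m0: "m0 \<in> G"
    and inner: "\<And>g. g \<in> G \<Longrightarrow> (\<theta> ^^ k) g = m0 \<circ> g \<circ> inv_isom m0"
  shows "\<exists>L a. \<exists>S :: real^'n \<Rightarrow> real^'n. linear L \<and> linear S \<and> inj S \<and>
    (\<forall>g\<in>G. \<forall>x. norm (S (lin g x)) = norm (S x)) \<and> (\<forall>x. norm (S (L x)) = norm (S x)) \<and>
    (\<forall>g\<in>G. \<forall>x. L (g x) + a = \<theta> g (L x + a))"
proof -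
  obtain p where p: "p > 0" "\<And>g. g \<in> G \<Longrightarrow> lin (g ^^ p) = id" using point_group_exponent by blast
  have \<theta>i: "(\<theta> ^^ i) g \<in> G" if "g \<in> G" for g i
    by (induction i) (simp_all add: that \<theta>)
  have \<theta>i_comp: "(\<theta> ^^ i) (f \<circ> g) = (\<theta> ^^ i) f \<circ> (\<theta> ^^ i) g" if "f \<in> G" "g \<in> G" for f g i
  proof (induction i)
    case (Suc i)
    have "(\<theta> ^^ Suc i) (f \<circ> g) = \<theta> ((\<theta> ^^ i) (f \<circ> g))" by (simp only: funpow.simps comp_apply[of \<theta>])
    also have "\<dots> = \<theta> ((\<theta> ^^ i) f \<circ> (\<theta> ^^ i) g)" by (simp only: Suc)
    also have "\<dots> = \<theta> ((\<theta> ^^ i) f) \<circ> \<theta> ((\<theta> ^^ i) g)" by (rule \<theta>_comp[OF \<theta>i \<theta>i]) fact+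
    finally show ?case by (simp only: funpow.simps comp_apply[of \<theta>])
  qed simp
  have \<theta>i_id: "(\<theta> ^^ i) id = id" for i
  proof -
    have "(\<theta> ^^ i) id \<circ> (\<theta> ^^ i) id = (\<theta> ^^ i) id \<circ> id" using \<theta>i_comp[OF id_mem id_mem, of i] by simp
    then show ?thesis by (rule isom_comp_left_cancel[OF carr[OF \<theta>i[OF id_mem]]])
  qed
  have \<theta>i_pow: "(\<theta> ^^ i) (g ^^ j) = (\<theta> ^^ i) g ^^ j" if "g \<in> G" for g i j
    by (induction j) (simp_all only: funpow.simps \<theta>i_id \<theta>i_comp[OF that funpow_mem[OF that]])
  have \<theta>i_inv: "(\<theta> ^^ i) (inv_isom g) = inv_isom ((\<theta> ^^ i) g)" if "g \<in> G" for g i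
  proof -
    have "(\<theta> ^^ i) (inv_isom g) \<circ> (\<theta> ^^ i) g = id"
      using \<theta>i_comp[OF inv_mem[OF that] that, of i] inv_isom_group(1)[OF carr[OF that]] \<theta>i_id by simp
    then show ?thesis
      using isom.inv_equality[of "(\<theta> ^^ i) (inv_isom g)" "(\<theta> ^^ i) g"] carr \<theta>i inv_mem that by simp
  qed
  \<comment> \<open>It is not yet known that \<open>\<theta>\<close> sends translations to
    translations. Demanding this for all iterates gives a lattice that \<open>\<theta>\<close> maps
    into itself.\<close>
  define \<Lambda> where "\<Lambda> = {v. (+) v \<in> G \<and> (\<forall>i. lin ((\<theta> ^^ i) ((+) v)) = id)}"
  have plus: "(+) (v + w) = (+) v \<circ> (+) w" for v w :: "real^'n" by (auto simp: algebra_simps)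
  have \<Lambda>G: "(+) v \<in> G" if "v \<in> \<Lambda>" for v using that by (simp add: \<Lambda>_def)
  have \<Lambda>_add: "v + w \<in> \<Lambda>" if "v \<in> \<Lambda>" "w \<in> \<Lambda>" for v w
  proof -
    have "(+) (v + w) \<in> G" unfolding plus using that \<Lambda>G comp_mem by blast
    moreover have "lin ((\<theta> ^^ i) ((+) (v + w))) = id" for i
      unfolding plus \<theta>i_comp[OF \<Lambda>G[OF that(1)] \<Lambda>G[OF that(2)]]
        lin_comp[OF carr[OF \<theta>i[OF \<Lambda>G[OF that(1)]]]]
      using that by (simp add: \<Lambda>_def)
    ultimately show ?thesis unfolding \<Lambda>_def by blast
  qed
  have \<Lambda>_0: "0 \<in> \<Lambda>"
  proof -
    have "(+) (0::real^'n) = id" by auto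
    then show ?thesis unfolding \<Lambda>_def mem_Collect_eq using id_mem \<theta>i_id lin_id by metis
  qed
  have \<Lambda>_uminus: "- v \<in> \<Lambda>" if "v \<in> \<Lambda>" for v
  proof -
    have "(+) (- v) \<in> G" using inv_mem[OF \<Lambda>G[OF that]] by (simp add: inv_translation)
    moreover have "lin ((\<theta> ^^ i) ((+) (- v))) = id" for i
    proof -
      have t: "(\<theta> ^^ i) ((+) v) = (+) ((\<theta> ^^ i) ((+) v) 0)"
        using that by (simp add: \<Lambda>_def lin_eq_id_iff[symmetric])
      have "(\<theta> ^^ i) ((+) (- v)) = inv_isom ((\<theta> ^^ i) ((+) v))"
        using \<theta>i_inv[OF \<Lambda>G[OF that], of i] by (simp add: inv_translation)
      also have "\<dots> = (+) (- ((\<theta> ^^ i) ((+) v) 0))" by (subst t) (rule inv_translation)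
      finally show ?thesis by simp
    qed
    ultimately show ?thesis unfolding \<Lambda>_def by blast
  qed
  have \<Lambda>_disc: "finite {v \<in> \<Lambda>. norm v \<le> R}" for R
  proof -
    have "(\<lambda>v. (+) v) ` {v \<in> \<Lambda>. norm v \<le> R} \<subseteq> {g \<in> G. norm (g 0) \<le> R}" using \<Lambda>G by auto
    then have "finite ((\<lambda>v. (+) v) ` {v \<in> \<Lambda>. norm v \<le> R})"
      using finite_bounded finite_subset by blast
    moreover have "inj_on (\<lambda>v. (+) v) {v \<in> \<Lambda>. norm v \<le> R}"
      by (intro inj_onI) (metis add.right_neutral)
    ultimately show ?thesis by (rule finite_imageD)
  qed
  \<comment> \<open>The image of \<open>(+) v ^^ p\<close> under an iterate of
    \<open>\<theta>\<close> is a \<open>p\<close>-th power in \<open>G\<close>, and \<open>p\<close>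
    kills every linear part. Hence \<open>\<Lambda>\<close> is large enough to span.\<close>
  have \<Lambda>_mult: "of_nat p *\<^sub>R v \<in> \<Lambda>" if v: "(+) v \<in> G" for v
  proof -
    have "(+) v ^^ j = (+) (of_nat j *\<^sub>R v)" for j by (induction j) (auto simp: algebra_simps)
    then have eq: "(+) (of_nat p *\<^sub>R v) = (+) v ^^ p" by simp
    show ?thesis
      unfolding \<Lambda>_def mem_Collect_eq eq \<theta>i_pow[OF v] using funpow_mem[OF v] p(2) \<theta>i[OF v] by blast
  qed
  have \<Lambda>_span: "span \<Lambda> = UNIV"
  proof -
    have "v \<in> span \<Lambda>" if "(+) v \<in> G" for v
    proof -
      have "(1 / of_nat p) *\<^sub>R of_nat p *\<^sub>R v \<in> span \<Lambda>"
        by (intro span_mul span_base \<Lambda>_mult that)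
      then show ?thesis using p(1) by simp
    qed
    then have "span {v. (+) v \<in> G} \<subseteq> span \<Lambda>" by (intro span_minimal) auto
    then show ?thesis using span_translations by auto
  qed
  define h where "h v = \<theta> ((+) v) 0" for v
  have \<theta>_transl: "\<theta> ((+) v) = (+) (h v)" if "v \<in> \<Lambda>" for v
  proof -
    have "lin ((\<theta> ^^ 1) ((+) v)) = id" using that unfolding \<Lambda>_def by blast
    then show ?thesis by (simp add: h_def lin_eq_id_iff)
  qed
  have "h (v + w) = h v + h w" if "v \<in> \<Lambda>" "w \<in> \<Lambda>" for v w
  proof -
    have "h (v + w) = (\<theta> ((+) v) \<circ> \<theta> ((+) w)) 0"
      unfolding h_def plus using \<theta>_comp[OF \<Lambda>G[OF that(1)] \<Lambda>G[OF that(2)]] by simp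
    then show ?thesis using that by (simp add: \<theta>_transl)
  qed
  then obtain L where L: "linear L" "\<And>v. v \<in> \<Lambda> \<Longrightarrow> h v = L v"
    using lattice_additive_extends_linear[of \<Lambda> h] \<Lambda>_0 \<Lambda>_add \<Lambda>_uminus \<Lambda>_disc \<Lambda>_span by blast
  interpret L: linear L by fact
  have L_\<Lambda>: "\<theta> ((+) v) = (+) (L v)" if "v \<in> \<Lambda>" for v
    using that by (simp add: \<theta>_transl L(2))
  have L_mem: "L v \<in> \<Lambda>" if "v \<in> \<Lambda>" for v
  proof -
    have "(+) (L v) \<in> G" using \<theta>[OF \<Lambda>G[OF that]] L_\<Lambda>[OF that] by simp
    moreover have "lin ((\<theta> ^^ i) ((+) (L v))) = id" for i
    proof -
      have "(\<theta> ^^ i) ((+) (L v)) = (\<theta> ^^ Suc i) ((+) v)"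
        unfolding L_\<Lambda>[OF that, symmetric] by (simp add: funpow_swap1)
      then show ?thesis using that unfolding \<Lambda>_def by (metis (mono_tags, lifting) mem_Collect_eq)
    qed
    ultimately show ?thesis unfolding \<Lambda>_def by blast
  qed
  have lin_mem: "lin g v \<in> \<Lambda>" if g: "g \<in> G" and v: "v \<in> \<Lambda>" for g v
  proof -
    have eq: "(+) (lin g v) = g \<circ> (+) v \<circ> inv_isom g"
      by (rule isom_conj_eqI[OF carr[OF g] conj_translation[OF carr[OF g]], symmetric])
    note vG = \<Lambda>G[OF v]
    have "(+) (lin g v) \<in> G" unfolding eq by (rule comp_mem[OF comp_mem[OF g vG] inv_mem[OF g]])
    moreover have "lin ((\<theta> ^^ i) ((+) (lin g v))) = id" for i
    proof -
      let ?\<theta> = "\<theta> ^^ i"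
      have "?\<theta> ((+) (lin g v)) = ?\<theta> g \<circ> ?\<theta> ((+) v) \<circ> inv_isom (?\<theta> g)"
        unfolding eq \<theta>i_comp[OF comp_mem[OF g vG] inv_mem[OF g]] \<theta>i_comp[OF g vG] \<theta>i_inv[OF g] ..
      moreover have gG: "?\<theta> g \<in> carrier isom_group" by (rule carr[OF \<theta>i[OF g]])
      moreover have "?\<theta> g \<circ> ?\<theta> ((+) v) \<in> carrier isom_group"
        by (rule carr[OF comp_mem[OF \<theta>i[OF g] \<theta>i[OF vG]]])
      ultimately have "lin (?\<theta> ((+) (lin g v))) = lin (?\<theta> g) \<circ> lin (?\<theta> ((+) v)) \<circ> lin (inv_isom (?\<theta> g))"
        by (simp only: lin_comp)
      then show ?thesis using v lin_inv(2)[OF gG] unfolding \<Lambda>_def by simp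
    qed
    ultimately show ?thesis unfolding \<Lambda>_def by blast
  qed
  \<comment> \<open>Apply \<open>\<theta>\<close> to
    \<open>(+) (lin g v) \<circ> g = g \<circ> (+) v\<close>. Both sides of the claim are linear, so
    it extends from the spanning set \<open>\<Lambda>\<close>.\<close>
  have L_lin: "L (lin g x) = lin (\<theta> g) (L x)" if g: "g \<in> G" for g x
  proof -
    interpret g: linear "lin g" using lin_isom(1)[OF carr[OF g]] .
    interpret \<theta>g: linear "lin (\<theta> g)" using lin_isom(1)[OF carr[OF \<theta>[OF g]]] .
    have on: "(L \<circ> lin g) v = (lin (\<theta> g) \<circ> L) v" if v: "v \<in> \<Lambda>" for v
    proof -
      have "(+) (lin g v) \<circ> g = g \<circ> (+) v" using conj_translation[OF carr[OF g]] by simp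
      then have "\<theta> ((+) (lin g v)) \<circ> \<theta> g = \<theta> g \<circ> \<theta> ((+) v)"
        using \<theta>_comp[OF \<Lambda>G[OF lin_mem[OF g v]] g] \<theta>_comp[OF g \<Lambda>G[OF v]] by simp
      then have "(+) (L (lin g v)) \<circ> \<theta> g = \<theta> g \<circ> (+) (L v)"
        unfolding L_\<Lambda>[OF v] L_\<Lambda>[OF lin_mem[OF g v]] .
      also have "\<dots> = (+) (lin (\<theta> g) (L v)) \<circ> \<theta> g" by (rule conj_translation[OF carr[OF \<theta>[OF g]]])
      finally have "L (lin g v) + \<theta> g 0 = lin (\<theta> g) (L v) + \<theta> g 0" by (metis comp_apply)
      then show ?thesis by simp
    qed
    have "(L \<circ> lin g) x = (lin (\<theta> g) \<circ> L) x"
      by (rule linear_eq_on_span[of "L \<circ> lin g" "lin (\<theta> g) \<circ> L" \<Lambda>, OF _ _ on])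
        (simp_all add: \<Lambda>_span linear_compose L(1) g.linear_axioms \<theta>g.linear_axioms del: comp_apply)
    then show ?thesis by simp
  qed
  have Li: "linear (L ^^ i)" for i
  proof (induction i)
    case (Suc i)
    show ?case using linear_compose[OF Suc L(1)] by (simp only: funpow.simps)
  qed (auto simp: linear_iff)
  have Li_\<Lambda>: "(\<theta> ^^ i) ((+) v) = (+) ((L ^^ i) v) \<and> (L ^^ i) v \<in> \<Lambda>" if "v \<in> \<Lambda>" for v i
    by (induction i) (simp_all add: that L_\<Lambda> L_mem)
  \<comment> \<open>The \<open>k\<close>-th iterate of \<open>\<theta>\<close> is conjugation by
    \<open>m0\<close>, which acts on translations through \<open>lin m0\<close>.\<close>
  have Lk: "(L ^^ k) x = lin m0 x" for x
  proof (rule linear_eq_on_span[of "L ^^ k" "lin m0" \<Lambda>])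
    fix v assume v: "v \<in> \<Lambda>"
    have "(+) ((L ^^ k) v) = m0 \<circ> (+) v \<circ> inv_isom m0"
      using Li_\<Lambda>[OF v, of k] inner[OF \<Lambda>G[OF v]] by simp
    also have "\<dots> = (+) (lin m0 v)"
      by (rule isom_conj_eqI[OF carr[OF m0] conj_translation[OF carr[OF m0]]])
    finally have "(L ^^ k) v + 0 = lin m0 v + 0" by (rule fun_cong)
    then show "(L ^^ k) v = lin m0 v" by simp
  qed (use Li lin_isom(1)[OF carr[OF m0]] \<Lambda>_span in auto)
  have Lk_norm: "norm ((L ^^ k) x) = norm x" for x
    unfolding Lk by (rule lin_isom(2)[OF carr[OF m0]])
  have "inj L"
    unfolding linear_injective_0[OF L(1)]
  proof (intro allI impI)
    fix x assume "L x = 0"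
    then have "(L ^^ k) x = 0" using k linear_0[OF Li] by (cases k) (auto simp: funpow_swap1)
    then show "x = 0" using Lk_norm[of x] by simp
  qed
  then have "surj L" using linear_injective_imp_surjective[OF L(1)] by blast
  \<comment> \<open>With \<open>L\<close> surjective, the intertwining relation \<open>L_lin\<close>
    shows that \<open>\<theta>\<close> preserves all translations of \<open>G\<close>.\<close>
  have \<theta>_id: "lin (\<theta> t) = id" if t: "t \<in> G" "lin t = id" for t
  proof
    fix y
    obtain x where "y = L x" using \<open>surj L\<close> by (metis surjD)
    then show "lin (\<theta> t) y = id y" using L_lin[OF t(1), of x] t(2) by simp
  qed
  \<comment> \<open>Consequently \<open>\<Lambda>\<close> is the full translation lattice.\<close>
  have transl_\<Lambda>: "t 0 \<in> \<Lambda>" "t = (+) (t 0)" if t: "t \<in> G" "lin t = id" for t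
  proof -
    show tt: "t = (+) (t 0)" using t(2) by (simp add: lin_eq_id_iff)
    have "lin ((\<theta> ^^ i) t) = id" for i
    proof (induction i)
      case (Suc i)
      show ?case using \<theta>_id[OF \<theta>i[OF t(1)] Suc] by (simp only: funpow.simps comp_apply[of \<theta>])
    qed (simp only: funpow_0 t)
    then have "(+) (t 0) \<in> G \<and> (\<forall>i. lin ((\<theta> ^^ i) ((+) (t 0))) = id)"
      unfolding tt[symmetric] using t by blast
    then show "t 0 \<in> \<Lambda>" by (simp add: \<Lambda>_def)
  qed
  \<comment> \<open>The cocycle: the discrepancy at the origin between \<open>\<theta> g\<close> and
    the conjugate of \<open>g\<close> by \<open>L\<close>.\<close>
  define c where "c g = \<theta> g 0 - L (g 0)" for g
  have c_comp: "c (f \<circ> g) = lin (\<theta> f) (c g) + c f" if "f \<in> G" "g \<in> G" for f g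
  proof -
    interpret \<theta>f: linear "lin (\<theta> f)" using lin_isom(1)[OF carr[OF \<theta>[OF that(1)]]] .
    show ?thesis
      unfolding c_def \<theta>_comp[OF that] comp_apply
      using isom_eq_lin[of "\<theta> f" "\<theta> g 0"] isom_eq_lin[of f "g 0"] L_lin[OF that(1), of "g 0"]
      by (simp add: \<theta>f.diff L.add)
  qed
  have c_transl: "c t = 0" if "t \<in> G" "lin t = id" for t
  proof -
    have "\<theta> t 0 = L (t 0)"
      using L_\<Lambda>[OF transl_\<Lambda>(1)[OF that]] transl_\<Lambda>(2)[OF that] by (metis add.right_neutral)
    then show ?thesis by (simp add: c_def)
  qed
  \<comment> \<open>\<open>c\<close> vanishes on translations, so it descends to the finite point
    group, where it can be averaged.\<close>
  have c_cong: "c f = c g" if "f \<in> G" "g \<in> G" "lin f = lin g" for f g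
  proof -
    let ?t = "f \<circ> inv_isom g"
    have t: "?t \<in> G" using that comp_mem inv_mem by blast
    have lt: "lin ?t = id" using that lin_comp[OF carr[OF that(1)]] lin_inv(2)[OF carr[OF that(2)]] by simp
    have "f = ?t \<circ> g" using inv_isom_group(1)[OF carr[OF that(2)]] by (simp add: comp_assoc)
    then have "c f = lin (\<theta> ?t) (c g) + c ?t" using c_comp[OF t that(2)] by simp
    then show ?thesis using \<theta>_id[OF t lt] c_transl[OF t lt] by simp
  qed
  define rep where "rep Q = (SOME g. g \<in> G \<and> lin g = Q)" for Q
  have rep: "rep (lin g) \<in> G" "lin (rep (lin g)) = lin g" if "g \<in> G" for g
    using someI[of "\<lambda>f. f \<in> G \<and> lin f = lin g" g] that by (simp_all add: rep_def)
  define m where "m = card (lin ` G)"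
  have m: "m > 0" unfolding m_def using finite_point_group id_mem by (auto simp: card_gt_0_iff)
  define a where "a = (1 / of_nat m) *\<^sub>R (\<Sum>Q\<in>lin ` G. c (rep Q))"
  \<comment> \<open>Left multiplication by \<open>lin g\<close> permutes the point group; expanding
    the reindexed sum by the cocycle identity returns the average itself.\<close>
  have a_eq: "lin (\<theta> g) a + c g = a" if g: "g \<in> G" for g
  proof -
    interpret \<theta>g: linear "lin (\<theta> g)" using lin_isom(1)[OF carr[OF \<theta>[OF g]]] .
    have "(\<Sum>Q\<in>lin ` G. c (rep Q)) = (\<Sum>Q\<in>lin ` G. c (rep (lin g \<circ> Q)))"
      by (rule sum.reindex_bij_betw[OF bij_betw_lin_comp[OF g], symmetric])
    also have "\<dots> = (\<Sum>Q\<in>lin ` G. lin (\<theta> g) (c (rep Q)) + c g)"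
    proof (rule sum.cong[OF refl])
      fix Q assume "Q \<in> lin ` G"
      then obtain f where f: "f \<in> G" "Q = lin f" by blast
      have "lin g \<circ> lin f = lin (g \<circ> rep (lin f))"
        using lin_comp[OF carr[OF g]] rep(2)[OF f(1)] by simp
      then have "c (rep (lin g \<circ> Q)) = c (g \<circ> rep (lin f))"
        unfolding f(2) using rep comp_mem[OF g rep(1)[OF f(1)]] by (intro c_cong) auto
      then show "c (rep (lin g \<circ> Q)) = lin (\<theta> g) (c (rep Q)) + c g"
        using c_comp[OF g rep(1)[OF f(1)]] f(2) by simp
    qed
    also have "\<dots> = lin (\<theta> g) (\<Sum>Q\<in>lin ` G. c (rep Q)) + of_nat m *\<^sub>R c g"
      by (simp add: sum.distrib \<theta>g.sum m_def sum_constant_scaleR del: sum_constant)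
    finally have "a = (1 / of_nat m) *\<^sub>R (lin (\<theta> g) (\<Sum>Q\<in>lin ` G. c (rep Q)) + of_nat m *\<^sub>R c g)"
      unfolding a_def by simp
    also have "\<dots> = lin (\<theta> g) a + c g"
      using m by (simp add: a_def \<theta>g.scale scaleR_add_right)
    finally show ?thesis by simp
  qed
  have conj: "L (g x) + a = \<theta> g (L x + a)" if g: "g \<in> G" for g x
  proof -
    interpret \<theta>g: linear "lin (\<theta> g)" using lin_isom(1)[OF carr[OF \<theta>[OF g]]] .
    have "\<theta> g (L x + a) = lin (\<theta> g) (L x) + lin (\<theta> g) a + \<theta> g 0"
      using isom_eq_lin[of "\<theta> g" "L x + a"] \<theta>g.add by simp
    moreover have "L (g x) = L (lin g x) + L (g 0)"
      using isom_eq_lin[of g x] L.add by simp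
    moreover have "\<theta> g 0 = c g + L (g 0)" by (simp add: c_def)
    moreover note a_eq[OF g, symmetric] L_lin[OF g, of x]
    ultimately show ?thesis by (metis (no_types, lifting) add.assoc add.commute)
  qed
  obtain S :: "real^'n \<Rightarrow> real^'n"
    where S: "linear S" "\<And>x. (norm (S x))\<^sup>2 = (\<Sum>i<k. (norm ((L ^^ i) x))\<^sup>2)"
    using exists_linear_sum_of_squares[of "\<lambda>i. L ^^ i" k] Li by blast
  have "inj S"
    unfolding linear_injective_0[OF S(1)]
  proof (intro allI impI)
    fix x assume "S x = 0"
    then have "(\<Sum>i<k. (norm ((L ^^ i) x))\<^sup>2) = 0" using S(2)[of x] by simp
    then have "\<forall>i\<in>{..<k}. (norm ((L ^^ i) x))\<^sup>2 = 0"
      by (subst (asm) sum_nonneg_eq_0_iff) auto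
    then have "(norm ((L ^^ 0) x))\<^sup>2 = 0" using k by blast
    then show "x = 0" by simp
  qed
  moreover have "norm (S (lin g x)) = norm (S x)" if "g \<in> G" for g x
  proof -
    \<comment> \<open>\<open>L ^^ i\<close> turns the action of \<open>g\<close> into that of
      \<open>(\<theta> ^^ i) g\<close>, which is again orthogonal, so every summand is invariant by
      itself.\<close>
    have "(L ^^ i) (lin g x) = lin ((\<theta> ^^ i) g) ((L ^^ i) x)" for i
      by (induction i) (simp_all add: L_lin \<theta>i that)
    then have "(norm (S (lin g x)))\<^sup>2 = (norm (S x))\<^sup>2"
      unfolding S(2) using lin_isom(2)[OF carr[OF \<theta>i[OF that]]] by simp
    then show ?thesis by simp
  qed
  moreover have "norm (S (L x)) = norm (S x)" for x
  proof -
    \<comment> \<open>\<open>L\<close> shifts the summation index by one, and the two end terms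
      cancel because \<open>L ^^ k\<close> preserves norms.\<close>
    have "(norm (S (L x)))\<^sup>2 = (\<Sum>i<k. (norm ((L ^^ Suc i) x))\<^sup>2)"
      unfolding S(2) by (simp add: funpow_swap1)
    also have "\<dots> = (\<Sum>i<Suc k. (norm ((L ^^ i) x))\<^sup>2) - (norm x)\<^sup>2"
      by (subst sum.lessThan_Suc_shift) simp
    also have "\<dots> = (norm (S x))\<^sup>2" unfolding S(2) using Lk_norm[of x] by simp
    finally show ?thesis by simp
  qed
  ultimately show ?thesis using L(1) S(1) conj by blast
qed



section \<open>Extensions with infinite cyclic quotient\<close>

text \<open>An extension of the integers by \<open>N\<close> is encoded by the exponent homomorphism \<open>e\<close> with
  kernel \<open>N\<close> that sends the chosen generator to \<open>1\<close>.\<close>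

definition cyclic_ext :: "('a, 'b) monoid_scheme \<Rightarrow> 'a set \<Rightarrow> ('a \<Rightarrow> int) \<Rightarrow> 'a \<Rightarrow> bool" where
  "cyclic_ext G N e g \<longleftrightarrow> group G \<and> e \<in> hom G integer_group \<and> N = kernel G integer_group e \<and>
     g \<in> carrier G \<and> e g = 1"

lemma cyclic_extD:
  fixes G (structure)
  assumes "cyclic_ext G N e g"
  shows "group G" "group_hom G integer_group e" "g \<in> carrier G" "e g = 1"
    "x \<in> N \<longleftrightarrow> x \<in> carrier G \<and> e x = 0" "N \<lhd> G"
    "x \<in> carrier G \<Longrightarrow> y \<in> carrier G \<Longrightarrow> e (x \<otimes> y) = e x + e y"
    "x \<in> carrier G \<Longrightarrow> e (inv x) = - e x"
    "x \<in> carrier G \<Longrightarrow> e (x [^] (i::int)) = i * e x"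
proof -
  show G: "group G" "g \<in> carrier G" "e g = 1" using assms by (auto simp: cyclic_ext_def)
  show gh: "group_hom G integer_group e"
    using assms by (simp add: cyclic_ext_def group_hom_def group_hom_axioms_def)
  then interpret group_hom G integer_group e .
  show "x \<in> N \<longleftrightarrow> x \<in> carrier G \<and> e x = 0"
    using assms by (auto simp: cyclic_ext_def kernel_def)
  show "N \<lhd> G" using assms normal_kernel by (simp add: cyclic_ext_def)
  show "x \<in> carrier G \<Longrightarrow> y \<in> carrier G \<Longrightarrow> e (x \<otimes> y) = e x + e y" by simp
  show "x \<in> carrier G \<Longrightarrow> e (inv x) = - e x" by (simp add: hom_inv)
  show "x \<in> carrier G \<Longrightarrow> e (x [^] (i::int)) = i * e x" by (simp add: hom_int_pow)
qed

lemma cyclic_ext_split: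
  fixes G (structure)
  assumes "cyclic_ext G N e g" "x \<in> carrier G"
  shows "x \<otimes> g [^] (- e x) \<in> N" "x = (x \<otimes> g [^] (- e x)) \<otimes> g [^] e x"
proof -
  interpret group G using assms(1) by (rule cyclic_extD)
  note D = cyclic_extD[OF assms(1)]
  show "x \<otimes> g [^] (- e x) \<in> N" using assms(2) D by simp
  have "(x \<otimes> g [^] (- e x)) \<otimes> g [^] e x = x \<otimes> (g [^] (- e x) \<otimes> g [^] e x)"
    using assms(2) D(3) by (simp add: m_assoc)
  also have "\<dots> = x" using assms(2) D(3) by (simp add: int_pow_mult[symmetric])
  finally show "x = (x \<otimes> g [^] (- e x)) \<otimes> g [^] e x" ..
qed

text \<open>A nonzero \<open>i\<close> would let every exponent be reduced modulo \<open>i\<close>,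
  leaving finitely many elements.\<close>

lemma (in group) infinite_cyclic_pow_inj:
  assumes a: "a \<in> carrier G" and gen: "generate G {a} = carrier G" and inf: "infinite (carrier G)"
    and eq: "a [^] (i::int) = \<one>"
  shows "i = 0"
proof (rule ccontr)
  assume "i \<noteq> 0"
  have "carrier G \<subseteq> (\<lambda>j. a [^] j) ` {- \<bar>i\<bar>..\<bar>i\<bar>}"
  proof
    fix x assume "x \<in> carrier G"
    then obtain j :: int where "x = a [^] j" using gen generate_pow[OF a] by blast
    also have "a [^] j = a [^] (i * (j div i) + j mod i)" by simp
    also have "\<dots> = (a [^] i) [^] (j div i) \<otimes> a [^] (j mod i)"
      unfolding int_pow_mult[OF a] int_pow_pow[OF a] ..
    also have "\<dots> = a [^] (j mod i)" using a by (simp add: eq)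
    finally have "x = a [^] (j mod i)" .
    moreover have "\<bar>j mod i\<bar> < \<bar>i\<bar>" using \<open>i \<noteq> 0\<close> by (rule abs_mod_less)
    then have "j mod i \<in> {- \<bar>i\<bar>..\<bar>i\<bar>}" by auto
    ultimately show "x \<in> (\<lambda>j. a [^] j) ` {- \<bar>i\<bar>..\<bar>i\<bar>}" by blast
  qed
  then show False using inf finite_subset by blast
qed

lemma (in group) infinite_cyclic_iso:
  assumes a: "a \<in> carrier G" and gen: "generate G {a} = carrier G" and inf: "infinite (carrier G)"
  shows "(\<lambda>i::int. a [^] i) \<in> iso integer_group G"
proof -
  have "inj (\<lambda>i::int. a [^] i)"
  proof (rule injI)
    fix i j :: int assume "a [^] i = a [^] j"
    then have "a [^] (i - j) = \<one>" using a by (simp add: int_pow_diff)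
    then have "i - j = 0" by (rule infinite_cyclic_pow_inj[OF a gen inf])
    then show "i = j" by simp
  qed
  moreover have "range (\<lambda>i::int. a [^] i) = carrier G" using gen generate_pow[OF a] by (simp add: full_SetCompr_eq)
  ultimately show ?thesis using hom_integer_group_pow[OF a] by (simp add: iso_def bij_betw_def)
qed

text \<open>The exponent map is the quotient map followed by the inverse of the isomorphism from the
  integers to the powers of the coset of \<open>g\<close>.\<close>

lemma cyclic_ext_of_generate:
  assumes "N \<lhd> G" "g \<in> carrier G" "infinite (carrier (G Mod N))"
    "generate (G Mod N) {N #>\<^bsub>G\<^esub> g} = carrier (G Mod N)"
  shows "\<exists>e. cyclic_ext G N e g"
proof -
  interpret normal N G by fact
  interpret Q: group "G Mod N" by (rule factorgroup_is_group)
  let ?a = "N #>\<^bsub>G\<^esub> g" and ?f = "\<lambda>i::int. (N #>\<^bsub>G\<^esub> g) [^]\<^bsub>G Mod N\<^esub> i"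
  have a: "?a \<in> carrier (G Mod N)" using assms(2) by (simp add: FactGroup_def rcosetsI subset)
  have f: "?f \<in> iso integer_group (G Mod N)"
    by (rule Q.infinite_cyclic_iso[OF a assms(4,3)])
  define e where "e = inv_into UNIV ?f \<circ> (\<lambda>x. N #>\<^bsub>G\<^esub> x)"
  have f': "inv_into UNIV ?f \<in> iso (G Mod N) integer_group"
    using group.iso_set_sym[OF group_integer_group f] by simp
  have e: "e \<in> hom G integer_group"
    unfolding e_def using r_coset_hom_Mod f' by (auto simp: iso_def intro: Group.hom_compose)
  have inj: "inj ?f" using f by (simp add: iso_def bij_betw_def)
  have e_iff: "e x = i \<longleftrightarrow> N #>\<^bsub>G\<^esub> x = ?f i" if "x \<in> carrier G" for x i
  proof -
    have "N #>\<^bsub>G\<^esub> x \<in> range ?f"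
      using f that by (simp add: iso_def bij_betw_def FactGroup_def rcosetsI subset)
    then show ?thesis unfolding e_def comp_apply using inj by (metis f_inv_into_f inv_f_f)
  qed
  have "N = kernel G integer_group e"
  proof (intro equalityI subsetI)
    fix x assume x: "x \<in> N"
    then have "N #>\<^bsub>G\<^esub> x = N" by (simp add: rcos_const is_group)
    then show "x \<in> kernel G integer_group e"
      using x e_iff[of x 0] by (simp add: kernel_def FactGroup_def)
  next
    fix x assume "x \<in> kernel G integer_group e"
    then have x: "x \<in> carrier G" "e x = 0" by (auto simp: kernel_def)
    then have "N #>\<^bsub>G\<^esub> x = N" using e_iff[of x 0] by (simp add: FactGroup_def)
    then show "x \<in> N" using x(1) rcos_self[OF _ subgroup_axioms] by metis
  qed
  moreover have "e g = 1" using e_iff[OF assms(2)] a by simp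
  ultimately show ?thesis using e assms(2) by (auto simp: cyclic_ext_def is_group)
qed

lemma cyclic_ext_exists:
  assumes "N \<lhd> G" "G Mod N \<cong> D" "group D" "cyclic_group D" "infinite (carrier D)"
  shows "infinite (carrier (G Mod N))" "\<exists>e g. cyclic_ext G N e g"
proof -
  interpret normal N G by fact
  interpret Q: group "G Mod N" by (rule factorgroup_is_group)
  obtain h where "h \<in> iso (G Mod N) D" using assms(2) by (auto simp: is_iso_def)
  then show inf: "infinite (carrier (G Mod N))"
    using assms(5) bij_betw_finite by (auto simp: iso_def)
  have "cyclic_group (G Mod N)"
    using isomorphic_group_cyclicity[OF assms(2) Q.is_group assms(3)] assms(4) by simp
  then obtain a where a: "a \<in> carrier (G Mod N)" "carrier (G Mod N) = range (\<lambda>n::int. a [^]\<^bsub>G Mod N\<^esub> n)"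
    unfolding Q.cyclic_group by blast
  then have gen: "generate (G Mod N) {a} = carrier (G Mod N)" by (auto simp: Q.generate_pow)
  obtain g where "g \<in> carrier G" "a = N #>\<^bsub>G\<^esub> g" using a(1) by (auto simp: FactGroup_def RCOSETS_def)
  then show "\<exists>e g. cyclic_ext G N e g"
    using cyclic_ext_of_generate[OF assms(1) _ inf] gen by blast
qed

lemma cyclic_ext_quotient_iso:
  assumes "cyclic_ext G N e g" "group D" "cyclic_group D" "infinite (carrier D)"
  shows "G Mod N \<cong> D"
proof -
  interpret group_hom G integer_group e using assms(1) by (rule cyclic_extD)
  note D = cyclic_extD[OF assms(1)]
  have "e (g [^]\<^bsub>G\<^esub> i) = i" for i :: int using D(9)[OF D(3)] D(4) by simp
  then have "i \<in> e ` carrier G" for i using D(3) by (metis G.int_pow_closed imageI)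
  then have "e ` carrier G = carrier integer_group" by auto
  then have "(G Mod kernel G integer_group e) \<cong> integer_group" by (rule FactGroup_iso)
  then have 1: "G Mod N \<cong> integer_group" using assms(1) by (simp add: cyclic_ext_def)
  interpret D: group D by fact
  obtain a where a: "a \<in> carrier D" "carrier D = range (\<lambda>n::int. a [^]\<^bsub>D\<^esub> n)"
    using assms(3) unfolding D.cyclic_group by blast
  then have "generate D {a} = carrier D" by (auto simp: D.generate_pow)
  then have "integer_group \<cong> D" using D.infinite_cyclic_iso[OF a(1) _ assms(4)] by (auto simp: is_iso_def)
  with 1 show ?thesis by (rule iso_trans)
qed

text \<open>Write \<open>g'\<close> as an element of \<open>N\<close> times
  \<open>g [^] e g'\<close>. Applying \<open>e'\<close> gives \<open>e g' * e' g = 1\<close>, so the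
  exponent is a unit of the integers. This sign is the origin of the pairs of inverse
  elements.\<close>

lemma cyclic_ext_generator_unique:
  fixes G (structure)
  assumes e: "cyclic_ext G N e g" and e': "cyclic_ext G N e' g'"
  shows "\<exists>f\<in>N. g' = f \<otimes> g \<or> g' = f \<otimes> inv g"
proof -
  interpret group G using e by (rule cyclic_extD)
  note D = cyclic_extD[OF e] and D' = cyclic_extD[OF e']
  have "g' \<otimes> g [^] (- e g') \<in> N" using cyclic_ext_split[OF e D'(3)] by simp
  then have "e' g' - e g' * e' g = 0" using D'(3,5,7,9) D(3) by simp
  then have "e g' * e' g = 1" using D'(4) by simp
  then have "e g' = 1 \<or> e g' = - 1" using zmult_eq_1_iff by blast
  moreover have "g' = (g' \<otimes> g [^] (- e g')) \<otimes> g [^] e g'"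
    by (rule cyclic_ext_split[OF e D'(3)])
  moreover have "g [^] (-1::int) = inv g" using D(3) by (simp add: int_pow_neg)
  ultimately show ?thesis using \<open>g' \<otimes> g [^] (- e g') \<in> N\<close> D(3) by (metis int_pow_1)
qed

lemma cyclic_ext_mult:
  assumes "cyclic_ext G N e g" "f \<in> N"
  shows "cyclic_ext G N e (f \<otimes>\<^bsub>G\<^esub> g)"
proof -
  interpret group G using assms(1) by (rule cyclic_extD)
  show ?thesis using assms cyclic_extD[OF assms(1)] by (simp add: cyclic_ext_def)
qed

lemma cyclic_ext_inv:
  assumes "cyclic_ext G N e g"
  shows "cyclic_ext G N (\<lambda>x. - e x) (inv\<^bsub>G\<^esub> g)"
proof -
  interpret group G using assms by (rule cyclic_extD)
  note D = cyclic_extD[OF assms]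
  have "(\<lambda>x. - e x) \<in> hom G integer_group" by (rule homI) (simp_all add: D)
  moreover have "N = kernel G integer_group (\<lambda>x. - e x)" using D(5) by (auto simp: kernel_def)
  ultimately show ?thesis using D by (simp add: cyclic_ext_def)
qed

text \<open>Extends \<open>\<beta> : N\<^sub>1 \<rightarrow> N\<^sub>2\<close> by sending \<open>f g\<^sub>1\<^sup>i\<close> to \<open>\<beta> f g\<^sub>2\<^sup>i\<close>.\<close>

lemma cyclic_ext_iso_extend:
  fixes G1 (structure)
  assumes e1: "cyclic_ext G1 N1 e1 g1" and e2: "cyclic_ext G2 N2 e2 g2"
    and bij: "bij_betw \<beta> N1 N2"
    and hom: "\<And>x y. x \<in> N1 \<Longrightarrow> y \<in> N1 \<Longrightarrow> \<beta> (x \<otimes> y) = \<beta> x \<otimes>\<^bsub>G2\<^esub> \<beta> y"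
    and conj: "\<And>x. x \<in> N1 \<Longrightarrow> \<beta> (g1 \<otimes> x \<otimes> inv g1) = g2 \<otimes>\<^bsub>G2\<^esub> \<beta> x \<otimes>\<^bsub>G2\<^esub> inv\<^bsub>G2\<^esub> g2"
  shows "\<exists>\<phi>\<in>iso G1 G2. \<phi> ` N1 = N2"
proof -
  interpret G1: group G1 using e1 by (rule cyclic_extD)
  interpret G2: group G2 using e2 by (rule cyclic_extD)
  interpret N1: normal N1 G1 using e1 by (rule cyclic_extD)
  interpret N2: normal N2 G2 using e2 by (rule cyclic_extD)
  note D1 = cyclic_extD[OF e1] and D2 = cyclic_extD[OF e2]
  note s1 = cyclic_ext_split[OF e1] and s2 = cyclic_ext_split[OF e2]
  have \<beta>: "\<beta> x \<in> N2" if "x \<in> N1" for x using bij that by (auto simp: bij_betw_def)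
  have \<beta>': "\<beta> x \<in> carrier G2" if "x \<in> N1" for x using \<beta>[OF that] by simp
  have conj_eq: "\<beta> (x \<otimes> n \<otimes> inv x) = y \<otimes>\<^bsub>G2\<^esub> \<beta> n \<otimes>\<^bsub>G2\<^esub> inv\<^bsub>G2\<^esub> y
      \<longleftrightarrow> \<beta> (x \<otimes> n \<otimes> inv x) \<otimes>\<^bsub>G2\<^esub> y = y \<otimes>\<^bsub>G2\<^esub> \<beta> n"
    if "x \<in> carrier G1" "y \<in> carrier G2" "n \<in> N1" for x y n
    unfolding G2.inv_solve_right[OF \<beta>'[OF N1.inv_op_closed2[OF that(1,3)]]
        G2.m_closed[OF that(2) \<beta>'[OF that(3)]] that(2)] by (rule eq_commute)
  define C where "C x y \<longleftrightarrow> (\<forall>n\<in>N1. \<beta> (x \<otimes> n \<otimes> inv x) \<otimes>\<^bsub>G2\<^esub> y = y \<otimes>\<^bsub>G2\<^esub> \<beta> n)" for x y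
  have C1: "C g1 g2" unfolding C_def using conj conj_eq D1(3) D2(3) by blast
  have C_inv: "C (inv x) (inv\<^bsub>G2\<^esub> y)"
    if "C x y" and xy: "x \<in> carrier G1" "y \<in> carrier G2" for x y
    unfolding C_def
  proof
    fix n assume n: "n \<in> N1"
    let ?m = "inv x \<otimes> n \<otimes> x"
    have m: "?m \<in> N1" using N1.inv_op_closed1 n xy by blast
    have "x \<otimes> ?m \<otimes> inv x = n"
      using xy n by (simp add: G1.m_assoc[symmetric]) (simp add: G1.m_assoc)
    then have "\<beta> n \<otimes>\<^bsub>G2\<^esub> y = y \<otimes>\<^bsub>G2\<^esub> \<beta> ?m" using \<open>C x y\<close> m unfolding C_def by metis
    then have "inv\<^bsub>G2\<^esub> y \<otimes>\<^bsub>G2\<^esub> (\<beta> n \<otimes>\<^bsub>G2\<^esub> y) \<otimes>\<^bsub>G2\<^esub> inv\<^bsub>G2\<^esub> y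
        = inv\<^bsub>G2\<^esub> y \<otimes>\<^bsub>G2\<^esub> (y \<otimes>\<^bsub>G2\<^esub> \<beta> ?m) \<otimes>\<^bsub>G2\<^esub> inv\<^bsub>G2\<^esub> y" by simp
    then have "inv\<^bsub>G2\<^esub> y \<otimes>\<^bsub>G2\<^esub> \<beta> n = \<beta> ?m \<otimes>\<^bsub>G2\<^esub> inv\<^bsub>G2\<^esub> y"
      using xy \<beta>'[OF n] \<beta>'[OF m] by (simp add: G2.m_assoc G2.inv_solve_left')
    then show "\<beta> (inv x \<otimes> n \<otimes> inv (inv x)) \<otimes>\<^bsub>G2\<^esub> inv\<^bsub>G2\<^esub> y = inv\<^bsub>G2\<^esub> y \<otimes>\<^bsub>G2\<^esub> \<beta> n"
      using xy by simp
  qed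
  have C_mult: "C (x \<otimes> x') (y \<otimes>\<^bsub>G2\<^esub> y')"
    if "C x y" "C x' y'" and xy: "x \<in> carrier G1" "y \<in> carrier G2" "x' \<in> carrier G1" "y' \<in> carrier G2" for x y x' y'
    unfolding C_def
  proof
    fix n assume n: "n \<in> N1"
    let ?m = "x' \<otimes> n \<otimes> inv x'"
    have m: "?m \<in> N1" using N1.inv_op_closed2 n xy by blast
    have xm: "x \<otimes> ?m \<otimes> inv x \<in> N1" using N1.inv_op_closed2 m xy by blast
    have 1: "\<beta> (x \<otimes> ?m \<otimes> inv x) \<otimes>\<^bsub>G2\<^esub> y = y \<otimes>\<^bsub>G2\<^esub> \<beta> ?m" using that m by (simp add: C_def)
    have 2: "\<beta> ?m \<otimes>\<^bsub>G2\<^esub> y' = y' \<otimes>\<^bsub>G2\<^esub> \<beta> n" using that n by (simp add: C_def)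
    have "(x \<otimes> x') \<otimes> n \<otimes> inv (x \<otimes> x') = x \<otimes> ?m \<otimes> inv x"
      using xy n by (simp add: G1.inv_mult_group G1.m_assoc)
    moreover have "\<beta> (x \<otimes> ?m \<otimes> inv x) \<otimes>\<^bsub>G2\<^esub> (y \<otimes>\<^bsub>G2\<^esub> y') = y \<otimes>\<^bsub>G2\<^esub> \<beta> ?m \<otimes>\<^bsub>G2\<^esub> y'"
      using xy \<beta>'[OF xm] 1 by (simp add: G2.m_assoc[symmetric])
    moreover have "\<dots> = y \<otimes>\<^bsub>G2\<^esub> y' \<otimes>\<^bsub>G2\<^esub> \<beta> n"
      using xy \<beta>'[OF m] \<beta>'[OF n] 2 by (simp add: G2.m_assoc)
    ultimately show "\<beta> ((x \<otimes> x') \<otimes> n \<otimes> inv (x \<otimes> x')) \<otimes>\<^bsub>G2\<^esub> (y \<otimes>\<^bsub>G2\<^esub> y') = y \<otimes>\<^bsub>G2\<^esub> y' \<otimes>\<^bsub>G2\<^esub> \<beta> n"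
      by simp
  qed
  have C_nat: "C (g1 [^] k) (g2 [^]\<^bsub>G2\<^esub> k)" for k :: nat
  proof (induction k)
    case 0
    then show ?case unfolding C_def using \<beta>' by simp
  next
    case (Suc k)
    then show ?case using C_mult[OF Suc C1] D1(3) D2(3) by simp
  qed
  have C_int: "C (g1 [^] i) (g2 [^]\<^bsub>G2\<^esub> i)" for i :: int
  proof (cases i rule: int_cases2)
    case (nonneg k)
    then show ?thesis using C_nat by (simp add: int_pow_int)
  next
    case (nonpos k)
    then show ?thesis using C_inv[OF C_nat] D1(3) D2(3) by (simp add: G1.int_pow_neg_int G2.int_pow_neg_int)
  qed
  define \<phi> where "\<phi> x = \<beta> (x \<otimes> g1 [^] (- e1 x)) \<otimes>\<^bsub>G2\<^esub> g2 [^]\<^bsub>G2\<^esub> e1 x" for x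
  have \<phi>_eq: "\<phi> (n \<otimes> g1 [^] i) = \<beta> n \<otimes>\<^bsub>G2\<^esub> g2 [^]\<^bsub>G2\<^esub> i" if n: "n \<in> N1" for n and i :: int
  proof -
    have "e1 (n \<otimes> g1 [^] i) = i" using n D1 by simp
    moreover have "(n \<otimes> g1 [^] i) \<otimes> g1 [^] (- i) = n"
      using n D1(3) by (simp add: G1.m_assoc G1.int_pow_mult[symmetric])
    ultimately show ?thesis unfolding \<phi>_def by simp
  qed
  have ex1: "\<exists>n\<in>N1. \<exists>i. x = n \<otimes> g1 [^] (i::int)" if "x \<in> carrier G1" for x
    using s1[OF that] by blast
  have e\<phi>: "e2 (\<beta> n \<otimes>\<^bsub>G2\<^esub> g2 [^]\<^bsub>G2\<^esub> (i::int)) = i" if "n \<in> N1" for n i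
    using \<beta>[OF that] D2 by simp
  have "\<phi> \<in> hom G1 G2"
  proof (rule homI)
    show "\<phi> x \<in> carrier G2" if "x \<in> carrier G1" for x
      using ex1[OF that] \<phi>_eq \<beta>' D2(3) by auto
    fix x y assume "x \<in> carrier G1" "y \<in> carrier G1"
    then obtain n i m j where x: "n \<in> N1" "x = n \<otimes> g1 [^] (i::int)"
      and y: "m \<in> N1" "y = m \<otimes> g1 [^] (j::int)" using ex1 by meson
    let ?a = "g1 [^] i" and ?b = "g2 [^]\<^bsub>G2\<^esub> i"
    \<comment> \<open>Moving \<open>m\<close> past \<open>?a\<close> in the product replaces it by
      \<open>?m\<close>; \<open>C_int\<close> says that \<open>\<beta>\<close> respects this
      move.\<close>
    let ?m = "?a \<otimes> m \<otimes> inv ?a"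
    have ac: "?a \<in> carrier G1" "?b \<in> carrier G2" using D1(3) D2(3) by simp_all
    have m: "?m \<in> N1" using N1.inv_op_closed2[OF ac(1) y(1)] .
    have nm: "n \<otimes> ?m \<in> N1" using x(1) m by simp
    have "x \<otimes> y = (n \<otimes> ?m) \<otimes> g1 [^] (i + j)"
    proof -
      have "inv ?a \<otimes> (?a \<otimes> z) = z" if "z \<in> carrier G1" for z
        using that ac by (simp add: G1.m_assoc[symmetric])
      then show ?thesis
        using x y ac D1(3) by (simp add: G1.int_pow_mult G1.m_assoc)
    qed
    then have "\<phi> (x \<otimes> y) = \<beta> n \<otimes>\<^bsub>G2\<^esub> \<beta> ?m \<otimes>\<^bsub>G2\<^esub> (?b \<otimes>\<^bsub>G2\<^esub> g2 [^]\<^bsub>G2\<^esub> j)"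
      using \<phi>_eq[OF nm] hom[OF x(1) m] D2(3) by (simp add: G2.int_pow_mult)
    also have "\<dots> = \<beta> n \<otimes>\<^bsub>G2\<^esub> (\<beta> ?m \<otimes>\<^bsub>G2\<^esub> ?b) \<otimes>\<^bsub>G2\<^esub> g2 [^]\<^bsub>G2\<^esub> j"
      using \<beta>'[OF x(1)] \<beta>'[OF m] ac D2(3) by (simp add: G2.m_assoc)
    also have "\<beta> ?m \<otimes>\<^bsub>G2\<^esub> ?b = ?b \<otimes>\<^bsub>G2\<^esub> \<beta> m" using C_int[of i] y(1) by (simp add: C_def)
    also have "\<beta> n \<otimes>\<^bsub>G2\<^esub> (?b \<otimes>\<^bsub>G2\<^esub> \<beta> m) \<otimes>\<^bsub>G2\<^esub> g2 [^]\<^bsub>G2\<^esub> j = \<phi> x \<otimes>\<^bsub>G2\<^esub> \<phi> y"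
      unfolding x(2) y(2) \<phi>_eq[OF x(1)] \<phi>_eq[OF y(1)]
      using \<beta>'[OF x(1)] \<beta>'[OF y(1)] ac D2(3) by (simp add: G2.m_assoc)
    finally show "\<phi> (x \<otimes> y) = \<phi> x \<otimes>\<^bsub>G2\<^esub> \<phi> y" .
  qed
  moreover have "inj_on \<phi> (carrier G1)"
  proof (rule inj_onI)
    fix x y assume "x \<in> carrier G1" "y \<in> carrier G1" and eq: "\<phi> x = \<phi> y"
    then obtain n i m j where x: "n \<in> N1" "x = n \<otimes> g1 [^] (i::int)"
      and y: "m \<in> N1" "y = m \<otimes> g1 [^] (j::int)" using ex1 by meson
    have eq': "\<beta> n \<otimes>\<^bsub>G2\<^esub> g2 [^]\<^bsub>G2\<^esub> i = \<beta> m \<otimes>\<^bsub>G2\<^esub> g2 [^]\<^bsub>G2\<^esub> j" using eq x y \<phi>_eq by simp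
    then have "i = j" using e\<phi> x(1) y(1) by metis
    then have "\<beta> n = \<beta> m" using eq' \<beta>' x(1) y(1) D2(3) by simp
    then have "n = m" using bij x(1) y(1) by (auto simp: bij_betw_def inj_on_def)
    then show "x = y" using x y \<open>i = j\<close> by simp
  qed
  moreover have "\<phi> ` carrier G1 = carrier G2"
  proof (intro equalityI subsetI)
    fix y assume y: "y \<in> carrier G2"
    obtain n where n: "n \<in> N1" "\<beta> n = y \<otimes>\<^bsub>G2\<^esub> g2 [^]\<^bsub>G2\<^esub> (- e2 y)"
      using s2(1)[OF y] bij by (metis bij_betw_def imageE)
    have "\<phi> (n \<otimes> g1 [^] e2 y) = y" unfolding \<phi>_eq[OF n(1)] n(2) using s2(2)[OF y] by simp
    then show "y \<in> \<phi> ` carrier G1" using n(1) D1(3)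
      by (metis G1.int_pow_closed G1.m_closed N1.mem_carrier imageI)
  next
    fix y assume "y \<in> \<phi> ` carrier G1"
    then obtain x where "x \<in> carrier G1" "y = \<phi> x" by blast
    then show "y \<in> carrier G2" using ex1[of x] \<phi>_eq \<beta>' D2(3) by auto
  qed
  ultimately have "\<phi> \<in> iso G1 G2" by (simp add: iso_def bij_betw_def)
  moreover have "\<phi> n = \<beta> n" if "n \<in> N1" for n
    using \<phi>_eq[OF that, of 0] that \<beta>'[OF that] by simp
  then have "\<phi> ` N1 = N2" using bij by (simp add: bij_betw_def image_def)
  ultimately show ?thesis by blast
qed



section \<open>Outer automorphisms induced by conjugation\<close>

lemma auto_iff: "f \<in> auto H \<longleftrightarrow> f \<in> hom H H \<and> f \<in> extensional (carrier H) \<and> bij_betw f (carrier H) (carrier H)"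
  by (auto simp: auto_def Bij_def)

lemma AutoGroup_simps:
  "carrier (AutoGroup H) = auto H"
  "f \<in> auto H \<Longrightarrow> g \<in> auto H \<Longrightarrow> f \<otimes>\<^bsub>AutoGroup H\<^esub> g = compose (carrier H) f g"
  "\<one>\<^bsub>AutoGroup H\<^esub> = (\<lambda>x\<in>carrier H. x)"
  by (auto simp: AutoGroup_def BijGroup_def auto_def)

lemma autoD:
  assumes "f \<in> auto H"
  shows "x \<in> carrier H \<Longrightarrow> f x \<in> carrier H"
    "x \<in> carrier H \<Longrightarrow> y \<in> carrier H \<Longrightarrow> f (x \<otimes>\<^bsub>H\<^esub> y) = f x \<otimes>\<^bsub>H\<^esub> f y"
    "f ` carrier H = carrier H" "f \<in> extensional (carrier H)" "f \<in> iso H H"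
  using assms by (auto simp: auto_iff hom_def bij_betw_def iso_def)

lemma auto_restrict_iso:
  assumes "group H" "f \<in> iso H H"
  shows "restrict f (carrier H) \<in> auto H"
proof -
  interpret group H by fact
  have "bij_betw (restrict f (carrier H)) (carrier H) (carrier H)"
    using assms(2) by (auto simp: iso_def cong: bij_betw_cong)
  then show ?thesis using assms(2) by (auto simp: auto_iff iso_def hom_def)
qed

lemma conj_aut_hom:
  fixes G (structure)
  assumes "N \<lhd> G"
  shows "conj_aut G N \<in> hom G (AutoGroup (G\<lparr>carrier := N\<rparr>))"
proof (rule homI)
  interpret normal N G by fact
  let ?K = "G\<lparr>carrier := N\<rparr>"
  have hom: "conj_aut G N g \<in> hom ?K ?K" if g: "g \<in> carrier G" for g
  proof (rule homI)
    fix x y assume "x \<in> carrier ?K" "y \<in> carrier ?K"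
    then have xy: "x \<in> N" "y \<in> N" by simp_all
    show "conj_aut G N g x \<in> carrier ?K" using xy g inv_op_closed2 by (simp add: conj_aut_def)
    have "inv g \<otimes> (g \<otimes> z) = z" if "z \<in> carrier G" for z
      using that g by (simp add: m_assoc[symmetric])
    then show "conj_aut G N g (x \<otimes>\<^bsub>?K\<^esub> y) = conj_aut G N g x \<otimes>\<^bsub>?K\<^esub> conj_aut G N g y"
      using xy g by (simp add: conj_aut_def m_assoc)
  qed
  have inverse: "conj_aut G N g (conj_aut G N (inv g) x) = x" if "g \<in> carrier G" "x \<in> N" for g x
  proof -
    have "inv g \<otimes> x \<otimes> g \<in> N" using inv_op_closed1 that by blast
    moreover have "g \<otimes> (inv g \<otimes> z) = z" if "z \<in> carrier G" for z
      using that \<open>g \<in> carrier G\<close> by (simp add: m_assoc[symmetric])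
    ultimately show ?thesis using that by (simp add: conj_aut_def m_assoc)
  qed
  have auto: "conj_aut G N g \<in> auto ?K" if g: "g \<in> carrier G" for g
  proof -
    have mem: "conj_aut G N h x \<in> N" if "h \<in> carrier G" "x \<in> N" for h x
      using that inv_op_closed2 by (simp add: conj_aut_def)
    have "bij_betw (conj_aut G N g) N N"
      using mem g inverse[OF g] inverse[of "inv g"]
      by (intro bij_betw_byWitness[where f' = "conj_aut G N (inv g)"]) auto
    then show ?thesis using hom[OF g] by (simp add: auto_iff conj_aut_def)
  qed
  show "g \<in> carrier G \<Longrightarrow> conj_aut G N g \<in> carrier (AutoGroup ?K)" for g
    using auto by (simp add: AutoGroup_simps)
  fix g h assume gh: "g \<in> carrier G" "h \<in> carrier G"
  have "conj_aut G N (g \<otimes> h) = compose N (conj_aut G N g) (conj_aut G N h)"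
  proof
    fix x
    show "conj_aut G N (g \<otimes> h) x = compose N (conj_aut G N g) (conj_aut G N h) x"
      using gh inv_op_closed2[of h x]
      by (auto simp: conj_aut_def compose_def m_assoc inv_mult_group)
  qed
  then show "conj_aut G N (g \<otimes> h) = conj_aut G N g \<otimes>\<^bsub>AutoGroup ?K\<^esub> conj_aut G N h"
    using auto[OF gh(1)] auto[OF gh(2)] by (simp add: AutoGroup_simps)
qed

lemma (in group) conj_aut_inner_hom: "conj_aut G (carrier G) \<in> hom G (AutoGroup G)"
proof -
  have "carrier G \<lhd> G" by (simp add: normal_inv_iff subgroup_self)
  from conj_aut_hom[OF this] show ?thesis by simp
qed

text \<open>An automorphism \<open>f\<close> conjugates the inner automorphism given by
  \<open>g\<close> to the one given by \<open>f g\<close>.\<close>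

lemma (in group) Inn_normal: "Inn G \<lhd> AutoGroup G"
proof -
  interpret A: group "AutoGroup G" by (rule AutoGroup)
  interpret c: group_hom G "AutoGroup G" "conj_aut G (carrier G)"
    using conj_aut_inner_hom by unfold_locales
  show ?thesis
    unfolding A.normal_inv_iff
  proof (intro conjI ballI)
    show "subgroup (Inn G) (AutoGroup G)" unfolding Inn_def by (rule c.img_is_subgroup)
    fix f i assume f: "f \<in> carrier (AutoGroup G)" and "i \<in> Inn G"
    then obtain g where g: "g \<in> carrier G" "i = conj_aut G (carrier G) g" by (auto simp: Inn_def)
    have f': "f \<in> auto G" using f by (simp add: AutoGroup_simps)
    have fg: "f g \<in> carrier G" using autoD(1)[OF f'] g by simp
    have i: "i \<in> auto G" "conj_aut G (carrier G) (f g) \<in> auto G"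
      using g fg c.hom_closed by (auto simp: AutoGroup_simps)
    have f_inv: "f (inv g) = inv (f g)"
      using group_hom.hom_inv[of G G f] f' g(1) by (simp add: auto_iff group_hom_def group_hom_axioms_def is_group)
    have "compose (carrier G) f i = compose (carrier G) (conj_aut G (carrier G) (f g)) f"
    proof (rule extensionalityI[of _ "carrier G"])
      fix x assume "x \<in> carrier G"
      then show "compose (carrier G) f i x = compose (carrier G) (conj_aut G (carrier G) (f g)) f x"
        using g fg autoD(1,2)[OF f'] f_inv by (simp add: compose_def conj_aut_def)
    qed (simp_all add: compose_def)
    then have "f \<otimes>\<^bsub>AutoGroup G\<^esub> i = conj_aut G (carrier G) (f g) \<otimes>\<^bsub>AutoGroup G\<^esub> f"
      using f' i by (simp add: AutoGroup_simps)
    then have "f \<otimes>\<^bsub>AutoGroup G\<^esub> i \<otimes>\<^bsub>AutoGroup G\<^esub> inv\<^bsub>AutoGroup G\<^esub> f = conj_aut G (carrier G) (f g)"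
      using A.inv_solve_right'[of "conj_aut G (carrier G) (f g)" "f \<otimes>\<^bsub>AutoGroup G\<^esub> i" f] f i
      by (simp only: AutoGroup_simps(1) A.m_closed[unfolded AutoGroup_simps(1)])
    then show "f \<otimes>\<^bsub>AutoGroup G\<^esub> i \<otimes>\<^bsub>AutoGroup G\<^esub> inv\<^bsub>AutoGroup G\<^esub> f \<in> Inn G"
      using fg by (simp add: Inn_def)
  qed
qed

lemma (in group) group_Out: "group (Out G)"
  unfolding Out_def by (rule normal.factorgroup_is_group[OF Inn_normal])

section \<open>Transport of automorphisms and the induced homomorphism into the outer automorphism
  group\<close>

lemma transport_apply:
  assumes "bij_betw \<alpha> N M" "x \<in> N"
  shows "transport N M \<alpha> \<phi> (\<alpha> x) = \<alpha> (\<phi> x)"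
  using assms by (auto simp: transport_def compose_def bij_betw_def inv_into_f_f)

lemma extensional_transport: "transport N M \<alpha> \<phi> \<in> extensional M"
  by (simp add: transport_def compose_def)

lemma transport_eqI:
  assumes "bij_betw \<alpha> N M" "f \<in> extensional M" "\<And>x. x \<in> N \<Longrightarrow> f (\<alpha> x) = \<alpha> (\<phi> x)"
  shows "transport N M \<alpha> \<phi> = f"
proof (rule extensionalityI[OF extensional_transport assms(2)])
  fix y assume "y \<in> M"
  then obtain x where "x \<in> N" "y = \<alpha> x" using assms(1) by (auto simp: bij_betw_def)
  then show "transport N M \<alpha> \<phi> y = f y" using transport_apply[OF assms(1)] assms(3) by simp
qed

lemma transport_cong:
  assumes "\<And>x. x \<in> N \<Longrightarrow> \<alpha> x = \<beta> x" "\<phi> \<in> N \<rightarrow> N" "bij_betw \<alpha> N M"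
  shows "transport N M \<alpha> \<phi> = transport N M \<beta> \<phi>"
proof (rule transport_eqI[OF assms(3) extensional_transport])
  have b: "bij_betw \<beta> N M" using assms(1,3) bij_betw_cong by blast
  show "transport N M \<beta> \<phi> (\<alpha> x) = \<alpha> (\<phi> x)" if "x \<in> N" for x
    using transport_apply[OF b that, of \<phi>] assms(1)[OF that] assms(1)[OF funcset_mem[OF assms(2) that]] by simp
qed

lemma transport_hom:
  assumes "group K" "group H" "\<alpha> \<in> iso K H"
  shows "transport (carrier K) (carrier H) \<alpha> \<in> hom (AutoGroup K) (AutoGroup H)"
proof (rule homI)
  let ?T = "transport (carrier K) (carrier H) \<alpha>"
  interpret K: group K by fact
  interpret H: group H by fact
  have bij: "bij_betw \<alpha> (carrier K) (carrier H)" and hom: "\<alpha> \<in> hom K H"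
    using assms(3) by (auto simp: iso_def)
  have \<alpha>: "\<alpha> x \<in> carrier H" if "x \<in> carrier K" for x using hom that by (auto simp: hom_def)
  have \<alpha>_mult: "\<alpha> (x \<otimes>\<^bsub>K\<^esub> y) = \<alpha> x \<otimes>\<^bsub>H\<^esub> \<alpha> y" if "x \<in> carrier K" "y \<in> carrier K" for x y
    using hom that by (auto simp: hom_def)
  have auto: "?T \<phi> \<in> auto H" if \<phi>: "\<phi> \<in> auto K" for \<phi>
    unfolding auto_iff
  proof (intro conjI)
    have "bij_betw \<phi> (carrier K) (carrier K)" using \<phi> by (simp add: auto_iff)
    then show "bij_betw (?T \<phi>) (carrier H) (carrier H)"
      unfolding transport_def
      by (rule bij_betw_compose[OF bij_betw_compose[OF bij_betw_inv_into[OF bij]] bij])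
    show "?T \<phi> \<in> hom H H"
    proof (rule homI)
      fix a b assume "a \<in> carrier H" "b \<in> carrier H"
      then have "a \<in> \<alpha> ` carrier K" "b \<in> \<alpha> ` carrier K" using bij by (simp_all add: bij_betw_def)
      then obtain x y where x: "x \<in> carrier K" "a = \<alpha> x" and y: "y \<in> carrier K" "b = \<alpha> y"
        by blast
      show "?T \<phi> a \<in> carrier H" using x \<alpha> autoD(1)[OF \<phi>] by (simp add: transport_apply[OF bij])
      have "?T \<phi> (a \<otimes>\<^bsub>H\<^esub> b) = ?T \<phi> (\<alpha> (x \<otimes>\<^bsub>K\<^esub> y))" using x y \<alpha>_mult by simp
      also have "\<dots> = \<alpha> (\<phi> (x \<otimes>\<^bsub>K\<^esub> y))" using x y by (intro transport_apply[OF bij]) simp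
      also have "\<dots> = ?T \<phi> a \<otimes>\<^bsub>H\<^esub> ?T \<phi> b"
        using x y autoD(1,2)[OF \<phi>] by (simp add: transport_apply[OF bij] \<alpha>_mult)
      finally show "?T \<phi> (a \<otimes>\<^bsub>H\<^esub> b) = ?T \<phi> a \<otimes>\<^bsub>H\<^esub> ?T \<phi> b" .
    qed
  qed (rule extensional_transport)
  show "\<phi> \<in> carrier (AutoGroup K) \<Longrightarrow> ?T \<phi> \<in> carrier (AutoGroup H)" for \<phi>
    using auto by (simp add: AutoGroup_simps)
  fix \<phi> \<psi> assume "\<phi> \<in> carrier (AutoGroup K)" "\<psi> \<in> carrier (AutoGroup K)"
  then have a: "\<phi> \<in> auto K" "\<psi> \<in> auto K" by (simp_all add: AutoGroup_simps)
  have "?T (compose (carrier K) \<phi> \<psi>) = compose (carrier H) (?T \<phi>) (?T \<psi>)"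
    by (rule transport_eqI[OF bij])
      (simp_all add: compose_def \<alpha> transport_apply[OF bij] autoD(1)[OF a(2)])
  then show "?T (\<phi> \<otimes>\<^bsub>AutoGroup K\<^esub> \<psi>) = ?T \<phi> \<otimes>\<^bsub>AutoGroup H\<^esub> ?T \<psi>"
    using a auto by (simp add: AutoGroup_simps)
qed

abbreviation conj_by :: "('a, 'b) monoid_scheme \<Rightarrow> 'a \<Rightarrow> 'a \<Rightarrow> 'a" where
  "conj_by K a x \<equiv> a \<otimes>\<^bsub>K\<^esub> x \<otimes>\<^bsub>K\<^esub> inv\<^bsub>K\<^esub> a"

abbreviation inn_coset :: "('a, 'b) monoid_scheme \<Rightarrow> ('a \<Rightarrow> 'a) \<Rightarrow> ('a \<Rightarrow> 'a) set" where
  "inn_coset H f \<equiv> Inn H #>\<^bsub>AutoGroup H\<^esub> f"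

text \<open>On an extension this is the outer action by conjugation on \<open>N\<close>, read in
  \<open>H\<close>. Right cosets match the quotient behind \<open>Out\<close>; they equal the left
  cosets of the main statement because \<open>Inn H\<close> is normal.\<close>

definition out_map :: "('a, 'c) monoid_scheme \<Rightarrow> 'a set \<Rightarrow> ('b, 'd) monoid_scheme \<Rightarrow> ('a \<Rightarrow> 'b) \<Rightarrow> 'a \<Rightarrow> ('b \<Rightarrow> 'b) set" where
  "out_map G N H \<alpha> g = inn_coset H (transport N (carrier H) \<alpha> (conj_aut G N g))"

text \<open>\<open>\<alpha>\<close> is an isomorphism of abstract groups only: in the application
  \<open>N\<close> acts on a space of larger dimension than \<open>H\<close> does.\<close>

locale normal_iso = normal N G + H: group H for N and G (structure) and H (structure) +
  fixes \<alpha>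
  assumes iso: "\<alpha> \<in> iso (G\<lparr>carrier := N\<rparr>) H"
begin

lemma bij: "bij_betw \<alpha> N (carrier H)"
  using iso by (simp add: iso_def)

lemma transport_conj_hom: "(\<lambda>g. transport N (carrier H) \<alpha> (conj_aut G N g)) \<in> hom G (AutoGroup H)"
proof -
  have "group (G\<lparr>carrier := N\<rparr>)" using subgroup_is_group[OF is_group] .
  from Group.hom_compose[OF conj_aut_hom[OF normal_axioms] transport_hom[OF this H.is_group iso]]
  show ?thesis by (simp add: comp_def)
qed

lemma transport_conj_auto: "g \<in> carrier G \<Longrightarrow> transport N (carrier H) \<alpha> (conj_aut G N g) \<in> auto H"
  using transport_conj_hom by (auto simp: hom_def AutoGroup_simps)

lemma out_map_hom: "out_map G N H \<alpha> \<in> hom G (Out H)"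
  using Group.hom_compose[OF transport_conj_hom normal.r_coset_hom_Mod[OF H.Inn_normal]]
  by (simp add: out_map_def[abs_def] comp_def Out_def)

lemma out_map_group_hom: "group_hom G (Out H) (out_map G N H \<alpha>)"
  using out_map_hom H.group_Out is_group by (simp add: group_hom_def group_hom_axioms_def)

lemma out_map_eq_l_coset:
  "g \<in> carrier G \<Longrightarrow> transport N (carrier H) \<alpha> (conj_aut G N g) <#\<^bsub>AutoGroup H\<^esub> Inn H = out_map G N H \<alpha> g"
  using normal.coset_eq[OF H.Inn_normal] transport_conj_auto by (simp add: out_map_def AutoGroup_simps)

lemma inv_conj_aut:
  assumes "g \<in> carrier G"
  shows "inv\<^bsub>AutoGroup (G\<lparr>carrier := N\<rparr>)\<^esub> (conj_aut G N g) = conj_aut G N (inv g)"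
proof -
  interpret K: group "G\<lparr>carrier := N\<rparr>" using subgroup_is_group[OF is_group] .
  have "group_hom G (AutoGroup (G\<lparr>carrier := N\<rparr>)) (conj_aut G N)"
    using conj_aut_hom[OF normal_axioms] K.AutoGroup is_group by (simp add: group_hom_def group_hom_axioms_def)
  from group_hom.hom_inv[OF this assms] show ?thesis by simp
qed

lemma transport_conj_inner:
  assumes f: "f \<in> N"
  shows "transport N (carrier H) \<alpha> (conj_aut G N f) = conj_aut H (carrier H) (\<alpha> f)"
proof (rule transport_eqI[OF bij])
  show "conj_aut H (carrier H) (\<alpha> f) \<in> extensional (carrier H)" by (simp add: conj_aut_def)
  fix x assume x: "x \<in> N"
  have K: "group (G\<lparr>carrier := N\<rparr>)" using subgroup_is_group[OF is_group] .
  interpret a: group_hom "G\<lparr>carrier := N\<rparr>" H \<alpha>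
    using K iso H.is_group by (simp add: group_hom_def group_hom_axioms_def iso_def)
  have "inv\<^bsub>G\<lparr>carrier := N\<rparr>\<^esub> f = inv f" using m_inv_consistent[OF subgroup_axioms f] .
  then have "\<alpha> (inv f) = inv\<^bsub>H\<^esub> \<alpha> f" using a.hom_inv[of f] f by simp
  moreover have "\<alpha> (y \<otimes> z) = \<alpha> y \<otimes>\<^bsub>H\<^esub> \<alpha> z" if "y \<in> N" "z \<in> N" for y z
    using a.hom_mult[of y z] that by simp
  moreover have "\<alpha> x \<in> carrier H" using a.hom_closed[of x] x by simp
  ultimately show "conj_aut H (carrier H) (\<alpha> f) (\<alpha> x) = \<alpha> (conj_aut G N f x)"
    using x f by (simp add: conj_aut_def)
qed

text \<open>Elements of \<open>N\<close> act on \<open>N\<close> by inner automorphisms. Hence the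
  outer class of a generator depends only on its coset.\<close>

lemma out_map_kernel:
  assumes "f \<in> N"
  shows "out_map G N H \<alpha> f = \<one>\<^bsub>Out H\<^esub>"
proof -
  interpret I: normal "Inn H" "AutoGroup H" by (rule H.Inn_normal)
  have "\<alpha> f \<in> carrier H" using bij assms by (auto simp: bij_betw_def)
  then have "conj_aut H (carrier H) (\<alpha> f) \<in> Inn H" by (simp add: Inn_def)
  then show ?thesis
    unfolding out_map_def transport_conj_inner[OF assms] Out_def
    by (simp add: I.rcos_const[OF I.is_group] FactGroup_def)
qed

text \<open>Composing the identification with \<open>\<theta>\<close> conjugates the transported
  automorphism. The proof works with the relation between \<open>?T' \<theta>\<close> and
  \<open>\<theta> ?T\<close>, so that the inverse appears only in \<open>Out H\<close>.\<close>

lemma out_map_change_iso: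
  assumes \<theta>: "\<theta> \<in> auto H" and g: "g \<in> carrier G"
  shows "out_map G N H (\<theta> \<circ> \<alpha>) g =
    conj_by (Out H) (inn_coset H \<theta>) (out_map G N H \<alpha> g)"
proof -
  interpret I: normal "Inn H" "AutoGroup H" by (rule H.Inn_normal)
  interpret O: group "Out H" by (rule H.group_Out)
  have iso': "\<theta> \<circ> \<alpha> \<in> iso (G\<lparr>carrier := N\<rparr>) H" using iso autoD(5)[OF \<theta>] by (rule iso_set_trans)
  interpret \<theta>: normal_iso N G H "\<theta> \<circ> \<alpha>" using iso' by unfold_locales
  let ?T = "transport N (carrier H) \<alpha> (conj_aut G N g)"
    and ?T' = "transport N (carrier H) (\<theta> \<circ> \<alpha>) (conj_aut G N g)"
  have T: "?T \<in> auto H" "?T' \<in> auto H" using transport_conj_auto[OF g] \<theta>.transport_conj_auto[OF g] by auto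
  have "compose (carrier H) ?T' \<theta> = compose (carrier H) \<theta> ?T"
  proof (rule extensionalityI[of _ "carrier H"])
    fix y assume "y \<in> carrier H"
    then obtain x where "x \<in> N" "y = \<alpha> x" using bij by (auto simp: bij_betw_def)
    then show "compose (carrier H) ?T' \<theta> y = compose (carrier H) \<theta> ?T y"
      using \<open>y \<in> carrier H\<close> transport_apply[OF bij, of x] transport_apply[OF \<theta>.bij, of x]
      by (simp add: compose_def)
  qed (simp_all add: compose_def)
  then have "?T' \<otimes>\<^bsub>AutoGroup H\<^esub> \<theta> = \<theta> \<otimes>\<^bsub>AutoGroup H\<^esub> ?T" using T \<theta> by (simp add: AutoGroup_simps)
  moreover have c: "inn_coset H (f \<otimes>\<^bsub>AutoGroup H\<^esub> g) =
      inn_coset H f \<otimes>\<^bsub>Out H\<^esub> inn_coset H g"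
    if "f \<in> auto H" "g \<in> auto H" for f g
    using that hom_mult[OF I.r_coset_hom_Mod] by (simp add: Out_def AutoGroup_simps)
  ultimately have "out_map G N H (\<theta> \<circ> \<alpha>) g \<otimes>\<^bsub>Out H\<^esub> inn_coset H \<theta>
      = inn_coset H \<theta> \<otimes>\<^bsub>Out H\<^esub> out_map G N H \<alpha> g"
    unfolding out_map_def using T \<theta> by metis
  moreover have "inn_coset H f \<in> carrier (Out H)" if "f \<in> auto H" for f
    using that I.r_coset_hom_Mod by (auto simp: Out_def AutoGroup_simps hom_def)
  ultimately show ?thesis
    using T \<theta> by (subst O.inv_solve_right) (auto simp: out_map_def)
qed

lemma out_map_cong:
  assumes "\<And>x. x \<in> N \<Longrightarrow> \<alpha> x = \<beta> x" "g \<in> carrier G"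
  shows "out_map G N H \<alpha> g = out_map G N H \<beta> g"
proof -
  have "conj_aut G N g \<in> N \<rightarrow> N" using inv_op_closed2 assms(2) by (auto simp: conj_aut_def)
  then show ?thesis unfolding out_map_def using transport_cong[OF assms(1) _ bij] by simp
qed

text \<open>Two identifications of \<open>N\<close> with \<open>H\<close> differ by the automorphism
  \<open>\<beta> \<circ> inv_into N \<alpha>\<close> of \<open>H\<close>, whose outer class serves
  as \<open>a\<close> for all \<open>g\<close> simultaneously.\<close>

lemma out_map_conj_of_iso:
  assumes \<beta>: "\<beta> \<in> iso (G\<lparr>carrier := N\<rparr>) H"
  shows "\<exists>a\<in>carrier (Out H). \<forall>g\<in>carrier G.
    out_map G N H \<beta> g = conj_by (Out H) a (out_map G N H \<alpha> g)"
proof -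
  interpret I: normal "Inn H" "AutoGroup H" by (rule H.Inn_normal)
  have K: "group (G\<lparr>carrier := N\<rparr>)" using subgroup_is_group[OF is_group] .
  interpret b: normal_iso N G H \<beta> using \<beta> by unfold_locales
  define \<theta> where "\<theta> = restrict (\<beta> \<circ> inv_into N \<alpha>) (carrier H)"
  have "inv_into N \<alpha> \<in> iso H (G\<lparr>carrier := N\<rparr>)" using group.iso_set_sym[OF K iso] by simp
  then have "\<beta> \<circ> inv_into N \<alpha> \<in> iso H H" using \<beta> by (rule iso_set_trans)
  then have \<theta>: "\<theta> \<in> auto H" unfolding \<theta>_def by (rule auto_restrict_iso[OF H.is_group])
  have eq: "\<beta> x = (\<theta> \<circ> \<alpha>) x" if "x \<in> N" for x
    using that bij by (auto simp: \<theta>_def bij_betw_def)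
  have "inn_coset H \<theta> \<in> carrier (Out H)"
    using \<theta> I.r_coset_hom_Mod by (auto simp: Out_def AutoGroup_simps hom_def)
  moreover have "out_map G N H \<beta> g = conj_by (Out H) (inn_coset H \<theta>) (out_map G N H \<alpha> g)" if "g \<in> carrier G" for g
    by (rule trans[OF b.out_map_cong[OF eq that] out_map_change_iso[OF \<theta> that]])
  ultimately show ?thesis by blast
qed

end

text \<open>An isomorphism of pairs carries conjugation to conjugation, so it can be absorbed into
  the identification with \<open>H\<close>.\<close>

lemma out_map_natural:
  assumes "normal_iso N2 G2 H \<alpha>" "group G1" "\<phi> \<in> iso G1 G2" "\<phi> ` N1 = N2" "N1 \<lhd> G1"
  shows "normal_iso N1 G1 H (\<alpha> \<circ> \<phi>)"
    "g \<in> carrier G1 \<Longrightarrow> out_map G1 N1 H (\<alpha> \<circ> \<phi>) g = out_map G2 N2 H \<alpha> (\<phi> g)"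
proof -
  interpret G2: normal_iso N2 G2 H \<alpha> by fact
  interpret G1: normal N1 G1 by fact
  interpret \<phi>: group_hom G1 G2 \<phi>
    using assms(3) G1.is_group G2.is_group by (simp add: group_hom_def group_hom_axioms_def iso_def)
  have "inj_on \<phi> N1" using assms(3) G1.subset by (auto simp: iso_def bij_betw_def inj_on_subset)
  then have "\<phi> \<in> iso (G1\<lparr>carrier := N1\<rparr>) (G2\<lparr>carrier := N2\<rparr>)"
    using assms(4) by (auto simp: iso_def hom_def bij_betw_def)
  then have "\<alpha> \<circ> \<phi> \<in> iso (G1\<lparr>carrier := N1\<rparr>) H" using G2.iso by (rule iso_set_trans)
  then show "normal_iso N1 G1 H (\<alpha> \<circ> \<phi>)" by unfold_locales
  then interpret G1': normal_iso N1 G1 H "\<alpha> \<circ> \<phi>" .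
  assume g: "g \<in> carrier G1"
  have "transport N1 (carrier H) (\<alpha> \<circ> \<phi>) (conj_aut G1 N1 g) = transport N2 (carrier H) \<alpha> (conj_aut G2 N2 (\<phi> g))"
  proof (rule transport_eqI[OF G1'.bij extensional_transport])
    fix x assume x: "x \<in> N1"
    then have "\<phi> x \<in> N2" using assms(4) by blast
    then have "transport N2 (carrier H) \<alpha> (conj_aut G2 N2 (\<phi> g)) (\<alpha> (\<phi> x)) = \<alpha> (conj_aut G2 N2 (\<phi> g) (\<phi> x))"
      by (rule transport_apply[OF G2.bij])
    also have "conj_aut G2 N2 (\<phi> g) (\<phi> x) = \<phi> (conj_aut G1 N1 g x)"
      using x g \<open>\<phi> x \<in> N2\<close> by (simp add: conj_aut_def)
    finally show "transport N2 (carrier H) \<alpha> (conj_aut G2 N2 (\<phi> g)) ((\<alpha> \<circ> \<phi>) x) = (\<alpha> \<circ> \<phi>) (conj_aut G1 N1 g x)"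
      by simp
  qed
  then show "out_map G1 N1 H (\<alpha> \<circ> \<phi>) g = out_map G2 N2 H \<alpha> (\<phi> g)" by (simp add: out_map_def)
qed

section \<open>Conjugacy classes of inverse pairs as invariants of an extension\<close>

lemma (in group) conj_class_pair_eq:
  assumes "x \<in> carrier G" "a \<in> carrier G" "y = a \<otimes> x \<otimes> inv a"
  shows "conj_class G {y, inv y} = conj_class G {x, inv x}"
proof -
  have iy: "inv y = a \<otimes> inv x \<otimes> inv a" using assms by (simp add: inv_mult_group m_assoc)
  have img: "(\<lambda>z. g \<otimes> z \<otimes> inv g) ` {y, inv y} = (\<lambda>z. (g \<otimes> a) \<otimes> z \<otimes> inv (g \<otimes> a)) ` {x, inv x}"
    if "g \<in> carrier G" for g
    unfolding iy assms(3) using that assms(1,2) by (simp add: inv_mult_group m_assoc)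
  have img': "(\<lambda>z. g \<otimes> z \<otimes> inv g) ` {x, inv x} = (\<lambda>z. (g \<otimes> inv a) \<otimes> z \<otimes> inv (g \<otimes> inv a)) ` {y, inv y}"
    if "g \<in> carrier G" for g
    using img[of "g \<otimes> inv a"] that assms(2) by (simp add: m_assoc)
  show ?thesis
    unfolding conj_class_def
  proof (intro equalityI subsetI)
    fix P assume "P \<in> {(\<lambda>z. g \<otimes> z \<otimes> inv g) ` {y, inv y} |g. g \<in> carrier G}"
    then obtain g where g: "g \<in> carrier G" "P = (\<lambda>z. g \<otimes> z \<otimes> inv g) ` {y, inv y}" by blast
    show "P \<in> {(\<lambda>z. g \<otimes> z \<otimes> inv g) ` {x, inv x} |g. g \<in> carrier G}"
      unfolding g(2) img[OF g(1)] using m_closed[OF g(1) assms(2)] by blast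
  next
    fix P assume "P \<in> {(\<lambda>z. g \<otimes> z \<otimes> inv g) ` {x, inv x} |g. g \<in> carrier G}"
    then obtain g where g: "g \<in> carrier G" "P = (\<lambda>z. g \<otimes> z \<otimes> inv g) ` {x, inv x}" by blast
    show "P \<in> {(\<lambda>z. g \<otimes> z \<otimes> inv g) ` {y, inv y} |g. g \<in> carrier G}"
      unfolding g(2) img'[OF g(1)] using m_closed[OF g(1) inv_closed[OF assms(2)]] by blast
  qed
qed

text \<open>A pair belongs to its own class through conjugation by \<open>\<one>\<close>, so it is a
  conjugate of the other pair; \<open>y\<close> then matches one of its two members.\<close>

lemma (in group) conj_class_pair_eqD:
  assumes "conj_class G {y, inv y} = conj_class G {x, inv x}" "y \<in> carrier G"
  shows "\<exists>a\<in>carrier G. y = a \<otimes> x \<otimes> inv a \<or> y = a \<otimes> inv x \<otimes> inv a"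
proof -
  have "(\<lambda>z. \<one> \<otimes> z \<otimes> inv \<one>) ` {y, inv y} \<in> conj_class G {y, inv y}"
    unfolding conj_class_def using one_closed by blast
  then have "{y, inv y} \<in> conj_class G {x, inv x}" using assms by simp
  then obtain a where "a \<in> carrier G" "{y, inv y} = (\<lambda>z. a \<otimes> z \<otimes> inv a) ` {x, inv x}"
    unfolding conj_class_def by blast
  then show ?thesis by (intro bexI[of _ a]) (auto simp: doubleton_eq_iff)
qed

text \<open>All choices are compared at once: \<open>\<phi>\<close> moves the first generator into
  \<open>G2\<close>, where it agrees with \<open>g2\<close> up to sign and a factor in
  \<open>N2\<close>. The factor is killed by \<open>out_map\<close>, the sign swaps the pair, and
  changing the identification conjugates it.\<close>

theorem out_class_well_defined:
  assumes e1: "cyclic_ext G1 N1 e1 g1" and e2: "cyclic_ext G2 N2 e2 g2"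
    and a1: "normal_iso N1 G1 H \<alpha>1" and a2: "normal_iso N2 G2 H \<alpha>2"
    and \<phi>: "\<phi> \<in> iso G1 G2" "\<phi> ` N1 = N2"
  shows "conj_class (Out H) {out_map G2 N2 H \<alpha>2 g2, out_map G2 N2 H \<alpha>2 (inv\<^bsub>G2\<^esub> g2)}
    = conj_class (Out H) {out_map G1 N1 H \<alpha>1 g1, out_map G1 N1 H \<alpha>1 (inv\<^bsub>G1\<^esub> g1)}"
proof -
  interpret A1: normal_iso N1 G1 H \<alpha>1 by fact
  interpret A2: normal_iso N2 G2 H \<alpha>2 by fact
  interpret O: group "Out H" by (rule A1.H.group_Out)
  interpret o1: group_hom G1 "Out H" "out_map G1 N1 H \<alpha>1" by (rule A1.out_map_group_hom)
  interpret o2: group_hom G2 "Out H" "out_map G2 N2 H \<alpha>2" by (rule A2.out_map_group_hom)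
  interpret \<phi>: group_hom G1 G2 \<phi>
    using \<phi>(1) A1.is_group A2.is_group by (simp add: group_hom_def group_hom_axioms_def iso_def)
  note D1 = cyclic_extD[OF e1] and D2 = cyclic_extD[OF e2]
  note nat = out_map_natural[OF a2 D1(1) \<phi> D1(6)]
  obtain a where a: "a \<in> carrier (Out H)" "\<And>g. g \<in> carrier G1 \<Longrightarrow>
      out_map G1 N1 H (\<alpha>2 \<circ> \<phi>) g = conj_by (Out H) a (out_map G1 N1 H \<alpha>1 g)"
    using A1.out_map_conj_of_iso[OF normal_iso.iso[OF nat(1)]] by blast
  let ?x = "out_map G1 N1 H \<alpha>1 g1" and ?y = "out_map G2 N2 H \<alpha>2 g2"
  let ?\<psi> = "inv_into (carrier G1) \<phi>"
  have \<psi>: "?\<psi> \<in> iso G2 G1" using A1.iso_set_sym \<phi>(1) by blast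
  have inj: "inj_on \<phi> (carrier G1)" and surj: "\<phi> ` carrier G1 = carrier G2"
    using \<phi>(1) by (auto simp: iso_def bij_betw_def)
  interpret \<psi>: group_hom G2 G1 ?\<psi>
    using \<psi> A1.is_group A2.is_group by (simp add: group_hom_def group_hom_axioms_def iso_def)
  \<comment> \<open>The exponent map is carried along \<open>\<phi>\<close>, so that
    \<open>\<phi> g1\<close> and \<open>g2\<close> become generators for the same extension.\<close>
  have "cyclic_ext G2 N2 (e1 \<circ> ?\<psi>) (\<phi> g1)"
    unfolding cyclic_ext_def
  proof (intro conjI)
    show "e1 \<circ> ?\<psi> \<in> hom G2 integer_group"
      using e1 by (intro Group.hom_compose[OF \<psi>.homh]) (simp add: cyclic_ext_def)
    show "(e1 \<circ> ?\<psi>) (\<phi> g1) = 1" using inj D1(3,4) by simp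
    show "N2 = kernel G2 integer_group (e1 \<circ> ?\<psi>)"
    proof (intro equalityI subsetI)
      fix y assume "y \<in> N2"
      then obtain x where "x \<in> N1" "y = \<phi> x" using \<phi>(2) by blast
      then show "y \<in> kernel G2 integer_group (e1 \<circ> ?\<psi>)" using inj D1(5) by (simp add: kernel_def)
    next
      fix y assume y: "y \<in> kernel G2 integer_group (e1 \<circ> ?\<psi>)"
      then obtain x where "x \<in> carrier G1" "y = \<phi> x" using surj by (auto simp: kernel_def)
      then show "y \<in> N2" using y inj D1(5) \<phi>(2) by (auto simp: kernel_def)
    qed
  qed (use D1 D2 in auto)
  from cyclic_ext_generator_unique[OF this e2] obtain f where f: "f \<in> N2"
    "g2 = f \<otimes>\<^bsub>G2\<^esub> \<phi> g1 \<or> g2 = f \<otimes>\<^bsub>G2\<^esub> inv\<^bsub>G2\<^esub> (\<phi> g1)" by blast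
  have f': "f \<in> carrier G2" "out_map G2 N2 H \<alpha>2 f = \<one>\<^bsub>Out H\<^esub>"
    using f(1) A2.out_map_kernel by auto
  have "?y = conj_by (Out H) a ?x \<or>
      ?y = conj_by (Out H) a (inv\<^bsub>Out H\<^esub> ?x)"
    using f(2)
  proof
    assume "g2 = f \<otimes>\<^bsub>G2\<^esub> \<phi> g1"
    then have "?y = out_map G2 N2 H \<alpha>2 (\<phi> g1)" using f' D1(3) by simp
    then show ?thesis using nat(2)[OF D1(3)] a(2)[OF D1(3)] by simp
  next
    assume "g2 = f \<otimes>\<^bsub>G2\<^esub> inv\<^bsub>G2\<^esub> (\<phi> g1)"
    then have "?y = out_map G2 N2 H \<alpha>2 (\<phi> (inv\<^bsub>G1\<^esub> g1))" using f' D1(3) by simp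
    also have "\<dots> = conj_by (Out H) a (out_map G1 N1 H \<alpha>1 (inv\<^bsub>G1\<^esub> g1))"
      by (rule trans[OF nat(2)[symmetric] a(2)]) (use D1(3) in simp_all)
    finally show ?thesis using D1(3) by simp
  qed
  then have "conj_class (Out H) {?y, inv\<^bsub>Out H\<^esub> ?y} = conj_class (Out H) {?x, inv\<^bsub>Out H\<^esub> ?x}"
  proof
    assume "?y = conj_by (Out H) a ?x"
    then show ?thesis using a(1) D1(3) by (intro O.conj_class_pair_eq) auto
  next
    assume "?y = conj_by (Out H) a (inv\<^bsub>Out H\<^esub> ?x)"
    then have "conj_class (Out H) {?y, inv\<^bsub>Out H\<^esub> ?y}
        = conj_class (Out H) {inv\<^bsub>Out H\<^esub> ?x, inv\<^bsub>Out H\<^esub> (inv\<^bsub>Out H\<^esub> ?x)}"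
      using a(1) D1(3) by (intro O.conj_class_pair_eq) auto
    then show ?thesis using D1(3) by (simp add: insert_commute)
  qed
  then show ?thesis using D1(3) D2(3) by simp
qed

text \<open>The ambiguities are removed one by one until the two transported automorphisms are
  equal, not merely equal in \<open>Out H\<close>: the sign by inverting \<open>g1\<close>, the
  conjugation by changing \<alpha>1, the inner factor by changing \<open>g2\<close>. Then the
  isomorphism of the normal subgroups extends.\<close>

theorem out_class_injective:
  assumes e1: "cyclic_ext G1 N1 e1 g1" and e2: "cyclic_ext G2 N2 e2 g2"
    and a1: "normal_iso N1 G1 H \<alpha>1" and a2: "normal_iso N2 G2 H \<alpha>2"
    and eq: "conj_class (Out H) {out_map G2 N2 H \<alpha>2 g2, out_map G2 N2 H \<alpha>2 (inv\<^bsub>G2\<^esub> g2)}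
      = conj_class (Out H) {out_map G1 N1 H \<alpha>1 g1, out_map G1 N1 H \<alpha>1 (inv\<^bsub>G1\<^esub> g1)}"
  shows "\<exists>\<phi>\<in>iso G1 G2. \<phi> ` N1 = N2"
proof -
  interpret A1: normal_iso N1 G1 H \<alpha>1 by fact
  interpret A2: normal_iso N2 G2 H \<alpha>2 by fact
  interpret O: group "Out H" by (rule A1.H.group_Out)
  interpret I: normal "Inn H" "AutoGroup H" by (rule A1.H.Inn_normal)
  interpret o1: group_hom G1 "Out H" "out_map G1 N1 H \<alpha>1" by (rule A1.out_map_group_hom)
  interpret o2: group_hom G2 "Out H" "out_map G2 N2 H \<alpha>2" by (rule A2.out_map_group_hom)
  note D1 = cyclic_extD[OF e1] and D2 = cyclic_extD[OF e2]
  let ?x = "out_map G1 N1 H \<alpha>1 g1" and ?y = "out_map G2 N2 H \<alpha>2 g2"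
  have "conj_class (Out H) {?y, inv\<^bsub>Out H\<^esub> ?y} = conj_class (Out H) {?x, inv\<^bsub>Out H\<^esub> ?x}"
    using eq D1(3) D2(3) by simp
  from O.conj_class_pair_eqD[OF this] obtain a where a: "a \<in> carrier (Out H)"
    "?y = conj_by (Out H) a ?x \<or> ?y = conj_by (Out H) a (inv\<^bsub>Out H\<^esub> ?x)"
    using D2(3) by auto
  \<comment> \<open>\<open>g\<close> is \<open>g1\<close> or its inverse, according to the
    sign.\<close>
  obtain e g where e: "cyclic_ext G1 N1 e g"
    and ya: "?y = conj_by (Out H) a (out_map G1 N1 H \<alpha>1 g)"
    using a(2) e1 cyclic_ext_inv[OF e1] D1(3) o1.hom_inv[OF D1(3)] by metis
  note D = cyclic_extD[OF e]
  obtain \<theta> where \<theta>: "\<theta> \<in> auto H" "a = inn_coset H \<theta>"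
    using a(1) by (auto simp: Out_def FactGroup_def RCOSETS_def AutoGroup_simps)
  have "\<theta> \<circ> \<alpha>1 \<in> iso (G1\<lparr>carrier := N1\<rparr>) H" using A1.iso autoD(5)[OF \<theta>(1)] by (rule iso_set_trans)
  then interpret A: normal_iso N1 G1 H "\<theta> \<circ> \<alpha>1" by unfold_locales
  let ?T1 = "transport N1 (carrier H) (\<theta> \<circ> \<alpha>1) (conj_aut G1 N1 g)"
    and ?T2 = "transport N2 (carrier H) \<alpha>2 (conj_aut G2 N2 g2)"
  have T: "?T1 \<in> carrier (AutoGroup H)" "?T2 \<in> carrier (AutoGroup H)"
    using A.transport_conj_auto A2.transport_conj_auto D(3) D2(3) by (simp_all add: AutoGroup_simps)
  have "inn_coset H ?T1 = inn_coset H ?T2"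
    using ya A1.out_map_change_iso[OF \<theta>(1) D(3)] \<theta>(2) by (simp add: out_map_def)
  moreover have "?T1 \<in> inn_coset H ?T1" by (rule I.rcos_self[OF T(1) I.subgroup_axioms])
  \<comment> \<open>Equal cosets still leave an inner factor. It is conjugation by some
    \<open>\<alpha>2 f\<close>, and multiplying \<open>g2\<close> by \<open>f\<close> absorbs
    it.\<close>
  ultimately obtain i where i: "i \<in> Inn H" "?T1 = i \<otimes>\<^bsub>AutoGroup H\<^esub> ?T2"
    unfolding r_coset_def by auto
  then obtain h where h: "h \<in> carrier H" "i = conj_aut H (carrier H) h" by (auto simp: Inn_def)
  obtain f where f: "f \<in> N2" "h = \<alpha>2 f" using h(1) A2.bij by (auto simp: bij_betw_def)
  have "?T1 = transport N2 (carrier H) \<alpha>2 (conj_aut G2 N2 (f \<otimes>\<^bsub>G2\<^esub> g2))"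
    using i(2) h(2) f hom_mult[OF A2.transport_conj_hom, of f g2] D2(3) A2.transport_conj_inner[OF f(1)]
    by simp
  moreover define k where "k = f \<otimes>\<^bsub>G2\<^esub> g2"
  ultimately have TT: "?T1 = transport N2 (carrier H) \<alpha>2 (conj_aut G2 N2 k)" by simp
  have e2': "cyclic_ext G2 N2 e2 k" unfolding k_def by (rule cyclic_ext_mult[OF e2 f(1)])
  note D2' = cyclic_extD[OF e2']
  define \<beta> where "\<beta> = inv_into N2 \<alpha>2 \<circ> (\<theta> \<circ> \<alpha>1)"
  have "inv_into N2 \<alpha>2 \<in> iso H (G2\<lparr>carrier := N2\<rparr>)"
    using group.iso_set_sym[OF A2.subgroup_is_group[OF A2.is_group] A2.iso] by simp
  then have \<beta>: "\<beta> \<in> iso (G1\<lparr>carrier := N1\<rparr>) (G2\<lparr>carrier := N2\<rparr>)"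
    unfolding \<beta>_def by (rule iso_set_trans[OF A.iso])
  have \<alpha>\<beta>: "\<alpha>2 (\<beta> x) = \<theta> (\<alpha>1 x)" if "x \<in> N1" for x
  proof -
    have "(\<theta> \<circ> \<alpha>1) x \<in> \<alpha>2 ` N2" using that A.bij A2.bij by (auto simp: bij_betw_def)
    then show ?thesis unfolding \<beta>_def by (simp add: f_inv_into_f)
  qed
  have \<beta>_mem: "\<beta> x \<in> N2" if "x \<in> N1" for x using \<beta> that by (auto simp: iso_def hom_def)
  show ?thesis
  proof (rule cyclic_ext_iso_extend[OF e e2'])
    show "bij_betw \<beta> N1 N2" using \<beta> by (simp add: iso_def)
    show "\<beta> (x \<otimes>\<^bsub>G1\<^esub> y) = \<beta> x \<otimes>\<^bsub>G2\<^esub> \<beta> y" if "x \<in> N1" "y \<in> N1" for x y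
      using \<beta> that by (auto simp: iso_def hom_def)
    fix x assume x: "x \<in> N1"
    let ?x = "g \<otimes>\<^bsub>G1\<^esub> x \<otimes>\<^bsub>G1\<^esub> inv\<^bsub>G1\<^esub> g" and ?y = "k \<otimes>\<^bsub>G2\<^esub> \<beta> x \<otimes>\<^bsub>G2\<^esub> inv\<^bsub>G2\<^esub> k"
    have mem: "?x \<in> N1" "?y \<in> N2"
      using A1.inv_op_closed2[OF D(3) x] A2.inv_op_closed2[OF D2'(3) \<beta>_mem[OF x]] by auto
    have "?T1 ((\<theta> \<circ> \<alpha>1) x) = \<theta> (\<alpha>1 ?x)"
      using transport_apply[OF A.bij x] x by (simp add: conj_aut_def)
    moreover have "transport N2 (carrier H) \<alpha>2 (conj_aut G2 N2 k) (\<alpha>2 (\<beta> x)) = \<alpha>2 ?y"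
      using transport_apply[OF A2.bij \<beta>_mem[OF x]] \<beta>_mem[OF x] by (simp add: conj_aut_def)
    ultimately have "\<alpha>2 (\<beta> ?x) = \<alpha>2 ?y" using TT \<alpha>\<beta>[OF x] \<alpha>\<beta>[OF mem(1)] by simp
    then show "\<beta> ?x = ?y"
      using A2.bij \<beta>_mem[OF mem(1)] mem(2) by (auto simp: bij_betw_def inj_on_def)
  qed
qed



section \<open>Constructing an extension from an automorphism\<close>

text \<open>Conjugation by \<open>g\<close> might map \<open>N\<close> onto a proper subgroup, hence
  the condition on both \<open>g\<close> and its inverse. Elements conjugating \<open>N\<close> into
  itself are closed under products, which covers all integer powers.\<close>

lemma (in group) subgroup_cyclic_extension:
  assumes N: "subgroup N G" and g: "g \<in> carrier G"
    and conj: "\<And>f. f \<in> N \<Longrightarrow> g \<otimes> f \<otimes> inv g \<in> N" "\<And>f. f \<in> N \<Longrightarrow> inv g \<otimes> f \<otimes> g \<in> N"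
  shows "subgroup {f \<otimes> g [^] i | f (i::int). f \<in> N} G"
proof -
  interpret N: subgroup N G by fact
  define P where "P x \<longleftrightarrow> x \<in> carrier G \<and> (\<forall>f\<in>N. x \<otimes> f \<otimes> inv x \<in> N)" for x
  have P_mult: "P (x \<otimes> y)" if "P x" "P y" for x y
    unfolding P_def
  proof (intro conjI ballI)
    show "x \<otimes> y \<in> carrier G" using that by (simp add: P_def)
    fix f assume f: "f \<in> N"
    then have "x \<otimes> (y \<otimes> f \<otimes> inv y) \<otimes> inv x \<in> N" using that by (simp add: P_def)
    moreover have "x \<otimes> y \<otimes> f \<otimes> inv (x \<otimes> y) = x \<otimes> (y \<otimes> f \<otimes> inv y) \<otimes> inv x"
      using that f by (simp add: P_def inv_mult_group m_assoc)
    ultimately show "x \<otimes> y \<otimes> f \<otimes> inv (x \<otimes> y) \<in> N" by simp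
  qed
  have P_nat: "P (x [^] (k::nat))" if "P x" for x k
  proof (induction k)
    case 0
    then show ?case by (simp add: P_def)
  next
    case (Suc k)
    then show ?case using P_mult[OF Suc that] by simp
  qed
  have "P g" "P (inv g)" using g conj by (simp_all add: P_def)
  then have P_int: "P (g [^] i)" for i :: int
    using g by (cases i rule: int_cases2) (simp_all add: int_pow_int P_nat int_pow_neg_int nat_pow_inv[symmetric])
  have cancel: "inv x \<otimes> (x \<otimes> y) = y" if "x \<in> carrier G" "y \<in> carrier G" for x y
    using that by (simp add: m_assoc[symmetric])
  show ?thesis
  proof (rule subgroupI)
    show "{f \<otimes> g [^] i | f (i::int). f \<in> N} \<subseteq> carrier G" using g by auto
    show "{f \<otimes> g [^] i | f (i::int). f \<in> N} \<noteq> {}" using N.one_closed by blast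
  next
    fix a assume "a \<in> {f \<otimes> g [^] i | f (i::int). f \<in> N}"
    then obtain f and i :: int where a: "f \<in> N" "a = f \<otimes> g [^] i" by blast
    have "g [^] (- i) \<otimes> inv f \<otimes> inv (g [^] (- i)) \<in> N" using P_int[of "- i"] a(1) by (simp add: P_def)
    moreover have "inv a = (g [^] (- i) \<otimes> inv f \<otimes> inv (g [^] (- i))) \<otimes> g [^] (- i)"
      using a g by (simp add: inv_mult_group int_pow_neg m_assoc)
    ultimately show "inv a \<in> {f \<otimes> g [^] i | f (i::int). f \<in> N}" by blast
  next
    fix a b assume "a \<in> {f \<otimes> g [^] i | f (i::int). f \<in> N}" "b \<in> {f \<otimes> g [^] i | f (i::int). f \<in> N}"
    then obtain f f' and i j :: int where a: "f \<in> N" "a = f \<otimes> g [^] i" and b: "f' \<in> N" "b = f' \<otimes> g [^] j"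
      by blast
    have "f \<otimes> (g [^] i \<otimes> f' \<otimes> inv (g [^] i)) \<in> N" using P_int[of i] a(1) b(1) by (simp add: P_def)
    moreover have "a \<otimes> b = (f \<otimes> (g [^] i \<otimes> f' \<otimes> inv (g [^] i))) \<otimes> g [^] (i + j)"
      using a b g by (simp add: int_pow_mult m_assoc cancel)
    ultimately show "a \<otimes> b \<in> {f \<otimes> g [^] i | f (i::int). f \<in> N}" by blast
  qed
qed

text \<open>Powers in \<open>AutoGroup\<close> compose restricted functions, whereas the geometric
  construction uses plain iterates; on the carrier the two agree.\<close>

lemma grp_auto_funpow:
  assumes "\<theta> \<in> auto H" "g \<in> carrier H" "group H"
  shows "(\<theta> [^]\<^bsub>AutoGroup H\<^esub> (k::nat)) g = (\<theta> ^^ k) g"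
proof -
  interpret H: group H by fact
  interpret A: group "AutoGroup H" by (rule H.AutoGroup)
  have "\<theta> [^]\<^bsub>AutoGroup H\<^esub> (k::nat) \<in> auto H \<and> (\<forall>g\<in>carrier H. (\<theta> [^]\<^bsub>AutoGroup H\<^esub> k) g = (\<theta> ^^ k) g)" for k
  proof (induction k)
    case 0
    show ?case
    proof (intro conjI ballI)
      show "\<theta> [^]\<^bsub>AutoGroup H\<^esub> (0::nat) \<in> auto H"
        by (simp only: nat_pow_0 AutoGroup_simps(3) H.id_in_auto)
      show "(\<theta> [^]\<^bsub>AutoGroup H\<^esub> (0::nat)) g = (\<theta> ^^ 0) g" if "g \<in> carrier H" for g
        using that by (simp add: AutoGroup_simps(3))
    qed
  next
    case (Suc k)
    have "\<theta> [^]\<^bsub>AutoGroup H\<^esub> Suc k \<in> auto H"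
      using A.nat_pow_closed[of \<theta> "Suc k"] assms(1) by (simp add: AutoGroup_simps)
    moreover have "(\<theta> [^]\<^bsub>AutoGroup H\<^esub> Suc k) g = (\<theta> ^^ Suc k) g" if "g \<in> carrier H" for g
    proof -
      have "\<theta> [^]\<^bsub>AutoGroup H\<^esub> Suc k = compose (carrier H) (\<theta> [^]\<^bsub>AutoGroup H\<^esub> k) \<theta>"
        using Suc assms(1) by (simp add: AutoGroup_simps)
      then have "(\<theta> [^]\<^bsub>AutoGroup H\<^esub> Suc k) g = (\<theta> [^]\<^bsub>AutoGroup H\<^esub> k) (\<theta> g)"
        using that by (simp add: compose_def)
      also have "\<dots> = (\<theta> ^^ k) (\<theta> g)" using Suc autoD(1)[OF assms(1) that] by blast
      finally show ?thesis by (simp add: funpow_swap1)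
    qed
    ultimately show ?case by blast
  qed
  then show ?thesis using assms(2) by blast
qed

text \<open>That a power of the coset is trivial means that the same power of any lift is an inner
  automorphism.\<close>

lemma finite_order_outer_lift:
  assumes "group H" "x \<in> carrier (Out H)" "finite_order (Out H) x"
  shows "\<exists>\<theta> k h. \<theta> \<in> auto H \<and> x = inn_coset H \<theta> \<and> (k::nat) > 0 \<and> h \<in> carrier H \<and>
    (\<forall>g\<in>carrier H. (\<theta> ^^ k) g = h \<otimes>\<^bsub>H\<^esub> g \<otimes>\<^bsub>H\<^esub> inv\<^bsub>H\<^esub> h)"
proof -
  interpret H: group H by fact
  interpret I: normal "Inn H" "AutoGroup H" by (rule H.Inn_normal)
  obtain \<theta> where \<theta>: "\<theta> \<in> auto H" "x = inn_coset H \<theta>"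
    using assms(2) by (auto simp: Out_def FactGroup_def RCOSETS_def AutoGroup_simps)
  then have \<theta>': "\<theta> \<in> carrier (AutoGroup H)" by (simp add: AutoGroup_simps)
  obtain k :: nat where k: "k > 0" "x [^]\<^bsub>Out H\<^esub> k = \<one>\<^bsub>Out H\<^esub>" using assms(3) by (auto simp: finite_order_def)
  have "inn_coset H (\<theta> [^]\<^bsub>AutoGroup H\<^esub> k) = Inn H"
    using k(2) I.FactGroup_pow[OF \<theta>', of k] by (simp add: \<theta>(2) Out_def FactGroup_def)
  then have "\<theta> [^]\<^bsub>AutoGroup H\<^esub> k \<in> Inn H"
    using I.rcos_self[OF I.nat_pow_closed[OF \<theta>'] I.subgroup_axioms] by metis
  then obtain h where h: "h \<in> carrier H" "\<theta> [^]\<^bsub>AutoGroup H\<^esub> k = conj_aut H (carrier H) h"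
    by (auto simp: Inn_def)
  have "(\<theta> ^^ k) g = h \<otimes>\<^bsub>H\<^esub> g \<otimes>\<^bsub>H\<^esub> inv\<^bsub>H\<^esub> h" if "g \<in> carrier H" for g
    using grp_auto_funpow[OF \<theta>(1) that assms(1), of k] h(2) that by (simp add: conj_aut_def)
  then show ?thesis using \<theta> k(1) h(1) by blast
qed

text \<open>After identifying \<open>\<real>\<^sup>n\<close> with \<open>\<real>\<^sup>m \<times> \<real>\<close> by \<open>J\<close>, the group \<open>M\<close> acts on the first factor (conjugated by
  \<open>S\<close>), while the generator acts by the affine realisation of \<open>\<theta>\<close> and a unit shift of the second.\<close>

theorem (in crystal_group) realise_automorphism:
  fixes \<theta> :: "'n selfmap \<Rightarrow> 'n selfmap"
  assumes card: "CARD('k::finite) = CARD('n) + 1" and \<theta>: "\<theta> \<in> auto (grp G)"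
    and k: "k > 0" and m0: "m0 \<in> G"
    and inner: "\<And>g. g \<in> G \<Longrightarrow> (\<theta> ^^ k) g = m0 \<circ> g \<circ> inv_isom m0"
  shows "\<exists>(\<Gamma> :: 'k selfmap set) N e \<gamma> \<alpha>. crystal_group \<Gamma> \<and> cyclic_ext (grp \<Gamma>) N e \<gamma> \<and>
    normal_iso N (grp \<Gamma>) (grp G) \<alpha> \<and> transport N G \<alpha> (conj_aut (grp \<Gamma>) N \<gamma>) = \<theta>"
proof -
  interpret K: group "isom_group :: 'k selfmap monoid" by (rule group_isom_group)
  have \<theta>_mem: "\<theta> g \<in> G" if "g \<in> G" for g using autoD(1)[OF \<theta>] that by simp
  have \<theta>_comp: "\<theta> (f \<circ> g) = \<theta> f \<circ> \<theta> g" if "f \<in> G" "g \<in> G" for f g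
    using autoD(2)[OF \<theta>] that by simp
  obtain L a and S :: "real^'n \<Rightarrow> real^'n" where L: "linear L" and S: "linear S" "inj S"
    and S_lin: "\<And>g x. g \<in> G \<Longrightarrow> norm (S (lin g x)) = norm (S x)"
    and S_L: "\<And>x. norm (S (L x)) = norm (S x)"
    and conj: "\<And>g x. g \<in> G \<Longrightarrow> L (g x) + a = \<theta> g (L x + a)"
    using affine_realisation[OF \<theta>_mem \<theta>_comp k m0 inner] by blast
  interpret L: linear L by fact
  interpret S: linear S by fact
  define A where "A x = L x + a" for x
  have "inj L"
    unfolding linear_injective_0[OF L]
  proof (intro allI impI)
    fix x assume "L x = 0"
    then have "S x = 0" using S_L[of x] S.zero by simp
    then show "x = 0" using S linear_injective_0 by blast
  qed
  then have "surj L" using linear_injective_imp_surjective[OF L] by blast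
  have surjA: "surj A"
  proof (rule surjI)
    fix y show "A (inv_into UNIV L (y - a)) = y"
      using \<open>surj L\<close> by (simp add: A_def surj_f_inv_f)
  qed
  have "surj S" using linear_injective_imp_surjective[OF S] by blast
  define S' where "S' = inv_into UNIV S"
  have SS': "S (S' y) = y" "S' (S x) = x" for x y
    using S(2) \<open>surj S\<close> by (simp_all add: S'_def surj_f_inv_f)
  have dim_eq: "dim (UNIV :: ((real^'n) \<times> real) set) = dim (UNIV :: (real^'k) set)"
    using card by simp
  obtain J :: "(real^'n) \<times> real \<Rightarrow> real^'k" and J' where J: "linear J" "linear J'"
    and nJ: "\<And>x. norm (J x) = norm x" "\<And>x. norm (J' x) = norm x"
    and JJ': "\<And>x. J' (J x) = x" "\<And>x. J (J' x) = x"
  proof (rule isometries_subspaces[OF subspace_UNIV subspace_UNIV dim_eq])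
    fix f :: "(real^'n) \<times> real \<Rightarrow> real^'k" and g
    assume "linear f" "linear g"
      and *: "\<And>x. x \<in> UNIV \<Longrightarrow> norm (f x) = norm x" "\<And>x. x \<in> UNIV \<Longrightarrow> norm (g x) = norm x"
      "\<And>x. x \<in> UNIV \<Longrightarrow> g (f x) = x" "\<And>x. x \<in> UNIV \<Longrightarrow> f (g x) = x"
    then show ?thesis using *[OF UNIV_I] by (intro that[of f g])
  qed
  interpret J: linear J by fact
  interpret J': linear J' by fact
  \<comment> \<open>\<open>f\<close> acts on the first factor in coordinates deformed by
    \<open>S\<close>, and \<open>t\<close> shifts the second factor. Composition adds the shifts, so
    \<open>E\<close> turns relations between affine maps into relations between isometries.\<close>
  define E where "E f t = (\<lambda>x. J (S (f (S' (fst (J' x)))), snd (J' x) + t))" for f t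
  have E_J: "E f t (J (y, s)) = J (S (f (S' y)), s + t)" for f t y s by (simp add: E_def JJ')
  have E_comp: "E f s \<circ> E g t = E (f \<circ> g) (t + s)" for f g s t
    by (auto simp: E_def JJ' SS' algebra_simps)
  have E_inj: "f = g" if "E f 0 = E g 0" for f g
  proof
    fix x
    have "J (S (f x), 0) = J (S (g x), 0)"
      using fun_cong[OF that, of "J (S x, 0)"] by (simp add: E_J SS')
    then have "S (f x) = S (g x)" using JJ'(1) by (metis fst_conv)
    then show "f x = g x" using S(2) by (simp add: inj_eq)
  qed
  have E_isom: "E f t \<in> carrier isom_group"
    if "surj f" and iso: "\<And>x y. norm (S (f x) - S (f y)) = norm (S x - S y)" for f t
  proof -
    have "dist (E f t x) (E f t y) = dist x y" for x y
    proof -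
      obtain u s where x: "x = J (u, s)" using JJ'(2)[of x] by (metis prod.collapse)
      obtain v r where y: "y = J (v, r)" using JJ'(2)[of y] by (metis prod.collapse)
      show ?thesis
        unfolding x y E_J dist_norm J.diff[symmetric] nJ
        using iso[of "S' u" "S' v"] by (simp add: norm_Pair SS')
    qed
    moreover have "surj (E f t)"
      unfolding surj_def
    proof
      fix y
      obtain v r where y: "y = J (v, r)" using JJ'(2)[of y] by (metis prod.collapse)
      obtain z where "S' v = f z" using \<open>surj f\<close> by (metis surjD)
      then have "E f t (J (S z, r - t)) = y" by (simp add: E_J y SS') (metis SS'(1))
      then show "\<exists>x. y = E f t x" by metis
    qed
    ultimately show ?thesis by (simp add: isom_group_def)
  qed
  have E_G: "E g t \<in> carrier isom_group" if g: "g \<in> G" for g t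
  proof (rule E_isom)
    show "surj g" by (rule isom_groupD(1)[OF carr[OF g]])
    fix x y
    interpret g: linear "lin g" using lin_isom(1)[OF carr[OF g]] .
    have "S (g x) - S (g y) = S (lin g (x - y))"
      unfolding S.diff[symmetric] g.diff by (simp add: lin_def)
    then show "norm (S (g x) - S (g y)) = norm (S x - S y)" using S_lin[OF g] by (simp add: S.diff)
  qed
  define \<gamma> where "\<gamma> = E A 1"
  have \<gamma>: "\<gamma> \<in> carrier isom_group"
    unfolding \<gamma>_def
  proof (rule E_isom[OF surjA])
    fix x y
    have "S (A x) - S (A y) = S (L (x - y))" unfolding S.diff[symmetric] by (simp add: A_def L.diff)
    then show "norm (S (A x) - S (A y)) = norm (S x - S y)" using S_L by (simp add: S.diff)
  qed
  define \<iota> where "\<iota> m = E m 0" for m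
  define N where "N = \<iota> ` G"
  have \<iota>_comp: "\<iota> f \<circ> \<iota> g = \<iota> (f \<circ> g)" for f g by (simp add: \<iota>_def E_comp)
  have \<iota>_hom: "group_hom (grp G) (isom_group :: 'k selfmap monoid) \<iota>"
    using grp K.is_group E_G \<iota>_comp by (simp add: group_hom_def group_hom_axioms_def hom_def \<iota>_def)
  have N: "subgroup N isom_group"
    using group_hom.img_is_subgroup[OF \<iota>_hom] by (simp add: N_def)
  interpret N: isometry_group N using N by (rule isometry_group.intro)
  have \<iota>_conj: "\<gamma> \<circ> \<iota> m = \<iota> (\<theta> m) \<circ> \<gamma>" if "m \<in> G" for m
  proof -
    have "A \<circ> m = \<theta> m \<circ> A" using conj[OF that] by (auto simp: A_def)
    then show ?thesis unfolding \<gamma>_def \<iota>_def E_comp by simp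
  qed
  have conj1: "\<gamma> \<circ> f \<circ> inv_isom \<gamma> \<in> N" if f: "f \<in> N" for f
  proof -
    obtain m where m: "m \<in> G" "f = \<iota> m" using f by (auto simp: N_def)
    have "\<gamma> \<circ> f \<circ> inv_isom \<gamma> = \<iota> (\<theta> m)"
      unfolding m(2) by (rule isom_conj_eqI[OF \<gamma> \<iota>_conj[OF m(1)]])
    then show ?thesis using \<theta>_mem[OF m(1)] by (simp only: N_def imageI)
  qed
  have conj2: "inv_isom \<gamma> \<circ> f \<circ> \<gamma> \<in> N" if f: "f \<in> N" for f
  proof -
    obtain m where m: "m \<in> G" "f = \<iota> m" using f by (auto simp: N_def)
    \<comment> \<open>Stability under conjugation by the inverse of \<open>\<gamma>\<close> comes
      from the surjectivity of \<open>\<theta>\<close>.\<close>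
    obtain m' where m': "m' \<in> G" "m = \<theta> m'" using autoD(3)[OF \<theta>] m(1) by auto
    have "inv_isom \<gamma> \<circ> f \<circ> \<gamma> = inv_isom \<gamma> \<circ> (\<gamma> \<circ> \<iota> m')"
      unfolding m(2) m'(2) \<iota>_conj[OF m'(1)] by (rule comp_assoc)
    also have "\<dots> = \<iota> m'" unfolding comp_assoc[symmetric] inv_isom_group(1)[OF \<gamma>] by simp
    finally show ?thesis using m'(1) by (simp only: N_def imageI)
  qed
  define \<Gamma> where "\<Gamma> = {f \<circ> \<gamma> [^]\<^bsub>isom_group\<^esub> i | f (i::int). f \<in> N}"
  have \<Gamma>: "subgroup \<Gamma> isom_group"
    using K.subgroup_cyclic_extension[OF N \<gamma>] conj1 conj2 unfolding \<Gamma>_def by simp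
  interpret \<Gamma>: isometry_group \<Gamma> using \<Gamma> by (rule isometry_group.intro)
  \<comment> \<open>The last coordinate. \<open>N\<close> preserves it and \<open>\<gamma>\<close>
    raises it by 1, so on \<open>\<Gamma>\<close> its increment is the exponent of
    \<open>\<gamma>\<close>.\<close>
  define ht where "ht x = snd (J' x)" for x
  have ht_\<iota>: "ht (\<iota> m x) = ht x" for m x by (simp add: ht_def \<iota>_def E_def JJ')
  have ht_N: "ht (f x) = ht x" if "f \<in> N" for f x using that ht_\<iota> by (auto simp: N_def)
  have ht_\<gamma>: "ht (\<gamma> x) = ht x + 1" for x by (simp add: ht_def \<gamma>_def E_def JJ')
  have ht_nat: "ht ((\<gamma> [^]\<^bsub>isom_group\<^esub> (j::nat)) x) = ht x + real j" for j x
  proof (induction j arbitrary: x)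
    case (Suc j)
    have "(\<gamma> [^]\<^bsub>isom_group\<^esub> Suc j) x = (\<gamma> [^]\<^bsub>isom_group\<^esub> j) (\<gamma> x)" by simp
    then show ?case using Suc ht_\<gamma> by simp
  qed simp
  have \<gamma>_pow: "\<gamma> [^]\<^bsub>isom_group\<^esub> i \<in> carrier isom_group" for i :: int using \<gamma> by simp
  have ht_int: "ht ((\<gamma> [^]\<^bsub>isom_group\<^esub> i) x) = ht x + of_int i" for i :: int and x
  proof (cases i rule: int_cases2)
    case (nonneg j)
    then show ?thesis using ht_nat by (simp add: int_pow_int)
  next
    case (nonpos j)
    have pj: "\<gamma> [^]\<^bsub>isom_group\<^esub> j \<in> carrier isom_group" using \<gamma> by simp
    have "ht ((\<gamma> [^]\<^bsub>isom_group\<^esub> j) ((inv_isom (\<gamma> [^]\<^bsub>isom_group\<^esub> j)) x)) = ht x"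
      by (simp only: inv_isom_group(4)[OF pj])
    then show ?thesis using nonpos ht_nat \<gamma> by (simp add: K.int_pow_neg_int)
  qed
  have ht_0: "ht 0 = 0" using J'.zero by (simp add: ht_def)
  have \<Gamma>_ht: "\<exists>i::int. \<forall>x. ht (F x) = ht x + of_int i" if "F \<in> \<Gamma>" for F
    using that ht_N ht_int by (auto simp: \<Gamma>_def)
  \<comment> \<open>For \<open>F\<close> in \<open>\<Gamma>\<close> this height is already an
    integer; the floor only changes the type.\<close>
  define e where "e F = \<lfloor>ht (F 0)\<rfloor>" for F :: "'k selfmap"
  have e_ht: "ht (F x) = ht x + of_int (e F)" if "F \<in> \<Gamma>" for F x
    using \<Gamma>_ht[OF that] ht_0 by (auto simp: e_def)
  have N\<Gamma>: "f \<in> \<Gamma>" if "f \<in> N" for f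
  proof -
    have "f = f \<circ> \<gamma> [^]\<^bsub>isom_group\<^esub> (0::int)" by simp
    then show ?thesis using that unfolding \<Gamma>_def by blast
  qed
  have \<gamma>\<Gamma>: "\<gamma> \<in> \<Gamma>"
  proof -
    have "\<gamma> = id \<circ> \<gamma> [^]\<^bsub>isom_group\<^esub> (1::int)" using \<gamma> by simp
    then show ?thesis using N.id_mem unfolding \<Gamma>_def by blast
  qed
  have ext: "cyclic_ext (grp \<Gamma>) N e \<gamma>"
    unfolding cyclic_ext_def
  proof (intro conjI)
    show "group (grp \<Gamma>)" by (rule \<Gamma>.grp)
    show "e \<in> hom (grp \<Gamma>) integer_group"
    proof (rule homI)
      fix x y assume "x \<in> carrier (grp \<Gamma>)" "y \<in> carrier (grp \<Gamma>)"
      then have "real_of_int (e (x \<circ> y)) = of_int (e x + e y)"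
        using e_ht[of "x \<circ> y" 0] e_ht[of x "y 0"] e_ht[of y 0] \<Gamma>.comp_mem[of x y] by simp
      then have "e (x \<circ> y) = e x + e y" by (simp only: of_int_eq_iff)
      then show "e (x \<otimes>\<^bsub>grp \<Gamma>\<^esub> y) = e x \<otimes>\<^bsub>integer_group\<^esub> e y" by simp
    qed simp
    show "N = kernel (grp \<Gamma>) integer_group e"
    proof (intro equalityI subsetI)
      fix f assume "f \<in> N"
      then show "f \<in> kernel (grp \<Gamma>) integer_group e"
        using N\<Gamma> ht_N ht_0 by (simp add: kernel_def e_def)
    next
      fix F assume F: "F \<in> kernel (grp \<Gamma>) integer_group e"
      then obtain f and i :: int where f: "f \<in> N" "F = f \<circ> \<gamma> [^]\<^bsub>isom_group\<^esub> i"
        by (auto simp: kernel_def \<Gamma>_def)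
      have "e F = i" using ht_N[OF f(1)] ht_int ht_0 by (simp add: e_def f(2))
      then have "i = 0" using F by (simp add: kernel_def)
      then show "F \<in> N" using f by simp
    qed
    show "\<gamma> \<in> carrier (grp \<Gamma>)" using \<gamma>\<Gamma> by simp
    show "e \<gamma> = 1" using ht_\<gamma>[of 0] ht_0 by (simp add: e_def)
  qed
  define \<alpha> where "\<alpha> = inv_into G \<iota>"
  have \<iota>_inj: "inj_on \<iota> G" using E_inj by (auto simp: inj_on_def \<iota>_def)
  have "\<iota> \<in> iso (grp G) (grp N)"
    using \<iota>_inj \<iota>_comp by (auto simp: iso_def hom_def bij_betw_def N_def)
  then have \<alpha>_iso: "\<alpha> \<in> iso (grp N) (grp G)"
    using group.iso_set_sym[OF grp] by (simp add: \<alpha>_def)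
  have \<alpha>_\<iota>: "\<alpha> (\<iota> m) = m" if "m \<in> G" for m using that \<iota>_inj by (simp add: \<alpha>_def)
  interpret NG: normal N "grp \<Gamma>" by (rule cyclic_extD(6)[OF ext])
  have ni: "normal_iso N (grp \<Gamma>) (grp G) \<alpha>"
    using NG.normal_axioms grp \<alpha>_iso by (simp add: normal_iso_def normal_iso_axioms_def)
  have tr: "transport N G \<alpha> (conj_aut (grp \<Gamma>) N \<gamma>) = \<theta>"
  proof (rule transport_eqI)
    show "bij_betw \<alpha> N G" using \<alpha>_iso by (simp add: iso_def)
    show "\<theta> \<in> extensional G" using autoD(4)[OF \<theta>] by simp
    fix f assume f: "f \<in> N"
    then obtain m where m: "m \<in> G" "f = \<iota> m" by (auto simp: N_def)
    have "conj_aut (grp \<Gamma>) N \<gamma> f = \<gamma> \<circ> f \<circ> inv_isom \<gamma>"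
      using f K.m_inv_consistent[OF \<Gamma> \<gamma>\<Gamma>] by (simp add: conj_aut_def)
    also have "\<dots> = \<iota> (\<theta> m)" unfolding m(2) by (rule isom_conj_eqI[OF \<gamma> \<iota>_conj[OF m(1)]])
    finally show "\<theta> (\<alpha> f) = \<alpha> (conj_aut (grp \<Gamma>) N \<gamma> f)"
      using \<alpha>_\<iota>[OF \<theta>_mem[OF m(1)]] \<alpha>_\<iota>[OF m(1)] m(2) by simp
  qed
  obtain B where B: "B > 0" "\<And>x. B * norm x \<le> norm (S x)"
    using linear_inj_bounded_below_pos[OF S] by blast
  \<comment> \<open>The first component of the point \<open>\<gamma>\<close> to the power
    \<open>i\<close> sends 0 to, in the original coordinates of \<open>G\<close>. No bound uniform
    in \<open>i\<close> is available, so discreteness and density are checked level by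
    level.\<close>
  define z where "z i = S' (fst (J' ((\<gamma> [^]\<^bsub>isom_group\<^esub> i) 0)))" for i :: int
  have \<gamma>z: "(\<gamma> [^]\<^bsub>isom_group\<^esub> i) 0 = J (S (z i), of_int i)" for i
  proof -
    have "J' ((\<gamma> [^]\<^bsub>isom_group\<^esub> i) 0) = (S (z i), of_int i)"
      using ht_int[of i 0] ht_0 by (simp add: z_def SS' ht_def prod_eq_iff)
    then show ?thesis using JJ'(2) by metis
  qed
  have F0: "(\<iota> m \<circ> \<gamma> [^]\<^bsub>isom_group\<^esub> i) 0 = J (S (m (z i)), of_int i)" for m i
    by (simp add: \<gamma>z \<iota>_def E_J SS')
  have fin: "finite {F \<in> \<Gamma>. norm (F 0) \<le> R}" for R
  proof -
    \<comment> \<open>Only finitely many levels \<open>i\<close> are in reach. On each of them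
      \<open>m (z i)\<close> is confined to radius \<open>R / B\<close>, and \<open>m 0\<close> is
      at distance \<open>norm (z i)\<close> from it.\<close>
    let ?X = "SIGMA i:{- \<lceil>R\<rceil>..\<lceil>R\<rceil>}. {m \<in> G. norm (m 0) \<le> R / B + norm (z i)}"
    have "finite ?X" using finite_bounded by (intro finite_SigmaI) auto
    moreover have "{F \<in> \<Gamma>. norm (F 0) \<le> R} \<subseteq> (\<lambda>(i, m). \<iota> m \<circ> \<gamma> [^]\<^bsub>isom_group\<^esub> i) ` ?X"
    proof
      fix F assume "F \<in> {F \<in> \<Gamma>. norm (F 0) \<le> R}"
      then have F: "F \<in> \<Gamma>" "norm (F 0) \<le> R" by simp_all
      then obtain m and i :: int where m: "m \<in> G" "F = \<iota> m \<circ> \<gamma> [^]\<^bsub>isom_group\<^esub> i"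
        unfolding \<Gamma>_def N_def by blast
      then have n: "norm (S (m (z i)), real_of_int i) \<le> R" using F(2) F0[of m i] nJ(1) by metis
      have "\<bar>real_of_int i\<bar> \<le> R" using n norm_snd_le[of "real_of_int i" "S (m (z i))"] by simp
      then have "i \<le> \<lceil>R\<rceil>" "- \<lceil>R\<rceil> \<le> i" by linarith+
      then have "i \<in> {- \<lceil>R\<rceil>..\<lceil>R\<rceil>}" by simp
      moreover have "norm (m 0) \<le> R / B + norm (z i)"
      proof -
        have "B * norm (m (z i)) \<le> R"
          using n norm_fst_le[of "S (m (z i))" "real_of_int i"] B(2)[of "m (z i)"] by simp
        then have "norm (m (z i)) \<le> R / B" using B(1) by (simp add: field_simps)
        moreover have "norm (m 0 - m (z i)) = norm (z i)"
          using isom_groupD(2)[OF carr[OF m(1)], of 0 "z i"] by (simp add: dist_norm)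
        ultimately show ?thesis using norm_triangle_sub[of "m 0" "m (z i)"] by linarith
      qed
      ultimately have "(i, m) \<in> ?X" using m(1) by blast
      then show "F \<in> (\<lambda>(i, m). \<iota> m \<circ> \<gamma> [^]\<^bsub>isom_group\<^esub> i) ` ?X"
        by (rule image_eqI[rotated]) (simp add: m(2))
    qed
    ultimately show ?thesis using finite_surj by blast
  qed
  have dense: "\<exists>D. \<forall>x. \<exists>F\<in>\<Gamma>. dist (F 0) x \<le> D"
  proof -
    obtain d where d: "\<And>x. \<exists>g\<in>G. dist (g 0) x \<le> d" using dense_orbit by blast
    obtain C where C: "C > 0" "\<And>x. norm (S x) \<le> C * norm x" using linear_bounded_pos[OF S(1)] by blast
    \<comment> \<open>Two approximations in the orbit of \<open>G\<close> cost \<open>d\<close> each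
      and are stretched by \<open>S\<close> by at most \<open>C\<close>; the 1 pays for rounding
      \<open>s\<close> to a level.\<close>
    have "\<exists>F\<in>\<Gamma>. dist (F 0) x \<le> C * (2 * d) + 1" for x
    proof -
      obtain y s where x: "x = J (y, s)" using JJ'(2)[of x] by (metis prod.collapse)
      define i where "i = \<lfloor>s\<rfloor>"
      obtain m1 where m1: "m1 \<in> G" "dist (m1 0) (z i) \<le> d" using d by blast
      obtain m2 where m2: "m2 \<in> G" "dist (m2 0) (S' y) \<le> d" using d by blast
      \<comment> \<open>The inverse of \<open>m1\<close> brings \<open>z i\<close> back near 0, and
        \<open>m2\<close> then carries it near \<open>S' y\<close>.\<close>
      define m where "m = m2 \<circ> inv_isom m1"
      have m: "m \<in> G" unfolding m_def using comp_mem[OF m2(1) inv_mem[OF m1(1)]] .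
      have "dist (m (z i)) (m2 0) = dist ((inv_isom m1) (z i)) ((inv_isom m1) (m1 0))"
        unfolding m_def comp_apply isom_groupD(2)[OF carr[OF m2(1)]] inv_isom_group(3)[OF carr[OF m1(1)]] ..
      also have "\<dots> = dist (z i) (m1 0)" by (rule isom_groupD(2)[OF carr[OF inv_mem[OF m1(1)]]])
      finally have "dist (m (z i)) (m2 0) \<le> d" using m1(2) by (simp add: dist_commute)
      then have "dist (m (z i)) (S' y) \<le> 2 * d"
        using m2(2) dist_triangle[of "m (z i)" "S' y" "m2 0"] by linarith
      then have "C * norm (m (z i) - S' y) \<le> C * (2 * d)"
        using C(1) by (intro mult_left_mono) (simp_all add: dist_norm)
      then have "norm (S (m (z i) - S' y)) \<le> C * (2 * d)" using C(2) by (rule order_trans[rotated])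
      then have 1: "norm (S (m (z i)) - y) \<le> C * (2 * d)" by (simp add: S.diff SS')
      have 2: "\<bar>real_of_int i - s\<bar> \<le> 1" unfolding i_def by linarith
      let ?F = "\<iota> m \<circ> \<gamma> [^]\<^bsub>isom_group\<^esub> i"
      have "dist (?F 0) x = norm (S (m (z i)) - y, real_of_int i - s)"
        unfolding F0 x dist_norm J.diff[symmetric] nJ by simp
      also have "\<dots> \<le> norm (S (m (z i)) - y) + norm (real_of_int i - s)" by (rule norm_Pair_le)
      also have "\<dots> \<le> C * (2 * d) + 1" using 1 2 by simp
      finally have "dist (?F 0) x \<le> C * (2 * d) + 1" .
      moreover have "?F \<in> \<Gamma>" unfolding \<Gamma>_def N_def using m by blast
      ultimately show ?thesis by blast
    qed
    then show ?thesis by blast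
  qed
  have "crystal_group \<Gamma>"
    using fin dense \<Gamma>.isometry_group_axioms by (simp add: crystal_group_def crystal_group_axioms_def)
  then show ?thesis using ext ni tr by blast
qed



section \<open>The classification\<close>

lemma grp_nat_pow: "g [^]\<^bsub>grp \<Gamma>\<^esub> (k::nat) = (g :: ('n::finite) selfmap) ^^ k"
proof (induction k)
  case (Suc k)
  have "g [^]\<^bsub>grp \<Gamma>\<^esub> Suc k = g [^]\<^bsub>grp \<Gamma>\<^esub> k \<circ> g" by (simp add: nat_pow_def)
  also have "\<dots> = g ^^ Suc k" by (simp only: Suc funpow_Suc_right)
  finally show ?case .
qed (simp add: nat_pow_def)

text \<open>By \<open>conjugation_power_inner\<close> some power of \<open>g\<close> acts on
  \<open>N\<close> like an element \<open>f0\<close> of \<open>N\<close>, and \<open>out_map\<close>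
  sends \<open>f0\<close> to the identity.\<close>

lemma (in crystal_group) out_map_finite_order:
  assumes ni: "normal_iso N (grp G) H \<alpha>" and g: "g \<in> G"
  shows "finite_order (Out H) (out_map (grp G) N H \<alpha> g)"
proof -
  interpret A: normal_iso N "grp G" H \<alpha> by fact
  interpret o: group_hom "grp G" "Out H" "out_map (grp G) N H \<alpha>" by (rule A.out_map_group_hom)
  have NG: "N \<subseteq> G" using A.subset by simp
  have N: "subgroup N isom_group"
    by (rule isom.incl_subgroup[OF subgp A.subgroup_axioms])
  have inv_eq: "inv\<^bsub>grp G\<^esub> f = inv_isom f" if "f \<in> G" for f
    by (rule isom.m_inv_consistent[OF subgp that])
  have "g \<circ> f \<circ> inv_isom g \<in> N" if "f \<in> N" for f
    using A.inv_op_closed2[of g f] g that by (simp add: inv_eq)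
  from conjugation_power_inner[OF N NG g this] obtain k f0 where k: "k > 0" "f0 \<in> N"
    and eq: "\<And>f. f \<in> N \<Longrightarrow> (g ^^ k) \<circ> f = f0 \<circ> f \<circ> inv_isom f0 \<circ> (g ^^ k)" by blast
  have gk: "g ^^ k \<in> G" using funpow_mem[OF g] .
  have "conj_aut (grp G) N (g ^^ k) = conj_aut (grp G) N f0"
    unfolding conj_aut_def
  proof (rule restrict_ext)
    fix f assume f: "f \<in> N"
    have "(g ^^ k) \<circ> f \<circ> inv_isom (g ^^ k) = f0 \<circ> f \<circ> inv_isom f0"
      by (rule isom_conj_eqI[OF carr[OF gk] eq[OF f]])
    then show "g ^^ k \<otimes>\<^bsub>grp G\<^esub> f \<otimes>\<^bsub>grp G\<^esub> inv\<^bsub>grp G\<^esub> (g ^^ k) = f0 \<otimes>\<^bsub>grp G\<^esub> f \<otimes>\<^bsub>grp G\<^esub> inv\<^bsub>grp G\<^esub> f0"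
      using inv_eq[OF gk] inv_eq[of f0] k(2) NG by auto
  qed
  then have "out_map (grp G) N H \<alpha> (g ^^ k) = out_map (grp G) N H \<alpha> f0" by (simp add: out_map_def)
  also have "\<dots> = \<one>\<^bsub>Out H\<^esub>" by (rule A.out_map_kernel[OF k(2)])
  finally have "out_map (grp G) N H \<alpha> g [^]\<^bsub>Out H\<^esub> k = \<one>\<^bsub>Out H\<^esub>"
    using o.hom_nat_pow[of g k] g by (simp add: grp_nat_pow)
  then show ?thesis using k(1) by (auto simp: finite_order_def)
qed

lemma iso_pairsD:
  assumes "(\<Gamma>, N) \<in> iso_pairs \<Delta> M"
  shows "crystal_group \<Gamma>" "N \<lhd> grp \<Gamma>" "grp N \<cong> grp M" "grp \<Gamma> Mod N \<cong> grp \<Delta>"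
  using assms by (auto simp: iso_pairs_def space_group_iff)

lemma equiv_pair_rel: "equiv (iso_pairs \<Delta> M) (pair_rel \<Delta> M)"
proof (rule equivI)
  show "pair_rel \<Delta> M \<subseteq> iso_pairs \<Delta> M \<times> iso_pairs \<Delta> M" by (auto simp: pair_rel_def)
  show "refl_on (iso_pairs \<Delta> M) (pair_rel \<Delta> M)"
    by (auto simp: refl_on_def pair_rel_def intro!: bexI[OF _ id_iso])
  show "sym (pair_rel \<Delta> M)"
  proof (rule symI)
    fix p q assume "(p, q) \<in> pair_rel \<Delta> M"
    then obtain \<Gamma>1 N1 \<Gamma>2 N2 \<phi> where pq: "p = (\<Gamma>1, N1)" "q = (\<Gamma>2, N2)"
      "(\<Gamma>1, N1) \<in> iso_pairs \<Delta> M" "(\<Gamma>2, N2) \<in> iso_pairs \<Delta> M" "\<phi> \<in> iso (grp \<Gamma>1) (grp \<Gamma>2)" "\<phi> ` N1 = N2"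
      by (auto simp: pair_rel_def)
    interpret N1: normal N1 "grp \<Gamma>1" using iso_pairsD(2)[OF pq(3)] .
    have "inv_into \<Gamma>1 \<phi> \<in> iso (grp \<Gamma>2) (grp \<Gamma>1)" using N1.iso_set_sym[OF pq(5)] by simp
    moreover have "inv_into \<Gamma>1 \<phi> ` N2 = N1"
      using pq(5,6) N1.subset by (auto simp: iso_def bij_betw_def inv_into_image_cancel)
    ultimately show "(q, p) \<in> pair_rel \<Delta> M" using pq by (auto simp: pair_rel_def)
  qed
  show "trans (pair_rel \<Delta> M)"
  proof (rule transI)
    fix p q r assume "(p, q) \<in> pair_rel \<Delta> M" "(q, r) \<in> pair_rel \<Delta> M"
    moreover from this(1) obtain \<Gamma>1 N1 \<Gamma>2 N2 \<phi> where pq: "p = (\<Gamma>1, N1)" "q = (\<Gamma>2, N2)"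
      "(\<Gamma>1, N1) \<in> iso_pairs \<Delta> M" "\<phi> \<in> iso (grp \<Gamma>1) (grp \<Gamma>2)" "\<phi> ` N1 = N2"
      by (auto simp: pair_rel_def)
    ultimately obtain \<Gamma>3 N3 \<psi> where qr: "r = (\<Gamma>3, N3)" "(\<Gamma>3, N3) \<in> iso_pairs \<Delta> M"
      "\<psi> \<in> iso (grp \<Gamma>2) (grp \<Gamma>3)" "\<psi> ` N2 = N3"
      by (auto simp: pair_rel_def)
    have "\<psi> \<circ> \<phi> \<in> iso (grp \<Gamma>1) (grp \<Gamma>3)" using pq(4) qr(3) by (rule iso_set_trans)
    moreover have "(\<psi> \<circ> \<phi>) ` N1 = N3" using pq(5) qr(4) by (auto simp: image_comp[symmetric])
    ultimately have "\<exists>\<zeta>\<in>iso (grp \<Gamma>1) (grp \<Gamma>3). \<zeta> ` N1 = N3" by blast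
    then show "(p, r) \<in> pair_rel \<Delta> M" using pq(1,3) qr(1,2) by (simp add: pair_rel_def)
  qed
qed

definition out_class :: "('n::finite) selfmap set \<Rightarrow> 'n selfmap set \<Rightarrow> ('m::finite) selfmap set \<Rightarrow>
    ('n selfmap \<Rightarrow> 'm selfmap) \<Rightarrow> 'n selfmap \<Rightarrow> ('m selfmap \<Rightarrow> 'm selfmap) set set set" where
  "out_class \<Gamma> N M \<alpha> g = conj_class (Out (grp M))
     {out_map (grp \<Gamma>) N (grp M) \<alpha> g, out_map (grp \<Gamma>) N (grp M) \<alpha> (inv\<^bsub>grp \<Gamma>\<^esub> g)}"

text \<open>A relation that leaves the representative, the generator and the identification open.
  Independence of these choices then says that it is single-valued, and injectivity of the
  correspondence is the same statement read backwards.\<close>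

definition presents :: "('m::finite) selfmap set \<Rightarrow> (('n::finite) selfmap set \<times> 'n selfmap set) set \<Rightarrow>
    ('m selfmap \<Rightarrow> 'm selfmap) set set set \<Rightarrow> bool" where
  "presents M c C \<longleftrightarrow> (\<exists>\<Gamma> N e \<gamma> \<alpha>. (\<Gamma>, N) \<in> c \<and> cyclic_ext (grp \<Gamma>) N e \<gamma> \<and>
     normal_iso N (grp \<Gamma>) (grp M) \<alpha> \<and> C = out_class \<Gamma> N M \<alpha> \<gamma>)"

lemma presents_unique:
  assumes "c \<in> Iso \<Delta> M" "presents M c C" "presents M c C'"
  shows "C = C'"
proof -
  obtain \<Gamma> N e \<gamma> \<alpha> where 1: "(\<Gamma>, N) \<in> c" "cyclic_ext (grp \<Gamma>) N e \<gamma>"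
    "normal_iso N (grp \<Gamma>) (grp M) \<alpha>" "C = out_class \<Gamma> N M \<alpha> \<gamma>" using assms(2) unfolding presents_def by blast
  obtain \<Gamma>' N' e' \<gamma>' \<alpha>' where 2: "(\<Gamma>', N') \<in> c" "cyclic_ext (grp \<Gamma>') N' e' \<gamma>'"
    "normal_iso N' (grp \<Gamma>') (grp M) \<alpha>'" "C' = out_class \<Gamma>' N' M \<alpha>' \<gamma>'" using assms(3) unfolding presents_def by blast
  have "((\<Gamma>', N'), (\<Gamma>, N)) \<in> pair_rel \<Delta> M"
    using quotient_eq_iff[OF equiv_pair_rel assms(1)[unfolded Iso_def] assms(1)[unfolded Iso_def] 2(1) 1(1)] by simp
  then obtain \<phi> where "\<phi> \<in> iso (grp \<Gamma>') (grp \<Gamma>)" "\<phi> ` N' = N" by (auto simp: pair_rel_def)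
  then show ?thesis
    unfolding 1(4) 2(4) out_class_def by (rule out_class_well_defined[OF 2(2) 1(2) 2(3) 1(3)])
qed

lemma presents_injective:
  assumes "c \<in> Iso \<Delta> M" "c' \<in> Iso \<Delta> M" "presents M c C" "presents M c' C"
  shows "c = c'"
proof -
  obtain \<Gamma> N e \<gamma> \<alpha> where 1: "(\<Gamma>, N) \<in> c" "cyclic_ext (grp \<Gamma>) N e \<gamma>"
    "normal_iso N (grp \<Gamma>) (grp M) \<alpha>" "C = out_class \<Gamma> N M \<alpha> \<gamma>" using assms(3) unfolding presents_def by blast
  obtain \<Gamma>' N' e' \<gamma>' \<alpha>' where 2: "(\<Gamma>', N') \<in> c'" "cyclic_ext (grp \<Gamma>') N' e' \<gamma>'"
    "normal_iso N' (grp \<Gamma>') (grp M) \<alpha>'" "C = out_class \<Gamma>' N' M \<alpha>' \<gamma>'" using assms(4) unfolding presents_def by blast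
  have "\<exists>\<phi>\<in>iso (grp \<Gamma>) (grp \<Gamma>'). \<phi> ` N = N'"
    by (rule out_class_injective[OF 1(2) 2(2) 1(3) 2(3)]) (use 1(4) 2(4) in \<open>simp add: out_class_def\<close>)
  moreover have "(\<Gamma>, N) \<in> iso_pairs \<Delta> M" "(\<Gamma>', N') \<in> iso_pairs \<Delta> M"
    using in_quotient_imp_subset[OF equiv_pair_rel] assms(1,2) 1(1) 2(1) unfolding Iso_def by blast+
  ultimately have "((\<Gamma>, N), (\<Gamma>', N')) \<in> pair_rel \<Delta> M" by (simp add: pair_rel_def)
  then show ?thesis
    using quotient_eq_iff[OF equiv_pair_rel assms(1)[unfolded Iso_def] assms(2)[unfolded Iso_def] 1(1) 2(1)] by simp
qed

lemma iso_pairs_normal_iso: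
  assumes "(\<Gamma>, N) \<in> iso_pairs \<Delta> M" "group (grp M)" "\<alpha> \<in> iso (grp N) (grp M)"
  shows "normal_iso N (grp \<Gamma>) (grp M) \<alpha>"
  using iso_pairsD(2)[OF assms(1)] assms(2,3) by (simp add: normal_iso_def normal_iso_axioms_def)

theorem theorem7:
  fixes n :: nat
    and M :: "('m::finite) selfmap set"
    and \<Delta> :: "1 selfmap set"
  assumes "n \<ge> 2"
    and "CARD('n::finite) = n"
    and "CARD('m) = n - 1"
    and "space_group M"
    and "space_group \<Delta>"
    and "cyclic_group (grp \<Delta>)"
    and "infinite \<Delta>"
  shows "\<exists>F. bij_betw F
               (Iso \<Delta> M :: ('n selfmap set \<times> 'n selfmap set) set set)
               (inverse_pair_classes (Out (grp M))) \<and>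
          (\<forall>\<Gamma> N \<alpha> \<gamma>.
             (\<Gamma>, N) \<in> iso_pairs \<Delta> M \<and>
             \<alpha> \<in> iso (grp N) (grp M) \<and>
             \<gamma> \<in> \<Gamma> \<and>
             generate (grp \<Gamma> Mod N) {N #>\<^bsub>grp \<Gamma>\<^esub> \<gamma>} = carrier (grp \<Gamma> Mod N) \<longrightarrow>
             F (iso_class \<Delta> M \<Gamma> N) =
               conj_class (Out (grp M))
                 {transport N M \<alpha> (conj_aut (grp \<Gamma>) N \<gamma>)
                    <#\<^bsub>AutoGroup (grp M)\<^esub> Inn (grp M),
                  transport N M \<alpha> (inv\<^bsub>AutoGroup (grp N)\<^esub> (conj_aut (grp \<Gamma>) N \<gamma>))
                    <#\<^bsub>AutoGroup (grp M)\<^esub> Inn (grp M)})"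
proof -
  interpret M: crystal_group M using assms(4) by (simp add: space_group_iff)
  interpret D: crystal_group \<Delta> using assms(5) by (simp add: space_group_iff)
  interpret O: group "Out (grp M)" by (rule group.group_Out[OF M.grp])
  let ?Iso = "Iso \<Delta> M :: ('n selfmap set \<times> 'n selfmap set) set set"
  \<comment> \<open>By \<open>presents_unique\<close> at most one \<open>C\<close> qualifies for
    each class, so the choice is immaterial.\<close>
  define F where "F c = (SOME C. presents M c C)" for c :: "('n selfmap set \<times> 'n selfmap set) set"
  have inf\<Delta>: "infinite (carrier (grp \<Delta>))" using assms(7) by simp
  have class_mem: "iso_class \<Delta> M \<Gamma> N \<in> Iso \<Delta> M" "(\<Gamma>, N) \<in> iso_class \<Delta> M \<Gamma> N"
    if "(\<Gamma>, N) \<in> iso_pairs \<Delta> M" for \<Gamma> N :: "'n selfmap set"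
    using that equiv_class_self[OF equiv_pair_rel that] by (auto simp: iso_class_def Iso_def intro: quotientI)
  have F_eq: "F c = C" if "c \<in> ?Iso" "presents M c C" for c C
    unfolding F_def by (rule some_equality[of "presents M c", OF that(2)]) (rule presents_unique[OF that(1) _ that(2)])
  have ex: "\<exists>C \<in> inverse_pair_classes (Out (grp M)). presents M c C" if c_Iso: "c \<in> ?Iso" for c
  proof -
    obtain p where "c = pair_rel \<Delta> M `` {p}" "p \<in> iso_pairs \<Delta> M"
      using c_Iso[unfolded Iso_def] by (rule quotientE)
    then obtain \<Gamma> N where c: "(\<Gamma>, N) \<in> iso_pairs \<Delta> M" "c = iso_class \<Delta> M \<Gamma> N"
      unfolding iso_class_def by (metis surj_pair)
    note P = iso_pairsD[OF c(1)]
    obtain \<alpha> where "\<alpha> \<in> iso (grp N) (grp M)" using P(3) by (auto simp: is_iso_def)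
    then have ni: "normal_iso N (grp \<Gamma>) (grp M) \<alpha>" by (rule iso_pairs_normal_iso[OF c(1) M.grp])
    obtain e \<gamma> where ext: "cyclic_ext (grp \<Gamma>) N e \<gamma>"
      using cyclic_ext_exists(2)[OF P(2,4) D.grp assms(6) inf\<Delta>] by blast
    interpret o: group_hom "grp \<Gamma>" "Out (grp M)" "out_map (grp \<Gamma>) N (grp M) \<alpha>"
      by (rule normal_iso.out_map_group_hom[OF ni])
    have \<gamma>: "\<gamma> \<in> \<Gamma>" using cyclic_extD(3)[OF ext] by simp
    let ?x = "out_map (grp \<Gamma>) N (grp M) \<alpha> \<gamma>"
    have "finite_order (Out (grp M)) ?x" by (rule crystal_group.out_map_finite_order[OF P(1) ni \<gamma>])
    moreover have "?x \<in> carrier (Out (grp M))" using \<gamma> by simp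
    moreover have "out_class \<Gamma> N M \<alpha> \<gamma> = conj_class (Out (grp M)) {?x, inv\<^bsub>Out (grp M)\<^esub> ?x}"
      using \<gamma> by (simp add: out_class_def)
    ultimately have "out_class \<Gamma> N M \<alpha> \<gamma> \<in> inverse_pair_classes (Out (grp M))"
      unfolding inverse_pair_classes_def by blast
    moreover have "presents M c (out_class \<Gamma> N M \<alpha> \<gamma>)"
      unfolding presents_def c(2) using class_mem(2)[OF c(1)] ext ni by blast
    ultimately show ?thesis by blast
  qed
  have F_presents: "presents M c (F c)" "F c \<in> inverse_pair_classes (Out (grp M))" if "c \<in> ?Iso" for c
    using ex[OF that] F_eq[OF that] by auto
  have "inj_on F ?Iso"
  proof (rule inj_onI)
    fix c c' assume c: "c \<in> ?Iso" "c' \<in> ?Iso" "F c = F c'"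
    show "c = c'"
      using F_presents(1)[OF c(2)] unfolding c(3)[symmetric]
      by (rule presents_injective[OF c(1,2) F_presents(1)[OF c(1)]])
  qed
  moreover have "F ` ?Iso = inverse_pair_classes (Out (grp M))"
  proof (intro equalityI subsetI)
    show "C \<in> inverse_pair_classes (Out (grp M))" if "C \<in> F ` ?Iso" for C
      using that F_presents(2) by blast
    fix C assume "C \<in> inverse_pair_classes (Out (grp M))"
    then obtain x where x: "x \<in> carrier (Out (grp M))" "finite_order (Out (grp M)) x"
      "C = conj_class (Out (grp M)) {x, inv\<^bsub>Out (grp M)\<^esub> x}"
      unfolding inverse_pair_classes_def by blast
    obtain \<theta> and k :: nat and m0 where \<theta>: "\<theta> \<in> auto (grp M)" "x = Inn (grp M) #>\<^bsub>AutoGroup (grp M)\<^esub> \<theta>"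
      and k: "k > 0" "m0 \<in> M"
      and inner: "\<And>g. g \<in> M \<Longrightarrow> (\<theta> ^^ k) g = m0 \<otimes>\<^bsub>grp M\<^esub> g \<otimes>\<^bsub>grp M\<^esub> inv\<^bsub>grp M\<^esub> m0"
      using finite_order_outer_lift[OF M.grp x(1,2)] by auto
    have inner': "(\<theta> ^^ k) g = m0 \<circ> g \<circ> inv_isom m0" if "g \<in> M" for g
      using inner[OF that] M.isom.m_inv_consistent[OF M.subgp k(2)] by simp
    have card: "CARD('n) = CARD('m) + 1" using assms(1-3) by simp
    obtain \<Gamma> :: "'n selfmap set" and N e \<gamma> \<alpha> where \<Gamma>: "crystal_group \<Gamma>"
      and ext: "cyclic_ext (grp \<Gamma>) N e \<gamma>" and ni: "normal_iso N (grp \<Gamma>) (grp M) \<alpha>"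
      and tr: "transport N M \<alpha> (conj_aut (grp \<Gamma>) N \<gamma>) = \<theta>"
      using M.realise_automorphism[OF card \<theta>(1) k inner'] by blast
    interpret o: group_hom "grp \<Gamma>" "Out (grp M)" "out_map (grp \<Gamma>) N (grp M) \<alpha>"
      by (rule normal_iso.out_map_group_hom[OF ni])
    have "grp \<Gamma> Mod N \<cong> grp \<Delta>"
      by (rule cyclic_ext_quotient_iso[OF ext D.grp assms(6) inf\<Delta>])
    moreover have "grp N \<cong> grp M" using normal_iso.iso[OF ni] by (auto intro: is_isoI)
    ultimately have P: "(\<Gamma>, N) \<in> iso_pairs \<Delta> M"
      using \<Gamma> cyclic_extD(6)[OF ext] by (simp add: iso_pairs_def space_group_iff)
    have "out_map (grp \<Gamma>) N (grp M) \<alpha> \<gamma> = x" using tr \<theta>(2) by (simp add: out_map_def)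
    then have "C = out_class \<Gamma> N M \<alpha> \<gamma>"
      using o.hom_inv[OF cyclic_extD(3)[OF ext]] x(3) by (simp add: out_class_def)
    then have "presents M (iso_class \<Delta> M \<Gamma> N) C"
      unfolding presents_def using class_mem(2)[OF P] ext ni by blast
    then have "F (iso_class \<Delta> M \<Gamma> N) = C" by (rule F_eq[OF class_mem(1)[OF P]])
    then show "C \<in> F ` ?Iso" using class_mem(1)[OF P] by blast
  qed
  ultimately have "bij_betw F ?Iso (inverse_pair_classes (Out (grp M)))" by (simp add: bij_betw_def)
  moreover have "F (iso_class \<Delta> M \<Gamma> N) = conj_class (Out (grp M))
      {transport N M \<alpha> (conj_aut (grp \<Gamma>) N \<gamma>) <#\<^bsub>AutoGroup (grp M)\<^esub> Inn (grp M),
       transport N M \<alpha> (inv\<^bsub>AutoGroup (grp N)\<^esub> (conj_aut (grp \<Gamma>) N \<gamma>)) <#\<^bsub>AutoGroup (grp M)\<^esub> Inn (grp M)}"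
    if P: "(\<Gamma>, N) \<in> iso_pairs \<Delta> M" and \<alpha>: "\<alpha> \<in> iso (grp N) (grp M)" and \<gamma>: "\<gamma> \<in> \<Gamma>"
      and gen: "generate (grp \<Gamma> Mod N) {N #>\<^bsub>grp \<Gamma>\<^esub> \<gamma>} = carrier (grp \<Gamma> Mod N)"
    for \<Gamma> N :: "'n selfmap set" and \<alpha> \<gamma>
  proof -
    note D = iso_pairsD[OF P]
    have ni: "normal_iso N (grp \<Gamma>) (grp M) \<alpha>" by (rule iso_pairs_normal_iso[OF P M.grp \<alpha>])
    interpret A: normal_iso N "grp \<Gamma>" "grp M" \<alpha> by fact
    obtain e where ext: "cyclic_ext (grp \<Gamma>) N e \<gamma>"
      using cyclic_ext_of_generate[OF D(2) _ cyclic_ext_exists(1)[OF D(2,4) D.grp assms(6) inf\<Delta>] gen] \<gamma> by auto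
    have \<gamma>': "\<gamma> \<in> carrier (grp \<Gamma>)" using \<gamma> by simp
    have "presents M (iso_class \<Delta> M \<Gamma> N) (out_class \<Gamma> N M \<alpha> \<gamma>)"
      unfolding presents_def using class_mem(2)[OF P] ext ni by blast
    then have "F (iso_class \<Delta> M \<Gamma> N) = out_class \<Gamma> N M \<alpha> \<gamma>"
      by (rule F_eq[OF class_mem(1)[OF P]])
    \<comment> \<open>The statement inverts the automorphism, while \<open>out_class\<close> inverts
      the element; conjugation is a homomorphism, so both give the same.\<close>
    moreover have "inv\<^bsub>AutoGroup (grp N)\<^esub> (conj_aut (grp \<Gamma>) N \<gamma>) = conj_aut (grp \<Gamma>) N (inv\<^bsub>grp \<Gamma>\<^esub> \<gamma>)"
      using A.inv_conj_aut[OF \<gamma>'] by simp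
    ultimately show ?thesis
      using A.out_map_eq_l_coset[OF \<gamma>'] A.out_map_eq_l_coset[OF A.inv_closed[OF \<gamma>']]
      by (simp add: out_class_def)
  qed
  ultimately show ?thesis by (intro exI[of _ F] conjI allI impI) (simp, blast)
qed

end
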